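(* Let $L\in A_{1,2}(\omega)$, where $\omega=\operatorname{diag}\{\omega_1,\dots,\omega_m\}\in\mathcal D$. Then $$\alpha_n^{(s)}=\frac{2}{\pi}I^{(s)}+K_n,\quad s=1,\dots,p,\ n\ge0,$$ $$(I_m-I^{(s)})\alpha_{nq}=K_n,\quad n\ge0,\ s=1,\dots,p,\ q\in J_s.$$
   Context: Notation. $m\ge1$ is fixed; $I_m,0_m$ are the identity and zero $m\times m$ matrices; $\|A\|=\max_j\sum_k|a_{jk}|$. $\{\kappa_n\}$ denotes (various, possibly different at each occurrence and for each $q$) sequences from $l_2$; $\{K_n\}$ denotes various (possibly different at each occurrence) sequences of $m\times m$ matrices whose norms form a sequence from $l_2$. $\sqrt\lambda$ is chosen with $\mathrm{Re}\,\sqrt\lambda\ge0$. $\mathcal D$ is the set of complex diagonal $m\times m$ matrices. Problem $L$. For an $m\times m$ matrix function $Q$ with complex-valued entries in $L_2(0,\pi)$ and $h,H\in\mathbb C^{m\times m}$, $L=L(Q,h,H)$ is the boundary value problem $-Y''+Q(x)Y=\lambda Y$, $x\in(0,\pi)$, $U(Y):=Y'(0)-hY(0)=0$, $V(Y):=Y'(\pi)+HY(\pi)=0$. Let $\varphi(x,\lambda)$ be the $m\times m$ matrix solution with $\varphi(0,\lambda)=I_m$, $\varphi'(0,\lambda)=h$. The characteristic function is $\Delta(\lambda)=\det V(\varphi(\cdot,\lambda))$; its zeros are the eigenvalues of $L$. Let $\Phi(x,\lambda)$ be the matrix solution with $U(\Phi)=I_m$, $V(\Phi)=0_m$; $M(\lambda)=\Phi(0,\lambda)$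 is the Weyl matrix, meromorphic with poles at eigenvalues of $L$. $L\in A(\omega)$ means that the potential is in $L_2(0,\pi)$ and $h+H+\frac12\int_0^\pi Q(x)\,dx=\omega$. For $L\in A(\omega)$, $\omega\in\mathcal D$, the eigenvalues, counted with their multiplicities as zeros of $\Delta$, are indexed as $\{\lambda_{nq}\}_{n\ge0,\,q=1,\dots,m}$ so that $\sqrt{\lambda_{nq}}=n+\frac{\omega_q}{\pi n}+\frac{\kappa_n}{n}$ for $n\ge1$ (this is possible). Put $\alpha_{nq}=\operatorname{Res}_{\lambda=\lambda_{nq}}M(\lambda)$. $L\in A_{1,2}(\omega)$ means: $L\in A(\omega)$; all poles of $M(\lambda)$ are simple; and $\|\alpha_{nq}\|\le C$ for all $n,q$. Grouped weights. Choose for each distinct value in $\{\lambda_{nq}\}$ one representing index pair, giving $\{(n_k,q_k)\}_{k\ge0}$; put $\alpha'_{n_kq_k}=\alpha_{n_kq_k}$ and $\alpha'_{nq}=0_m$ for all other $(n,q)$. Let $1=m_1<\dots<m_p$ be such that $\omega_{m_1},\dots,\omega_{m_p}$ are all the distinct values among $\omega_1,\dots,\omega_m$; $J_s=\{q:\omega_q=\omega_{m_s}\}$; $\alpha_n^{(s)}=\sum_{q\in J_s}\alpha'_{nq}$; $I^{(s)}$ is the diagonal matrix with $I^{(s)}_{jj}=1$ for $j\in J_s$ and all other entries zero. *)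

theory Defs
  imports "HOL-Complex_Analysis.Complex_Analysis"
begin

text \<open>
  A problem \<open>L(Q,h,H)\<close> is represented by its three data. The finite index type \<open>'m\<close> plays the
  role of \<open>{1,...,m}\<close>; the components \<open>\<omega>\<^sub>q\<close> are given by a function \<open>w :: 'm \<Rightarrow> complex\<close>.
\<close>

definition mnorm :: "complex^'m^'m \<Rightarrow> real" where
  "mnorm A = (MAX j. \<Sum>k\<in>UNIV. norm (A $ j $ k))"

definition diag_mat :: "('m \<Rightarrow> complex) \<Rightarrow> complex^'m^'m" where
  "diag_mat w = (\<chi> j k. if j = k then w j else 0)"

definition l2_scalar :: "(nat \<Rightarrow> complex) \<Rightarrow> bool" where
  "l2_scalar \<kappa> \<longleftrightarrow> summable (\<lambda>n. (norm (\<kappa> n))\<^sup>2)"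

definition l2_matrix :: "(nat \<Rightarrow> complex^'m^'m) \<Rightarrow> bool" where
  "l2_matrix K \<longleftrightarrow> summable (\<lambda>n. (mnorm (K n))\<^sup>2)"

definition L2_potential :: "(real \<Rightarrow> complex^'m^'m) \<Rightarrow> bool" where
  "L2_potential Q \<longleftrightarrow> (\<forall>j k.
     (\<lambda>x. Q x $ j $ k) \<in> borel_measurable (lebesgue_on {0..pi}) \<and>
     integrable (lebesgue_on {0..pi}) (\<lambda>x. (norm (Q x $ j $ k))\<^sup>2))"

definition abs_cont_on :: "real \<Rightarrow> real \<Rightarrow> (real \<Rightarrow> 'a::real_normed_vector) \<Rightarrow> bool" where
  "abs_cont_on a b f \<longleftrightarrow> (\<forall>e>0. \<exists>d>0. \<forall>S :: (real \<times> real) set.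
     finite S \<longrightarrow> (\<forall>(s,t)\<in>S. a \<le> s \<and> s \<le> t \<and> t \<le> b) \<longrightarrow>
     pairwise (\<lambda>(s,t) (s',t'). {s<..<t} \<inter> {s'<..<t'} = {}) S \<longrightarrow>
     (\<Sum>(s,t)\<in>S. t - s) < d \<longrightarrow> (\<Sum>(s,t)\<in>S. norm (f t - f s)) < e)"

text \<open>Derivative on \<open>[0,\<pi>]\<close>, one-sided at the end points.\<close>

definition D :: "(real \<Rightarrow> complex^'m^'m) \<Rightarrow> real \<Rightarrow> complex^'m^'m" where
  "D Y x = vector_derivative Y (at x within {0..pi})"

text \<open>
  Since \<open>Q\<close> is only square integrable, solutions of \<open>-Y'' + Q Y = \<lambda> Y\<close> are Caratheodory solutions:
  \<open>Y'\<close> exists on \<open>[0,\<pi>]\<close> and is absolutely continuous, and the equation holds almost everywhere.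
  The scalar multiple \<open>\<lambda> Y\<close> is written \<open>mat \<lambda> ** Y\<close>. Solutions are unique (given the side
  conditions below) only as functions on \<open>[0,\<pi>]\<close>, and are only evaluated there.
\<close>

definition solution :: "(real \<Rightarrow> complex^'m^'m) \<Rightarrow> complex \<Rightarrow> (real \<Rightarrow> complex^'m^'m) \<Rightarrow> bool" where
  "solution Q lam Y \<longleftrightarrow>
     Y differentiable_on {0..pi} \<and> abs_cont_on 0 pi (D Y) \<and>
     (AE x in lebesgue_on {0..pi}. \<exists>Y2. (D Y has_vector_derivative Y2) (at x) \<and>
        - Y2 + Q x ** Y x = mat lam ** Y x)"

definition U :: "complex^'m^'m \<Rightarrow> (real \<Rightarrow> complex^'m^'m) \<Rightarrow> complex^'m^'m" where
  "U h Y = D Y 0 - h ** Y 0"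

definition V :: "complex^'m^'m \<Rightarrow> (real \<Rightarrow> complex^'m^'m) \<Rightarrow> complex^'m^'m" where
  "V H Y = D Y pi + H ** Y pi"

definition phi ::
  "(real \<Rightarrow> complex^'m^'m) \<Rightarrow> complex^'m^'m \<Rightarrow> complex \<Rightarrow> real \<Rightarrow> complex^'m^'m" where
  "phi Q h lam = (SOME Y. solution Q lam Y \<and> Y 0 = mat 1 \<and> D Y 0 = h)"

definition Delta ::
  "(real \<Rightarrow> complex^'m^'m) \<Rightarrow> complex^'m^'m \<Rightarrow> complex^'m^'m \<Rightarrow> complex \<Rightarrow> complex" where
  "Delta Q h H lam = det (V H (phi Q h lam))"

text \<open>
  At the eigenvalues the Weyl solution does not exist and \<open>Phi\<close> is arbitrary there; poles, their
  orders and residues depend only on the values in punctured neighbourhoods.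
\<close>

definition Phi ::
  "(real \<Rightarrow> complex^'m^'m) \<Rightarrow> complex^'m^'m \<Rightarrow> complex^'m^'m \<Rightarrow> complex \<Rightarrow> real \<Rightarrow> complex^'m^'m"
  where
  "Phi Q h H lam = (SOME Y. solution Q lam Y \<and> U h Y = mat 1 \<and> V H Y = 0)"

definition Weyl ::
  "(real \<Rightarrow> complex^'m^'m) \<Rightarrow> complex^'m^'m \<Rightarrow> complex^'m^'m \<Rightarrow> complex \<Rightarrow> complex^'m^'m" where
  "Weyl Q h H lam = Phi Q h H lam 0"

definition matrix_residue :: "(complex \<Rightarrow> complex^'m^'m) \<Rightarrow> complex \<Rightarrow> complex^'m^'m" where
  "matrix_residue F z = (\<chi> j k. residue (\<lambda>lam. F lam $ j $ k) z)"

text \<open>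
  A matrix function has a pole where some entry has one, and the order of the pole is the
  largest order among the entries.
\<close>

definition all_poles_simple :: "(complex \<Rightarrow> complex^'m^'m) \<Rightarrow> bool" where
  "all_poles_simple F \<longleftrightarrow> (\<forall>z j k. is_pole (\<lambda>lam. F lam $ j $ k) z \<longrightarrow>
     zorder (\<lambda>lam. F lam $ j $ k) z = -1)"

definition in_A ::
  "(real \<Rightarrow> complex^'m^'m) \<Rightarrow> complex^'m^'m \<Rightarrow> complex^'m^'m \<Rightarrow> complex^'m^'m \<Rightarrow> bool" where
  "in_A Q h H \<omega> \<longleftrightarrow> L2_potential Q \<and> h + H + (1/2) *\<^sub>R integral {0..pi} Q = \<omega>"

text \<open>
  Each zero of the characteristic function occurs in the family as often as its multiplicity, and
  nothing else occurs. The principal root \<open>csqrt\<close> has nonnegative real part.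
\<close>

definition eigenvalue_indexing ::
  "(real \<Rightarrow> complex^'m^'m) \<Rightarrow> complex^'m^'m \<Rightarrow> complex^'m^'m \<Rightarrow> ('m \<Rightarrow> complex) \<Rightarrow>
   (nat \<Rightarrow> 'm \<Rightarrow> complex) \<Rightarrow> bool" where
  "eigenvalue_indexing Q h H w lam \<longleftrightarrow>
     (\<forall>n q. Delta Q h H (lam n q) = 0) \<and>
     (\<forall>z. Delta Q h H z = 0 \<longrightarrow>
        finite {(n,q). lam n q = z} \<and>
        int (card {(n,q). lam n q = z}) = zorder (Delta Q h H) z) \<and>
     (\<forall>q. \<exists>\<kappa>. l2_scalar \<kappa> \<and> (\<forall>n\<ge>1. csqrt (lam n q) =
        of_nat n + w q / (of_real pi * of_nat n) + \<kappa> n / of_nat n))"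

definition alpha ::
  "(real \<Rightarrow> complex^'m^'m) \<Rightarrow> complex^'m^'m \<Rightarrow> complex^'m^'m \<Rightarrow> (nat \<Rightarrow> 'm \<Rightarrow> complex) \<Rightarrow>
   nat \<Rightarrow> 'm \<Rightarrow> complex^'m^'m" where
  "alpha Q h H lam n q = matrix_residue (Weyl Q h H) (lam n q)"

definition in_A12 ::
  "(real \<Rightarrow> complex^'m^'m) \<Rightarrow> complex^'m^'m \<Rightarrow> complex^'m^'m \<Rightarrow> complex^'m^'m \<Rightarrow>
   (nat \<Rightarrow> 'm \<Rightarrow> complex) \<Rightarrow> bool" where
  "in_A12 Q h H \<omega> lam \<longleftrightarrow> in_A Q h H \<omega> \<and> all_poles_simple (Weyl Q h H) \<and>
     (\<exists>C. \<forall>n q. mnorm (alpha Q h H lam n q) \<le> C)"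

text \<open>\<open>R\<close> contains exactly one index pair for every distinct value of \<open>lam\<close>.\<close>

definition representatives :: "(nat \<Rightarrow> 'm \<Rightarrow> complex) \<Rightarrow> (nat \<times> 'm) set \<Rightarrow> bool" where
  "representatives lam R \<longleftrightarrow>
     bij_betw (\<lambda>(n,q). lam n q) R (range (\<lambda>(n,q). lam n q))"

definition alpha' ::
  "(real \<Rightarrow> complex^'m^'m) \<Rightarrow> complex^'m^'m \<Rightarrow> complex^'m^'m \<Rightarrow> (nat \<Rightarrow> 'm \<Rightarrow> complex) \<Rightarrow>
   (nat \<times> 'm) set \<Rightarrow> nat \<Rightarrow> 'm \<Rightarrow> complex^'m^'m" where
  "alpha' Q h H lam R n q = (if (n,q) \<in> R then alpha Q h H lam n q else 0)"

text \<open>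
  \<open>ms 1, ..., ms p\<close> are indices at which \<open>w\<close> takes each of its distinct values exactly once.
  The index type carries no order, so any choice of such indices is allowed.
\<close>

definition distinct_value_indices :: "('m \<Rightarrow> complex) \<Rightarrow> nat \<Rightarrow> (nat \<Rightarrow> 'm) \<Rightarrow> bool" where
  "distinct_value_indices w p ms \<longleftrightarrow> bij_betw (\<lambda>s. w (ms s)) {1..p} (range w)"

definition J :: "('m \<Rightarrow> complex) \<Rightarrow> (nat \<Rightarrow> 'm) \<Rightarrow> nat \<Rightarrow> 'm set" where
  "J w ms s = {q. w q = w (ms s)}"

definition alpha_group ::
  "(real \<Rightarrow> complex^'m^'m) \<Rightarrow> complex^'m^'m \<Rightarrow> complex^'m^'m \<Rightarrow> ('m \<Rightarrow> complex) \<Rightarrow>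
   (nat \<Rightarrow> 'm \<Rightarrow> complex) \<Rightarrow> (nat \<times> 'm) set \<Rightarrow> (nat \<Rightarrow> 'm) \<Rightarrow> nat \<Rightarrow> nat \<Rightarrow> complex^'m^'m" where
  "alpha_group Q h H w lam R ms s n = (\<Sum>q\<in>J w ms s. alpha' Q h H lam R n q)"

definition I_group :: "('m \<Rightarrow> complex) \<Rightarrow> (nat \<Rightarrow> 'm) \<Rightarrow> nat \<Rightarrow> complex^'m^'m" where
  "I_group w ms s = diag_mat (\<lambda>j. if j \<in> J w ms s then 1 else 0)"

end

theory Submission
  imports Defs
begin

text \<open>Write \<open>\<lambda> = n\<^sup>2 + \<mu>\<close> with \<open>\<mu>\<close> in a fixed disc. Let \<open>S\<close> be the matrix solution with \<open>S(0) = 0\<close>,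
\<open>S'(0) = I\<close>. The Weyl solution is \<open>S + \<phi> M(\<lambda>)\<close>, so off the eigenvalues \<open>V(\<phi>) M(\<lambda>) = - V(S)\<close>
(\<open>Weyl_equation\<close>), where \<open>V(\<phi>)\<close> and \<open>V(S)\<close> are entire in \<open>\<lambda>\<close> (\<open>boundary_value_holomorphic\<close>).
Everything follows from the behaviour of these two matrices for large \<open>n\<close>
(\<open>boundary_value_l2_asymptotics\<close>):
\<open>(-1)\<^sup>n V(\<phi>) = \<omega> - (\<pi> \<mu> / 2) I + K\<^sub>n\<close> and \<open>(-1)\<^sup>n V(S) = I + K\<^sub>n\<close>, with errors bounded uniformly in
\<open>\<mu>\<close> by a square summable sequence.

These asymptotics come from rewriting the equation as \<open>Y'' + n\<^sup>2 Y = (Q - \<mu>) Y\<close> and varying the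
constants with the integer frequency \<open>n\<close>: a solution is \<open>cos n x\<close> up to \<open>O(1/n)\<close>, and inserting this
into the formula for \<open>Y'(\<pi>)\<close> leaves \<open>\<integral> cos\<^sup>2 n t (Q - \<mu>) dt\<close>, that is a mean value, which contributes to
\<open>\<omega>\<close>, and half of the Fourier coefficient \<open>\<integral> cos 2 n t Q dt\<close>, which is square summable by Bessel's
inequality. The square root of \<open>\<lambda>\<close> enters only through the asymptotics of the given eigenvalues, which
say that \<open>\<lambda>\<^sub>n\<^sub>q - n\<^sup>2 - 2 \<omega>\<^sub>q / \<pi>\<close> is square summable (\<open>eigenvalue_l2_asymptotics\<close>).

For the first claim take the circle of a small fixed radius about \<open>n\<^sup>2 + 2 \<omega>\<^sub>q / \<pi>\<close>, \<open>q \<in> J\<^sub>s\<close>. For large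
\<open>n\<close> it encloses the eigenvalues of the \<open>s\<close>-th group and no others, so \<open>\<alpha>\<^sub>n\<^sup>(\<^sup>s\<^sup>)\<close> is the contour mean of
\<open>M\<close>. On the circle \<open>M = ((\<pi> \<mu> / 2) I - \<omega>)\<inverse> + K\<^sub>n\<close>, and the contour mean of the diagonal matrix is
\<open>(2 / \<pi>) I\<^sup>(\<^sup>s\<^sup>)\<close>. For the second claim, simplicity of the poles gives \<open>V(\<phi>) \<alpha>\<^sub>n\<^sub>q = 0\<close> at
\<open>\<lambda> = \<lambda>\<^sub>n\<^sub>q\<close> (\<open>boundary_value_mult_residue\<close>), hence \<open>(\<omega> - \<omega>\<^sub>q I) \<alpha>\<^sub>n\<^sub>q = K\<^sub>n \<alpha>\<^sub>n\<^sub>q\<close>, which is square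
summable because the \<open>\<alpha>\<^sub>n\<^sub>q\<close> are bounded; the rows outside \<open>J\<^sub>s\<close> are those with \<open>\<omega>\<^sub>j \<noteq> \<omega>\<^sub>q\<close>.

Since \<open>Q\<close> is only square integrable, solutions are understood in the sense of Caratheodory. The
passage between them and an integral system rests on two facts about absolutely continuous functions:
the fundamental theorem of calculus for derivatives that exist almost everywhere
(\<open>abs_cont_has_integral\<close>), and Lebesgue's differentiation theorem
(\<open>indefinite_integral_has_vector_derivative_ae\<close>).\<close>

section \<open>Absolutely continuous functions\<close>

lemma sum_disjoint_interval_lengths_le:
  assumes "finite S" "T \<in> lmeasurable"
    and "\<And>s t. (s, t) \<in> S \<Longrightarrow> s \<le> t \<and> {s<..<t} \<subseteq> T"
    and "pairwise (\<lambda>(s,t) (s',t'). {s<..<t} \<inter> {s'<..<t'} = {}) S"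
  shows "(\<Sum>(s,t)\<in>S. t - s) \<le> measure lebesgue T"
proof -
  define I where "I = (\<lambda>(s::real, t). {s<..<t})"
  have lm: "I i \<in> lmeasurable" for i
    by (cases i) (simp add: I_def)
  have "(\<Sum>(s,t)\<in>S. t - s) = (\<Sum>i\<in>S. measure lebesgue (I i))"
    using assms(3) by (intro sum.cong) (auto simp: I_def)
  also have "\<dots> = measure lebesgue (\<Union>i\<in>S. I i)"
    using assms(1,4) lm
    by (intro measure_UNION'[symmetric]) (auto simp: I_def disjnt_def case_prod_unfold)
  also have "\<dots> \<le> measure lebesgue T"
    using assms(1-3) lm by (intro measure_mono_fmeasurable) (auto simp: I_def intro!: fmeasurableD fmeasurable.finite_UN)
  finally show ?thesis .
qed

text \<open>The systems of intervals over which \<open>abs_cont_on\<close> quantifies, so that its side conditions can be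
passed around as one fact.\<close>

definition interval_family :: "real \<Rightarrow> real \<Rightarrow> (real \<times> real) set \<Rightarrow> bool" where
  "interval_family a b S \<longleftrightarrow> finite S \<and> (\<forall>(s,t)\<in>S. a \<le> s \<and> s \<le> t \<and> t \<le> b) \<and>
     pairwise (\<lambda>(s,t) (s',t'). {s<..<t} \<inter> {s'<..<t'} = {}) S"

lemma interval_familyD:
  assumes "interval_family a b S"
  shows "finite S" "(s,t) \<in> S \<Longrightarrow> a \<le> s" "(s,t) \<in> S \<Longrightarrow> s \<le> t" "(s,t) \<in> S \<Longrightarrow> t \<le> b"
    "(s,t) \<in> S \<Longrightarrow> (s',t') \<in> S \<Longrightarrow> (s,t) \<noteq> (s',t') \<Longrightarrow> {s<..<t} \<inter> {s'<..<t'} = {}"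
  using assms unfolding interval_family_def pairwise_def by blast+

lemma abs_cont_on_iff:
  "abs_cont_on a b f \<longleftrightarrow> (\<forall>e>0. \<exists>d>0. \<forall>S. interval_family a b S \<longrightarrow>
     (\<Sum>(s,t)\<in>S. t - s) < d \<longrightarrow> (\<Sum>(s,t)\<in>S. norm (f t - f s)) < e)"
  unfolding abs_cont_on_def interval_family_def by (simp only: imp_conjL)

text \<open>The fundamental theorem of calculus for absolutely continuous functions, by a gauge argument. At tags
outside \<open>N\<close> the gauge comes from differentiability. At tags in \<open>N\<close> it is an open set of small measure
containing \<open>N\<close>; the intervals with such tags have small total length, and absolute continuity makes the
increments of \<open>F\<close> over them small in sum.\<close>

lemma abs_cont_has_integral:
  fixes F :: "real \<Rightarrow> 'a::real_normed_vector"
  assumes ab: "a \<le> b" and ac: "abs_cont_on a b F" and N: "negligible N"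
    and der: "\<And>x. x \<in> {a..b} - N \<Longrightarrow> (F has_vector_derivative f x) (at x within {a..b})"
  shows "(f has_integral (F b - F a)) {a..b}"
proof -
  define g where "g x = (if x \<in> N then 0 else f x)" for x
  have "(g has_integral (F b - F a)) {a..b}"
    unfolding has_integral_real
  proof (intro allI impI)
    fix e :: real assume e: "e > 0"
    define \<eta> where "\<eta> = e / (2 * (b - a + 1))"
    have \<eta>: "\<eta> > 0" "\<eta> * (b - a) < e / 2" using e ab by (auto simp: \<eta>_def field_simps)
    obtain d where d: "d > 0" and acd: "\<And>S. interval_family a b S \<Longrightarrow>
       (\<Sum>(s,t)\<in>S. t - s) < d \<Longrightarrow> (\<Sum>(s,t)\<in>S. norm (F t - F s)) < e / 2"
      using ac e unfolding abs_cont_on_iff by (metis half_gt_zero)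
    have Nm: "N \<in> lmeasurable" "measure lebesgue N = 0"
      using N by (auto simp: negligible_iff_measure)
    obtain T where T0: "open T" "N \<subseteq> T" "T - N \<in> lmeasurable" "emeasure lebesgue (T - N) < ennreal d"
      using sets_lebesgue_outer_open[of N d] Nm(1) d by blast
    have "T = (T - N) \<union> N" using T0 by blast
    then have "T \<in> lmeasurable" "measure lebesgue T \<le> measure lebesgue (T - N) + measure lebesgue N"
      using T0(3) Nm measure_Un_le[of "T - N" lebesgue N] by (auto intro: fmeasurable.Un dest!: fmeasurableD, metis fmeasurable.Un)
    moreover have "measure lebesgue (T - N) < d"
      using T0(3,4) d by (simp add: emeasure_eq_measure2 ennreal_less_iff)
    ultimately have T: "open T" "N \<subseteq> T" "T \<in> lmeasurable" "measure lebesgue T < d"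
      using T0 Nm by auto
    have "\<exists>\<delta>>0. x \<in> {a..b} - N \<longrightarrow> (\<forall>y\<in>{a..b}. norm (y - x) < \<delta> \<longrightarrow>
        norm (F y - F x - (y - x) *\<^sub>R f x) \<le> \<eta> * norm (y - x))" for x
    proof (cases "x \<in> {a..b} - N")
      case True
      then show ?thesis
        using der[OF True] \<eta>(1) unfolding has_vector_derivative_def has_derivative_within_alt by blast
    qed (auto intro: exI[of _ 1])
    then obtain \<delta> where \<delta>: "\<And>x. \<delta> x > 0"
      and \<delta>F: "\<And>x y. x \<in> {a..b} - N \<Longrightarrow> y \<in> {a..b} \<Longrightarrow> norm (y - x) < \<delta> x \<Longrightarrow>
        norm (F y - F x - (y - x) *\<^sub>R f x) \<le> \<eta> * norm (y - x)"
      by metis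
    (* T is open, so it may serve as the gauge at every tag in N. *)
    define \<gamma> where "\<gamma> x = (if x \<in> N then T else ball x (\<delta> x))" for x
    have gauge: "gauge \<gamma>"
      using T \<delta> by (auto simp: gauge_def \<gamma>_def)
    have "norm ((\<Sum>(x,k)\<in>p. measure lborel k *\<^sub>R g x) - (F b - F a)) < e"
      if p: "p tagged_division_of {a..b}" and fine: "\<gamma> fine p" for p
    proof -
      note pD = tagged_division_ofD[OF p]
      have fin: "finite p" by (rule pD)
      have pk: "\<exists>u v. k = {u..v} \<and> Inf k = u \<and> Sup k = v \<and> measure lborel k = v - u \<and> u \<le> x \<and> x \<le> v \<and>
           a \<le> u \<and> v \<le> b" if xk: "(x,k) \<in> p" for x k
      proof -
        obtain u v where "k = cbox u v" using pD(4)[OF xk] by blast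
        moreover have "x \<in> k" "k \<subseteq> {a..b}" using pD(2,3)[OF xk] by auto
        ultimately show ?thesis
          by (intro exI[of _ u] exI[of _ v]) auto
      qed
      define h where "h = (\<lambda>(x,k). norm (measure lborel k *\<^sub>R g x - (F (Sup k) - F (Inf k))))"
      have "(\<Sum>(x,k)\<in>p. measure lborel k *\<^sub>R g x) - (F b - F a)
          = (\<Sum>(x,k)\<in>p. measure lborel k *\<^sub>R g x - (F (Sup k) - F (Inf k)))"
        using additive_tagged_division_1[OF ab p, of F]
        by (simp add: sum_subtractf case_prod_unfold)
      then have "norm ((\<Sum>(x,k)\<in>p. measure lborel k *\<^sub>R g x) - (F b - F a)) \<le> (\<Sum>i\<in>p. h i)"
        unfolding h_def by (auto intro!: order_trans[OF norm_sum] sum_mono)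
      also have "\<dots> = (\<Sum>i\<in>{i\<in>p. fst i \<notin> N}. h i) + (\<Sum>i\<in>{i\<in>p. fst i \<in> N}. h i)"
        using fin by (subst sum.union_disjoint[symmetric]) (auto intro!: sum.cong)
      also have "(\<Sum>i\<in>{i\<in>p. fst i \<notin> N}. h i) \<le> (\<Sum>(x,k)\<in>{i\<in>p. fst i \<notin> N}. \<eta> * measure lborel k)"
      proof (rule sum_mono)
        fix i assume i: "i \<in> {i\<in>p. fst i \<notin> N}"
        obtain x k where [simp]: "i = (x,k)" by (cases i)
        have xk: "(x,k) \<in> p" "x \<notin> N" using i by auto
        obtain u v where uv: "k = {u..v}" "Inf k = u" "Sup k = v" "measure lborel k = v - u" "u \<le> x" "x \<le> v" "a \<le> u" "v \<le> b"
          using pk[OF xk(1)] by blast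
        have "k \<subseteq> ball x (\<delta> x)" using fineD[OF fine xk(1)] xk(2) by (simp add: \<gamma>_def)
        then have "norm (u - x) < \<delta> x" "norm (v - x) < \<delta> x"
          using uv subsetD[of k "ball x (\<delta> x)" u] subsetD[of k "ball x (\<delta> x)" v]
          by (auto simp: dist_norm)
        moreover have "x \<in> {a..b} - N" "u \<in> {a..b}" "v \<in> {a..b}" using uv xk by auto
        ultimately have 1: "norm (F v - F x - (v - x) *\<^sub>R f x) \<le> \<eta> * (v - x)"
          and 2: "norm (F u - F x - (u - x) *\<^sub>R f x) \<le> \<eta> * (x - u)"
          using \<delta>F[of x u] \<delta>F[of x v] uv by auto
        have "measure lborel k *\<^sub>R g x - (F (Sup k) - F (Inf k)) =
            (F u - F x - (u - x) *\<^sub>R f x) - (F v - F x - (v - x) *\<^sub>R f x)"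
          using xk uv by (simp add: g_def algebra_simps)
        also have "norm \<dots> \<le> \<eta> * (v - u)"
          using 1 2 by (intro order_trans[OF norm_triangle_ineq4]) (simp add: algebra_simps)
        finally show "h i \<le> (case i of (x,k) \<Rightarrow> \<eta> * measure lborel k)"
          by (simp add: h_def uv(4))
      qed
      also have "\<dots> \<le> (\<Sum>(x,k)\<in>p. \<eta> * measure lborel k)"
        using fin \<eta> by (intro sum_mono2) (auto)
      also have "\<dots> = \<eta> * (b - a)"
        using additive_content_tagged_division[of p a b] p ab
        by (simp add: sum_distrib_left[symmetric] case_prod_unfold)
      also have "(\<Sum>i\<in>{i\<in>p. fst i \<in> N}. h i) < e / 2"
      proof -
        define E where "E = (\<lambda>(x::real, k::real set). (Inf k, Sup k))"
        (* Only intervals of positive length have nonempty interiors, and injectivity of E follows from their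
           disjointness; the other intervals contribute nothing. *)
        define P where "P = {i\<in>p. fst i \<in> N \<and> measure lborel (snd i) > 0}"
        have finP: "finite P" using fin by (auto simp: P_def)
        have inter: "{Inf k<..<Sup k} = interior k" if "(x,k) \<in> p" for x k
          using pk[OF that] by (metis interior_atLeastAtMost_real)
        have disj: "{Inf k<..<Sup k} \<inter> {Inf k'<..<Sup k'} = {}"
          if "(x,k) \<in> p" "(x',k') \<in> p" "(x,k) \<noteq> (x',k')" for x k x' k'
          using pD(5)[OF that] inter that by auto
        have ne: "{Inf k<..<Sup k} \<noteq> {}" if "(x,k) \<in> P" for x k
          using pk[of x k] that by (auto simp: P_def)
        have inj: "inj_on E P"
        proof (rule inj_onI)
          fix i j assume "i \<in> P" "j \<in> P" "E i = E j"
          then show "i = j"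
            using disj[of "fst i" "snd i" "fst j" "snd j"] ne[of "fst i" "snd i"]
            by (auto simp: E_def P_def case_prod_unfold)
        qed
        have pw: "pairwise (\<lambda>(s,t) (s',t'). {s<..<t} \<inter> {s'<..<t'} = {}) (E ` P)"
        proof -
          have "{Inf k<..<Sup k} \<inter> {Inf k'<..<Sup k'} = {}" if "(x,k) \<in> P" "(x',k') \<in> P"
            "E (x,k) \<noteq> E (x',k')" for x k x' k'
            using disj[of x k x' k'] that by (auto simp: P_def)
          then show ?thesis by (auto simp: pairwise_def E_def case_prod_unfold)
        qed
        have sub: "s \<le> t \<and> {s<..<t} \<subseteq> T" "a \<le> s \<and> s \<le> t \<and> t \<le> b" if st: "(s,t) \<in> E ` P" for s t
        proof -
          obtain i where i: "i \<in> P" "(s,t) = E i" using st by (auto simp: image_iff)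
          define x k where "x = fst i" and "k = snd i"
          have xk: "(x,k) \<in> p" "x \<in> N" "s = Inf k" "t = Sup k"
            using i by (auto simp: E_def P_def x_def k_def case_prod_unfold)
          have "k \<subseteq> T" using fineD[OF fine xk(1)] xk(2) by (simp add: \<gamma>_def)
          then show "s \<le> t \<and> {s<..<t} \<subseteq> T" "a \<le> s \<and> s \<le> t \<and> t \<le> b"
            using pk[OF xk(1)] xk by auto
        qed
        have ifam: "interval_family a b (E ` P)"
          unfolding interval_family_def using finP sub(2) pw by blast
        have "(\<Sum>(s,t)\<in>E ` P. t - s) \<le> measure lebesgue T"
          using finP T sub(1) pw by (intro sum_disjoint_interval_lengths_le) auto
        then have "(\<Sum>(s,t)\<in>E ` P. norm (F t - F s)) < e / 2"
          using T(4) by (intro acd ifam) auto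
        also have "(\<Sum>(s,t)\<in>E ` P. norm (F t - F s)) = (\<Sum>i\<in>P. norm (F (Sup (snd i)) - F (Inf (snd i))))"
          by (subst sum.reindex[OF inj]) (simp add: E_def case_prod_unfold)
        also have "\<dots> = (\<Sum>i\<in>P. h i)"
          by (intro sum.cong) (auto simp: h_def P_def g_def norm_minus_commute)
        also have "\<dots> = (\<Sum>i\<in>{i\<in>p. fst i \<in> N}. h i)"
        proof (rule sum.mono_neutral_left)
          show "finite {i \<in> p. fst i \<in> N}" "P \<subseteq> {i \<in> p. fst i \<in> N}" using fin by (auto simp: P_def)
          show "\<forall>i\<in>{i \<in> p. fst i \<in> N} - P. h i = 0"
          proof
            fix i assume i: "i \<in> {i \<in> p. fst i \<in> N} - P"
            obtain x k where [simp]: "i = (x,k)" by (cases i)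
            have "(x,k) \<in> p" "measure lborel k \<le> 0" using i by (auto simp: P_def)
            moreover from this have "Inf k = Sup k" "measure lborel k = 0" using pk[of x k] by auto
            ultimately show "h i = 0" by (simp add: h_def)
          qed
        qed
        finally show ?thesis .
      qed
      finally show ?thesis using \<eta> by simp
    qed
    note close = this
    show "\<exists>\<gamma>. gauge \<gamma> \<and> (\<forall>\<D>. \<D> tagged_division_of {a..b} \<and> \<gamma> fine \<D> \<longrightarrow>
        norm ((\<Sum>(x, k)\<in>\<D>. measure lborel k *\<^sub>R g x) - (F b - F a)) < e)"
      using gauge close by (intro exI[of _ \<gamma>]) simp
  qed
  then show ?thesis
    by (rule has_integral_spike[OF N, rotated]) (auto simp: g_def)
qed

lemma abs_cont_on_imp_continuous_on:
  assumes "abs_cont_on a b f"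
  shows "continuous_on {a..b} f"
  unfolding continuous_on_iff
proof (intro ballI allI impI)
  fix x and e :: real assume x: "x \<in> {a..b}" and e: "e > 0"
  obtain d where d: "d > 0" and dS: "\<And>S. interval_family a b S \<Longrightarrow>
       (\<Sum>(s,t)\<in>S. t - s) < d \<Longrightarrow> (\<Sum>(s,t)\<in>S. norm (f t - f s)) < e"
    using assms e unfolding abs_cont_on_iff by blast
  have "dist (f y) (f x) < e" if "y \<in> {a..b}" "dist y x < d" for y
    using dS[of "{(x, y)}"] dS[of "{(y, x)}"] x that
    by (cases "x \<le> y") (auto simp: dist_norm norm_minus_commute interval_family_def)
  then show "\<exists>d>0. \<forall>x'\<in>{a..b}. dist x' x < d \<longrightarrow> dist (f x') (f x) < e"
    using d by blast
qed

lemma abs_cont_on_subset: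
  assumes "abs_cont_on a b f" "a \<le> c" "d \<le> b"
  shows "abs_cont_on c d f"
proof -
  have "interval_family a b S" if "interval_family c d S" for S
    using that assms(2,3) unfolding interval_family_def by fastforce
  then show ?thesis using assms(1) unfolding abs_cont_on_iff by meson
qed

text \<open>The source of the closure properties that follow. With \<open>g = f\<close> and \<open>C = 1\<close> it also transfers absolute
continuity between functions with the same increments on \<open>[a,b]\<close>.\<close>

lemma abs_cont_on_dominated:
  assumes "abs_cont_on a b f" "abs_cont_on a b g" "C > 0"
    and le: "\<And>s t. a \<le> s \<Longrightarrow> s \<le> t \<Longrightarrow> t \<le> b \<Longrightarrow> norm (F t - F s) \<le> C * (norm (f t - f s) + norm (g t - g s))"
  shows "abs_cont_on a b F"
  unfolding abs_cont_on_iff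
proof (intro allI impI)
  fix e :: real assume "e > 0"
  then have e: "e / (2 * C) > 0" using assms(3) by simp
  obtain d1 where d1: "d1 > 0" "\<And>S. interval_family a b S \<Longrightarrow>
       (\<Sum>(s,t)\<in>S. t - s) < d1 \<Longrightarrow> (\<Sum>(s,t)\<in>S. norm (f t - f s)) < e / (2 * C)"
    using assms(1) e unfolding abs_cont_on_iff by blast
  obtain d2 where d2: "d2 > 0" "\<And>S. interval_family a b S \<Longrightarrow>
       (\<Sum>(s,t)\<in>S. t - s) < d2 \<Longrightarrow> (\<Sum>(s,t)\<in>S. norm (g t - g s)) < e / (2 * C)"
    using assms(2) e unfolding abs_cont_on_iff by blast
  have "(\<Sum>(s,t)\<in>S. norm (F t - F s)) < e"
    if S: "interval_family a b S" "(\<Sum>(s,t)\<in>S. t - s) < min d1 d2" for S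
  proof -
    have "(\<Sum>(s,t)\<in>S. norm (F t - F s)) \<le> (\<Sum>(s,t)\<in>S. C * (norm (f t - f s) + norm (g t - g s)))"
      using interval_familyD[OF S(1)] le by (intro sum_mono) auto
    also have "\<dots> = C * ((\<Sum>(s,t)\<in>S. norm (f t - f s)) + (\<Sum>(s,t)\<in>S. norm (g t - g s)))"
      by (simp add: sum_distrib_left[symmetric] sum.distrib case_prod_unfold)
    also have "\<dots> < C * (e / (2 * C) + e / (2 * C))"
      using S assms(3) by (intro mult_strict_left_mono add_strict_mono d1(2) d2(2)) auto
    also have "\<dots> = e" using assms(3) by simp
    finally show ?thesis .
  qed
  then show "\<exists>d>0. \<forall>S. interval_family a b S \<longrightarrow>
       (\<Sum>(s,t)\<in>S. t - s) < d \<longrightarrow> (\<Sum>(s,t)\<in>S. norm (F t - F s)) < e"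
    using d1(1) d2(1) by (intro exI[of _ "min d1 d2"]) auto
qed

lemma abs_cont_on_lipschitz:
  assumes "\<And>s t. a \<le> s \<Longrightarrow> s \<le> t \<Longrightarrow> t \<le> b \<Longrightarrow> norm (f t - f s) \<le> C * (t - s)"
  shows "abs_cont_on a b f"
proof -
  have id: "abs_cont_on a b (\<lambda>x::real. x)"
    unfolding abs_cont_on_iff
  proof (intro allI impI)
    fix e :: real assume "e > 0"
    have "(\<Sum>(s,t)\<in>S. norm (t - s :: real)) = (\<Sum>(s,t)\<in>S. t - s)" if "interval_family a b S" for S
      using interval_familyD(3)[OF that] by (intro sum.cong) auto
    then show "\<exists>d>0. \<forall>S. interval_family a b S \<longrightarrow>
       (\<Sum>(s,t)\<in>S. t - s) < d \<longrightarrow> (\<Sum>(s,t)\<in>S. norm (t - s)) < e"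
      using \<open>e > 0\<close> by (intro exI[of _ e]) auto
  qed
  show ?thesis
  proof (rule abs_cont_on_dominated[OF id id, where C = "\<bar>C\<bar> + 1"])
    fix s t assume st: "a \<le> s" "s \<le> t" "t \<le> b"
    have "norm (f t - f s) \<le> C * (t - s)" by (rule assms[OF st])
    also have "\<dots> \<le> (\<bar>C\<bar> + 1) * ((t - s) + (t - s))"
      using st by (intro mult_mono) auto
    finally show "norm (f t - f s) \<le> (\<bar>C\<bar> + 1) * (norm (t - s) + norm (t - s))"
      using st by simp
  qed auto
qed

lemma abs_cont_on_add:
  assumes "abs_cont_on a b f" "abs_cont_on a b g"
  shows "abs_cont_on a b (\<lambda>x. f x + g x)"
  by (rule abs_cont_on_dominated[OF assms, of 1]) (auto simp: add_diff_add norm_triangle_ineq)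

lemma abs_cont_on_bilinear:
  assumes "bounded_bilinear pr" "abs_cont_on a b f" "abs_cont_on a b g"
  shows "abs_cont_on a b (\<lambda>x. pr (f x) (g x))"
proof -
  interpret bounded_bilinear pr by fact
  obtain K where K: "K > 0" "\<And>x y. norm (pr x y) \<le> norm x * norm y * K"
    using pos_bounded by blast
  have "bounded (f ` {a..b})" "bounded (g ` {a..b})"
    using assms by (auto intro!: compact_imp_bounded compact_continuous_image abs_cont_on_imp_continuous_on)
  then obtain B C where B: "B > 0" "\<And>x. x \<in> {a..b} \<Longrightarrow> norm (f x) \<le> B"
    and C: "C > 0" "\<And>x. x \<in> {a..b} \<Longrightarrow> norm (g x) \<le> C"
    unfolding bounded_pos by (metis imageI)
  show ?thesis
  proof (rule abs_cont_on_dominated[OF assms(2,3), where C = "K * (B + C)"])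
    fix s t assume st: "a \<le> s" "s \<le> t" "t \<le> b"
    have "pr (f t) (g t) - pr (f s) (g s) = pr (f t - f s) (g t) + pr (f s) (g t - g s)"
      by (simp add: diff_left diff_right)
    also have "norm \<dots> \<le> norm (f t - f s) * norm (g t) * K + norm (f s) * norm (g t - g s) * K"
      by (intro order_trans[OF norm_triangle_ineq] add_mono K)
    also have "\<dots> \<le> norm (f t - f s) * (B + C) * K + (B + C) * norm (g t - g s) * K"
      using B C K st by (intro add_mono mult_right_mono mult_left_mono order_trans[OF B(2)] order_trans[OF C(2)]) auto
    finally show "norm (pr (f t) (g t) - pr (f s) (g s)) \<le> K * (B + C) * (norm (f t - f s) + norm (g t - g s))"
      by (simp add: algebra_simps)
  qed (use B C K in auto)
qed

text \<open>Young's inequality \<open>g \<le> \<epsilon> g\<^sup>2 + 1 / (4 \<epsilon>)\<close> bounds the sum of the increments by \<open>\<epsilon>\<close> times the integral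
of \<open>g\<^sup>2\<close> over \<open>[a,b]\<close> plus a multiple of the total length of the intervals.\<close>

lemma abs_cont_indefinite_integral:
  fixes f :: "real \<Rightarrow> 'a::euclidean_space"
  assumes f: "f integrable_on {a..b}" and g: "(\<lambda>x. (g x)\<^sup>2) integrable_on {a..b}"
    and le: "\<And>x. x \<in> {a..b} \<Longrightarrow> norm (f x) \<le> g x"
  shows "abs_cont_on a b (\<lambda>x. integral {a..x} f)"
unfolding abs_cont_on_iff
proof (intro allI impI)
  fix e :: real assume e: "e > 0"
  define A where "A = integral {a..b} (\<lambda>x. (g x)\<^sup>2)"
  have A: "A \<ge> 0" unfolding A_def by (rule integral_nonneg[OF g]) auto
  define \<epsilon> where "\<epsilon> = e / (2 * (A + 1))"
  have \<epsilon>: "\<epsilon> > 0" "\<epsilon> * A < e / 2" using e A by (auto simp: \<epsilon>_def field_simps)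
  have young: "norm (f x) \<le> \<epsilon> * (g x)\<^sup>2 + 1 / (4 * \<epsilon>)" if "x \<in> {a..b}" for x
  proof -
    have "0 \<le> (2 * \<epsilon> * g x - 1)\<^sup>2 / (4 * \<epsilon>)" using \<epsilon> by simp
    also have "\<dots> = \<epsilon> * (g x)\<^sup>2 + 1 / (4 * \<epsilon>) - g x"
      using \<epsilon> by (simp add: field_simps power2_eq_square)
    finally show ?thesis using le[OF that] by linarith
  qed
  have "(\<Sum>(s,t)\<in>S. norm (integral {a..t} f - integral {a..s} f)) < e"
    if S: "interval_family a b S" "(\<Sum>(s,t)\<in>S. t - s) < 2 * \<epsilon> * e" for S
  proof -
    (* The integrals over the single intervals are integrals over [a,b] of truncations of g^2, whose sum
       is at most g^2 because the intervals do not overlap. *)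
    define ch where "ch = (\<lambda>(s,t) x. if x \<in> {s<..<t} then (g x)\<^sup>2 else (0::real))"
    have hi: "(ch (s,t) has_integral integral {s..t} (\<lambda>x. (g x)\<^sup>2)) {a..b}" if "(s,t) \<in> S" for s t
    proof -
      have st: "a \<le> s" "s \<le> t" "t \<le> b" using interval_familyD[OF S(1)] that by auto
      have "((\<lambda>x. (g x)\<^sup>2) has_integral integral {s..t} (\<lambda>x. (g x)\<^sup>2)) {s<..<t}"
        using integrable_on_subinterval[OF g, of s t] st
        by (simp add: has_integral_Icc_iff_Ioo[symmetric] integrable_integral)
      then show ?thesis
        using has_integral_restrict[of "{s<..<t}" "{a..b}" "\<lambda>x. (g x)\<^sup>2"] st
        by (simp add: ch_def subset_iff)
    qed
    have "norm (integral {a..t} f - integral {a..s} f)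
        \<le> \<epsilon> * integral {s..t} (\<lambda>x. (g x)\<^sup>2) + (t - s) / (4 * \<epsilon>)" if "(s,t) \<in> S" for s t
    proof -
      have st: "a \<le> s" "s \<le> t" "t \<le> b" using interval_familyD[OF S(1)] that by auto
      have ft: "f integrable_on {a..t}" "f integrable_on {s..t}" "(\<lambda>x. (g x)\<^sup>2) integrable_on {s..t}"
        using f g st by (auto intro: integrable_on_subinterval)
      have "integral {a..t} f - integral {a..s} f = integral {s..t} f"
        using Henstock_Kurzweil_Integration.integral_combine[OF st(1,2) ft(1)] by (simp add: algebra_simps)
      also have "norm \<dots> \<le> integral {s..t} (\<lambda>x. \<epsilon> * (g x)\<^sup>2 + 1 / (4 * \<epsilon>))"
        using ft young st by (intro integral_norm_bound_integral integrable_add integrable_on_mult_right) auto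
      also have "\<dots> = \<epsilon> * integral {s..t} (\<lambda>x. (g x)\<^sup>2) + (t - s) / (4 * \<epsilon>)"
        using ft st by (subst Henstock_Kurzweil_Integration.integral_add) (auto intro: integrable_on_mult_right)
      finally show ?thesis .
    qed
    then have "(\<Sum>(s,t)\<in>S. norm (integral {a..t} f - integral {a..s} f))
        \<le> (\<Sum>(s,t)\<in>S. \<epsilon> * integral {s..t} (\<lambda>x. (g x)\<^sup>2) + (t - s) / (4 * \<epsilon>))"
      by (intro sum_mono) auto
    also have "\<dots> = \<epsilon> * (\<Sum>(s,t)\<in>S. integral {s..t} (\<lambda>x. (g x)\<^sup>2)) + (\<Sum>(s,t)\<in>S. t - s) / (4 * \<epsilon>)"
      by (simp add: sum.distrib sum_distrib_left sum_divide_distrib case_prod_unfold)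
    also have "(\<Sum>(s,t)\<in>S. integral {s..t} (\<lambda>x. (g x)\<^sup>2)) \<le> A"
      unfolding A_def
    proof (rule has_integral_le)
      show "((\<lambda>x. \<Sum>i\<in>S. ch i x) has_integral (\<Sum>(s,t)\<in>S. integral {s..t} (\<lambda>x. (g x)\<^sup>2))) {a..b}"
        using hi by (intro has_integral_sum interval_familyD(1)[OF S(1)]) auto
      show "((\<lambda>x. (g x)\<^sup>2) has_integral integral {a..b} (\<lambda>x. (g x)\<^sup>2)) {a..b}"
        using g by (rule integrable_integral)
      fix x
      show "(\<Sum>i\<in>S. ch i x) \<le> (g x)\<^sup>2"
      proof (cases "\<exists>i\<in>S. x \<in> {fst i<..<snd i}")
        case True
        then obtain i where i: "i \<in> S" "x \<in> {fst i<..<snd i}" by blast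
        have "ch j x = 0" if "j \<in> S - {i}" for j
          using interval_familyD(5)[OF S(1), of "fst i" "snd i" "fst j" "snd j"] i that
          by (auto simp: ch_def case_prod_unfold prod_eq_iff)
        then have "(\<Sum>j\<in>S. ch j x) = ch i x"
          using i interval_familyD(1)[OF S(1)] by (simp add: sum.remove)
        then show ?thesis by (simp add: ch_def case_prod_unfold)
      next
        case False
        then have "(\<Sum>j\<in>S. ch j x) = 0" by (intro sum.neutral) (auto simp: ch_def)
        then show ?thesis by simp
      qed
    qed
    also have "(\<Sum>(s,t)\<in>S. t - s) / (4 * \<epsilon>) < e / 2"
      using S(2) \<epsilon>(1) by (simp add: field_simps)
    finally show ?thesis using \<epsilon> by (simp add: mult_left_mono)
  qed
  then show "\<exists>d>0. \<forall>S. interval_family a b S \<longrightarrow>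
       (\<Sum>(s,t)\<in>S. t - s) < d \<longrightarrow> (\<Sum>(s,t)\<in>S. norm (integral {a..t} f - integral {a..s} f)) < e"
    using \<epsilon>(1) e by (intro exI[of _ "2 * \<epsilon> * e"]) auto
qed

text \<open>Lebesgue's differentiation theorem on an interval. The points at which the difference quotient misses
\<open>f x\<close> by more than \<open>1 / (k + 1)\<close> at arbitrarily small scales are Vitali covered by intervals that are
fine for the gauge of the Henstock lemma. A disjoint subfamily covers almost all of them; the Henstock
lemma bounds its total error, and each error exceeds a fixed multiple of the length of the interval, so
the total length is as small as desired.\<close>

lemma indefinite_integral_has_vector_derivative_ae:
  fixes f :: "real \<Rightarrow> 'a::euclidean_space"
  assumes f: "f integrable_on {a..b}"
  obtains N where "negligible N"
    "\<And>x. x \<in> {a<..<b} - N \<Longrightarrow> ((\<lambda>x. integral {a..x} f) has_vector_derivative f x) (at x)"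
proof -
  define F where "F x = integral {a..x} f" for x
  have Fdiff: "F v - F u = integral {u..v} f" if "a \<le> u" "u \<le> v" "v \<le> b" for u v
  proof -
    have "f integrable_on {a..v}" using that by (intro integrable_on_subinterval[OF f]) auto
    from Henstock_Kurzweil_Integration.integral_combine[OF that(1,2) this]
    show ?thesis by (simp add: F_def algebra_simps)
  qed
  define err where "err x y = norm (F y - F x - (y - x) *\<^sub>R f x)" for x y
  define E where "E k = {x \<in> {a<..<b}. \<forall>d>0. \<exists>y\<in>{a<..<b}. y \<noteq> x \<and> \<bar>y - x\<bar> < d \<and>
      \<bar>y - x\<bar> / real (Suc k) < err x y}" for k
  have "negligible (E k)" for k
    unfolding negligible_outer_le
  proof (intro allI impI)
    fix e :: real assume e: "e > 0"
    have f': "f integrable_on cbox a b" using f by simp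
    have e': "e / real (Suc k) > 0" using e by simp
    obtain \<gamma> where \<gamma>: "gauge \<gamma>"
      and hen: "\<And>p. \<lbrakk>p tagged_partial_division_of (cbox a b); \<gamma> fine p\<rbrakk> \<Longrightarrow>
             sum (\<lambda>(x,k). norm(measure lborel k *\<^sub>R f x - integral k f)) p < e / real (Suc k)"
      using Henstock_lemma[OF f' e'] by blast
    define seg where "seg = (\<lambda>(x::real, y). {min x y..max x y})"
    (* A pair (x,y) stands for the interval between x and y, tagged by its end point x. *)
    define K where "K = {(x,y). x \<in> {a<..<b} \<and> y \<in> {a<..<b} \<and> y \<noteq> x \<and> seg (x,y) \<subseteq> \<gamma> x \<and>
        \<bar>y - x\<bar> / real (Suc k) < err x y}"
    define mid where "mid = (\<lambda>(x::real, y). (x + y) / 2)"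
    define rad where "rad = (\<lambda>(x::real, y). \<bar>y - x\<bar> / 2)"
    have cball_seg: "cball (mid i) (rad i) = seg i" for i
      by (cases i) (auto simp: mid_def rad_def seg_def dist_real_def min_def max_def abs_if field_simps split: if_splits)
    obtain C where C: "countable C" "C \<subseteq> K"
      and pw: "pairwise (\<lambda>i j. disjnt (cball (mid i) (rad i)) (cball (mid j) (rad j))) C"
      and neg: "negligible (E k - (\<Union>i \<in> C. cball (mid i) (rad i)))"
    proof (rule Vitali_covering_theorem_cballs[of K rad "E k" mid])
      show "0 < rad i" if "i \<in> K" for i
        using that by (auto simp: K_def rad_def)
      show "\<exists>i. i \<in> K \<and> x \<in> cball (mid i) (rad i) \<and> rad i < d" if x: "x \<in> E k" and d: "d > 0" for x d
      proof -
        obtain \<rho> where \<rho>: "\<rho> > 0" "ball x \<rho> \<subseteq> \<gamma> x"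
          using \<gamma> unfolding gauge_def by (meson open_contains_ball)
        have "min \<rho> d > 0" using \<rho> d by simp
        then obtain y where y: "y \<in> {a<..<b}" "y \<noteq> x" "\<bar>y - x\<bar> < min \<rho> d" "\<bar>y - x\<bar> / real (Suc k) < err x y"
          using x unfolding E_def by blast
        have "seg (x,y) \<subseteq> ball x \<rho>"
          using y(3) by (auto simp: seg_def dist_real_def)
        then have "(x,y) \<in> K" using y x \<rho> by (auto simp: K_def E_def)
        moreover have "x \<in> seg (x,y)" by (auto simp: seg_def)
        moreover have "rad (x,y) < d" using y(3) d by (simp add: rad_def)
        ultimately show ?thesis unfolding cball_seg by blast
      qed
    qed auto
    note pw = pw[unfolded cball_seg] and neg = neg[unfolded cball_seg]
    have lm: "seg i \<in> lmeasurable" for i by (cases i) (simp add: seg_def)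
    have bound: "measure lebesgue (\<Union>i\<in>I. seg i) \<le> e" if I: "I \<subseteq> C" "finite I" for I
    proof -
      define tag where "tag i = (fst i, seg i)" for i
      have disj: "seg i \<inter> seg j = {}" if "i \<in> I" "j \<in> I" "i \<noteq> j" for i j
        using pw I(1) that by (auto simp: pairwise_def disjnt_def)
      have mem: "fst i \<in> seg i" for i by (cases i) (auto simp: seg_def)
      have inj: "inj_on tag I"
        using disj mem by (fastforce simp: inj_on_def tag_def)
      have tp: "tag ` I tagged_partial_division_of cbox a b"
        unfolding tagged_partial_division_of_def
      proof (intro conjI allI impI)
        show "finite (tag ` I)" using I by simp
        fix x L assume "(x, L) \<in> tag ` I"
        then obtain i where i: "i \<in> I" "x = fst i" "L = seg i" by (auto simp: tag_def)
        then have iK: "i \<in> K" using I C by blast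
        show "x \<in> L" using i mem by simp
        show "L \<subseteq> cbox a b" using iK i by (cases i) (auto simp: K_def seg_def)
        show "\<exists>a b. L = cbox a b" using i by (cases i) (auto simp: seg_def)
      next
        fix x L x' L' assume *: "(x, L) \<in> tag ` I \<and> (x', L') \<in> tag ` I \<and> (x, L) \<noteq> (x', L')"
        then obtain i j where ij: "i \<in> I" "(x,L) = tag i" "j \<in> I" "(x',L') = tag j" by blast
        then have "L \<inter> L' = {}" using * disj[of i j] by (auto simp: tag_def)
        then show "interior L \<inter> interior L' = {}" using interior_subset by blast
      qed
      have fine: "\<gamma> fine tag ` I"
      proof (rule fineI)
        fix x L assume "(x, L) \<in> tag ` I"
        then obtain i where "i \<in> I" "x = fst i" "L = seg i" by (auto simp: tag_def)
        then show "L \<subseteq> \<gamma> x" using I C by (cases i) (auto simp: K_def)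
      qed
      have "measure lebesgue (\<Union>i\<in>I. seg i) \<le> (\<Sum>i\<in>I. measure lebesgue (seg i))"
        using I lm by (intro measure_UNION_le) auto
      also have "\<dots> \<le> (\<Sum>i\<in>I. real (Suc k) * norm (measure lborel (seg i) *\<^sub>R f (fst i) - integral (seg i) f))"
      proof (rule sum_mono)
        fix i assume "i \<in> I"
        then have iK: "i \<in> K" using I C by blast
        obtain x y where [simp]: "i = (x,y)" by (cases i)
        have xy: "a < x" "x < b" "a < y" "y < b" "\<bar>y - x\<bar> / real (Suc k) < err x y" using iK by (auto simp: K_def)
        have "err x y = norm (measure lborel (seg i) *\<^sub>R f x - integral (seg i) f)"
        proof (cases "x \<le> y")
          case True
          then show ?thesis using Fdiff[of x y] xy
            by (simp add: seg_def err_def norm_minus_commute)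
        next
          case False
          then have "err x y = norm (- (F x - F y) + (x - y) *\<^sub>R f x)"
            by (simp add: err_def algebra_simps)
          then show ?thesis using Fdiff[of y x] xy False
            by (simp add: seg_def)
        qed
        moreover have "measure lebesgue (seg i) = \<bar>y - x\<bar>"
          by (cases "x \<le> y") (simp_all add: seg_def)
        ultimately show "measure lebesgue (seg i) \<le> real (Suc k) * norm (measure lborel (seg i) *\<^sub>R f (fst i) - integral (seg i) f)"
          using xy(5) by (simp add: field_simps)
      qed
      also have "\<dots> = real (Suc k) * (\<Sum>(x,L)\<in>tag ` I. norm (measure lborel L *\<^sub>R f x - integral L f))"
        by (subst sum.reindex[OF inj]) (simp add: tag_def sum_distrib_left)
      also have "\<dots> \<le> real (Suc k) * (e / real (Suc k))"
        using hen[OF tp fine] by (intro mult_left_mono) auto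
      finally show ?thesis by simp
    qed
    have UN: "(\<Union>i\<in>C. seg i) \<in> lmeasurable" "measure lebesgue (\<Union>i\<in>C. seg i) \<le> e"
      using fmeasurable_UN_bound[OF C(1) lm bound] measure_UN_bound[OF C(1) lm bound] by auto
    let ?R = "E k - (\<Union>i\<in>C. seg i)"
    have R: "?R \<in> lmeasurable" "measure lebesgue ?R = 0"
      using neg by (auto simp: negligible_iff_measure)
    show "\<exists>T. E k \<subseteq> T \<and> T \<in> lmeasurable \<and> measure lebesgue T \<le> e"
    proof (intro exI conjI)
      show "E k \<subseteq> (\<Union>i\<in>C. seg i) \<union> ?R" by blast
      show "(\<Union>i\<in>C. seg i) \<union> ?R \<in> lmeasurable" using UN R by (metis fmeasurable.Un)
      show "measure lebesgue ((\<Union>i\<in>C. seg i) \<union> ?R) \<le> e"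
        using measure_Un_le[of "\<Union>i\<in>C. seg i" lebesgue ?R] UN R fmeasurableD by fastforce
    qed
  qed
  then have neg: "negligible (\<Union>k. E k)" by (intro negligible_countable_Union) auto
  show ?thesis
  proof (rule that[OF neg])
    fix x assume x: "x \<in> {a<..<b} - (\<Union>k. E k)"
    show "((\<lambda>x. integral {a..x} f) has_vector_derivative f x) (at x)"
      unfolding has_vector_derivative_def has_derivative_at_alt F_def[symmetric]
    proof (intro conjI allI impI)
      show "bounded_linear (\<lambda>h. h *\<^sub>R f x)" by (rule bounded_linear_scaleR_left)
      fix e :: real assume e: "e > 0"
      then obtain k where k: "1 / real (Suc k) < e" using nat_approx_posE by blast
      have "x \<notin> E k" using x by blast
      then obtain d where d: "d > 0" "\<And>y. y \<in> {a<..<b} \<Longrightarrow> y \<noteq> x \<Longrightarrow> \<bar>y - x\<bar> < d \<Longrightarrow> err x y \<le> \<bar>y - x\<bar> / real (Suc k)"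
        using x unfolding E_def by (force simp: not_less)
      define d' where "d' = min d (min (x - a) (b - x))"
      have "norm (F y - F x - (y - x) *\<^sub>R f x) \<le> e * norm (y - x)" if y: "norm (y - x) < d'" for y
      proof (cases "y = x")
        case False
        have "y \<in> {a<..<b}" "\<bar>y - x\<bar> < d" using y by (auto simp: d'_def)
        then have "err x y \<le> \<bar>y - x\<bar> / real (Suc k)" using d(2) False by blast
        also have "\<dots> \<le> e * \<bar>y - x\<bar>"
          using mult_right_mono[OF less_imp_le[OF k], of "\<bar>y - x\<bar>"] by simp
        finally show ?thesis by (simp add: err_def)
      qed simp
      moreover have "d' > 0" using x d by (auto simp: d'_def)
      ultimately show "\<exists>d>0. \<forall>y. norm (y - x) < d \<longrightarrow> norm (F y - F x - (y - x) *\<^sub>R f x) \<le> e * norm (y - x)"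
        by blast
    qed
  qed
qed

section \<open>Matrix norms and square integrable potentials\<close>

lemma norm_matrix_power2:
  fixes A :: "complex^'m^'m"
  shows "(norm A)\<^sup>2 = (\<Sum>i\<in>UNIV. \<Sum>j\<in>UNIV. (norm (A $ i $ j))\<^sup>2)"
  by (simp add: norm_vec_def L2_set_def sum_nonneg)

lemma norm_entry_le: "norm (A $ i $ j) \<le> norm (A :: complex^'m^'m)"
  by (meson Finite_Cartesian_Product.norm_nth_le order_trans)

lemma norm_matrix_le_sum:
  fixes A :: "complex^'m^'m"
  shows "norm A \<le> (\<Sum>i\<in>UNIV. \<Sum>j\<in>UNIV. norm (A $ i $ j))"
proof -
  have *: "norm v \<le> (\<Sum>i\<in>UNIV. norm (v $ i))" for v :: "'b::real_normed_vector ^ 'm"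
    unfolding norm_vec_def by (rule L2_set_le_sum) auto
  show ?thesis by (rule order_trans[OF *]) (intro sum_mono *)
qed

text \<open>The norm of \<open>complex^'m^'m\<close> is the Frobenius norm, so this is the Cauchy-Schwarz inequality for each
entry of the product.\<close>

lemma norm_matrix_mult_le:
  fixes A B :: "complex^'m^'m"
  shows "norm (A ** B) \<le> norm A * norm B"
proof (rule power2_le_imp_le)
  have "(norm (A ** B))\<^sup>2 = (\<Sum>i\<in>UNIV. \<Sum>j\<in>UNIV. (norm (\<Sum>k\<in>UNIV. A $ i $ k * B $ k $ j))\<^sup>2)"
    by (simp add: norm_matrix_power2 matrix_matrix_mult_def)
  also have "\<dots> \<le> (\<Sum>i\<in>UNIV. \<Sum>j\<in>UNIV. (\<Sum>k\<in>UNIV. (norm (A $ i $ k))\<^sup>2) * (\<Sum>k\<in>UNIV. (norm (B $ k $ j))\<^sup>2))"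
  proof (intro sum_mono)
    fix i j
    have "norm (\<Sum>k\<in>UNIV. A $ i $ k * B $ k $ j) \<le> (\<Sum>k\<in>UNIV. norm (A $ i $ k) * norm (B $ k $ j))"
      by (rule order_trans[OF norm_sum]) (simp add: norm_mult)
    then have "(norm (\<Sum>k\<in>UNIV. A $ i $ k * B $ k $ j))\<^sup>2 \<le> (\<Sum>k\<in>UNIV. norm (A $ i $ k) * norm (B $ k $ j))\<^sup>2"
      by (intro power_mono) auto
    also have "\<dots> \<le> (\<Sum>k\<in>UNIV. (norm (A $ i $ k))\<^sup>2) * (\<Sum>k\<in>UNIV. (norm (B $ k $ j))\<^sup>2)"
      by (rule Cauchy_Schwarz_ineq_sum)
    finally show "(norm (\<Sum>k\<in>UNIV. A $ i $ k * B $ k $ j))\<^sup>2 \<le> \<dots>" .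
  qed
  also have "\<dots> = (\<Sum>i\<in>UNIV. \<Sum>k\<in>UNIV. (norm (A $ i $ k))\<^sup>2) * (\<Sum>j\<in>UNIV. \<Sum>k\<in>UNIV. (norm (B $ k $ j))\<^sup>2)"
    by (rule sum_product[symmetric])
  also have "(\<Sum>j\<in>UNIV. \<Sum>k\<in>UNIV. (norm (B $ k $ j))\<^sup>2) = (norm B)\<^sup>2"
    unfolding norm_matrix_power2 by (rule sum.swap)
  also have "(\<Sum>i\<in>UNIV. \<Sum>k\<in>UNIV. (norm (A $ i $ k))\<^sup>2) = (norm A)\<^sup>2"
    unfolding norm_matrix_power2 ..
  finally show "(norm (A ** B))\<^sup>2 \<le> (norm A * norm B)\<^sup>2"
    by (simp add: power_mult_distrib)
qed simp

lemma bounded_bilinear_matrix_mult: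
  "bounded_bilinear ((**) :: complex^'m^'m \<Rightarrow> complex^'m^'m \<Rightarrow> complex^'m^'m)"
proof
  fix A B C :: "complex^'m^'m" and r :: real
  show "(A + B) ** C = A ** C + B ** C"
    by (simp add: matrix_matrix_mult_def vec_eq_iff sum.distrib distrib_right)
  show "A ** (B + C) = A ** B + A ** C"
    by (simp add: matrix_matrix_mult_def vec_eq_iff sum.distrib distrib_left)
  show "r *\<^sub>R A ** B = r *\<^sub>R (A ** B)"
    by (simp add: matrix_matrix_mult_def vec_eq_iff scaleR_sum_right)
  show "A ** r *\<^sub>R B = r *\<^sub>R (A ** B)"
    by (simp add: matrix_matrix_mult_def vec_eq_iff scaleR_sum_right)
  show "\<exists>K. \<forall>(A :: complex^'m^'m) (B :: complex^'m^'m). norm (A ** B) \<le> norm A * norm B * K"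
    using norm_matrix_mult_le by (intro exI[of _ 1]) auto
qed

interpretation matrix_mult: bounded_bilinear "(**) :: complex^'m^'m \<Rightarrow> complex^'m^'m \<Rightarrow> complex^'m^'m"
  by (rule bounded_bilinear_matrix_mult)

lemma mat_mult_entry [simp]: "(mat c ** A) $ i $ j = c * (A :: complex^'m^'m) $ i $ j"
  by (simp add: matrix_matrix_mult_def mat_def if_distrib[of "\<lambda>x. x * _"] cong: if_cong)

lemma mult_mat_entry [simp]: "(A ** mat c) $ i $ j = c * (A :: complex^'m^'m) $ i $ j"
  by (simp add: matrix_matrix_mult_def mat_def if_distrib[of "\<lambda>x. _ * x"] mult.commute cong: if_cong)

lemma norm_mat_mult: "norm (mat c ** A) = norm c * norm (A :: complex^'m^'m)"
proof (rule power2_eq_imp_eq)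
  show "(norm (mat c ** A))\<^sup>2 = (norm c * norm A)\<^sup>2"
    by (simp add: norm_matrix_power2 norm_mult power_mult_distrib sum_distrib_left)
qed auto

lemma norm_mat: "norm (mat c :: complex^'m^'m) = norm c * norm (mat 1 :: complex^'m^'m)"
  using norm_mat_mult[of c "mat 1"] by simp

lemma mnorm_le_norm: "mnorm (A :: complex^'m^'m) \<le> real CARD('m) * norm A"
proof -
  have "(\<Sum>k\<in>UNIV. norm (A $ j $ k)) \<le> real CARD('m) * norm A" for j
    using sum_bounded_above[of UNIV "\<lambda>k. norm (A $ j $ k)" "norm A"] norm_entry_le[of A j] by auto
  then show ?thesis unfolding mnorm_def by (subst Max_le_iff) auto
qed

lemma mnorm_nonneg: "mnorm A \<ge> 0"
proof -
  have "0 \<le> (\<Sum>k\<in>UNIV. norm (A $ undefined $ k))" by (intro sum_nonneg) auto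
  also have "\<dots> \<le> mnorm A" unfolding mnorm_def by (intro Max_ge) auto
  finally show ?thesis .
qed

lemma norm_le_mnorm: "norm (A :: complex^'m^'m) \<le> real CARD('m) * mnorm A"
proof -
  have "(\<Sum>k\<in>UNIV. norm (A $ j $ k)) \<le> mnorm A" for j
    unfolding mnorm_def by (intro Max_ge) auto
  then show ?thesis
    using sum_bounded_above[of UNIV "\<lambda>j. \<Sum>k\<in>UNIV. norm (A $ j $ k)" "mnorm A"] norm_matrix_le_sum[of A] by auto
qed

lemma L2_potential_measurable:
  assumes "L2_potential (Q :: real \<Rightarrow> complex^'m^'m)"
  shows "Q \<in> borel_measurable (lebesgue_on {0..pi})"
  unfolding borel_measurable_euclidean_space[of Q]
proof
  fix u :: "complex^'m^'m" assume "u \<in> Basis"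
  then obtain j k v where u: "u = axis j (axis k v)" by (auto simp: Basis_vec_def)
  have "(\<lambda>x. Q x $ j $ k \<bullet> v) \<in> borel_measurable (lebesgue_on {0..pi})"
    using assms unfolding L2_potential_def by (intro borel_measurable_inner) auto
  then show "(\<lambda>x. Q x \<bullet> u) \<in> borel_measurable (lebesgue_on {0..pi})"
    by (simp add: u inner_axis)
qed

lemma L2_potential_square_integrable:
  assumes "L2_potential (Q :: real \<Rightarrow> complex^'m^'m)"
  shows "(\<lambda>x. (norm (Q x))\<^sup>2) integrable_on {0..pi}"
proof -
  have "(\<lambda>x. (norm (Q x $ j $ k))\<^sup>2) integrable_on {0..pi}" for j k
    using assms unfolding L2_potential_def by (intro integrable_on_lebesgue_on) auto
  then show ?thesis
    unfolding norm_matrix_power2 by (intro integrable_sum) auto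
qed

lemma L2_potential_absolutely_integrable:
  assumes "L2_potential (Q :: real \<Rightarrow> complex^'m^'m)"
  shows "Q absolutely_integrable_on {0..pi}"
proof (rule measurable_bounded_by_integrable_imp_absolutely_integrable)
  show "(\<lambda>x. 1 + (norm (Q x))\<^sup>2) integrable_on {0..pi}"
    using L2_potential_square_integrable[OF assms] by (intro integrable_add) auto
  show "norm (Q x) \<le> 1 + (norm (Q x))\<^sup>2" for x
    using zero_le_power2[of "norm (Q x) - 1/2"] by (simp add: power2_eq_square algebra_simps)
qed (use L2_potential_measurable[OF assms] in auto)

section \<open>Gronwall estimates and Picard iteration\<close>

text \<open>In the supremum norm with weight \<open>exp (- L t)\<close>, integration against \<open>a\<close> has norm at most \<open>1/2\<close> once \<open>L\<close>
is large compared with the integral of \<open>a\<^sup>2\<close>: by Young's inequality \<open>a \<le> a\<^sup>2 / L + L / 4\<close>, where the first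
term contributes at most \<open>1/4\<close> by the size of \<open>L\<close> and the second one by integrating \<open>exp (L t)\<close>.\<close>

lemma exponential_weight:
  fixes a :: "real \<Rightarrow> real"
  assumes a: "a absolutely_integrable_on {0..b}" and a2: "(\<lambda>t. (a t)\<^sup>2) integrable_on {0..b}"
  obtains L where "L > 0"
    "\<And>x. x \<in> {0..b} \<Longrightarrow> integral {0..x} (\<lambda>t. a t * exp (L * t)) \<le> exp (L * x) / 2"
proof -
  define S where "S = integral {0..b} (\<lambda>t. (a t)\<^sup>2)"
  have S: "S \<ge> 0" unfolding S_def by (rule integral_nonneg[OF a2]) auto
  (* S / L < 1/4 is what the last estimate needs; S may be zero. *)
  define L where "L = 4 * (S + 1)"
  have L: "L > 0" using S by (simp add: L_def)
  show ?thesis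
  proof (rule that[OF L])
    fix x assume x: "x \<in> {0..b}"
    have sub: "{0..x} \<subseteq> {0..b}" using x by auto
    have ax: "(\<lambda>t. a t * exp (L * t)) integrable_on {0..x}"
    proof -
      have "a absolutely_integrable_on {0..x}" using a sub by (rule absolutely_integrable_on_subinterval)
      then have "(\<lambda>t. exp (L * t) * a t) absolutely_integrable_on {0..x}"
        by (intro absolutely_integrable_bounded_measurable_product_real)
           (auto intro!: continuous_imp_measurable_on_sets_lebesgue continuous_intros compact_imp_bounded compact_continuous_image)
      then show ?thesis by (simp add: mult.commute absolutely_integrable_on_def)
    qed
    have a2x: "(\<lambda>t. (a t)\<^sup>2) integrable_on {0..x}" by (rule integrable_on_subinterval[OF a2 sub])
    have "((\<lambda>t. exp (L * t)) has_integral (exp (L * x) / L - exp (L * 0) / L)) {0..x}"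
      using x L by (intro fundamental_theorem_of_calculus) (auto intro!: derivative_eq_intros simp: has_real_derivative_iff_has_vector_derivative[symmetric])
    then have e: "(\<lambda>t. exp (L * t)) integrable_on {0..x}" "integral {0..x} (\<lambda>t. exp (L * t)) \<le> exp (L * x) / L"
      using L by (auto simp: integral_unique has_integral_integrable intro: has_integral_integrable)
    have "integral {0..x} (\<lambda>t. a t * exp (L * t)) \<le> integral {0..x} (\<lambda>t. exp (L * x) / L * (a t)\<^sup>2 + L / 4 * exp (L * t))"
    proof (rule integral_le[OF ax])
      show "(\<lambda>t. exp (L * x) / L * (a t)\<^sup>2 + L / 4 * exp (L * t)) integrable_on {0..x}"
        by (intro integrable_add integrable_on_mult_right a2x e)
      fix t assume t: "t \<in> {0..x}"
      have "a t \<le> (a t)\<^sup>2 / L + L / 4"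
        using zero_le_power2[of "2 * a t - L"] L by (simp add: power2_eq_square field_simps)
      then have "a t * exp (L * t) \<le> ((a t)\<^sup>2 / L + L / 4) * exp (L * t)"
        by (rule mult_right_mono) auto
      also have "\<dots> = (a t)\<^sup>2 / L * exp (L * t) + L / 4 * exp (L * t)" by (simp add: algebra_simps)
      also have "(a t)\<^sup>2 / L * exp (L * t) \<le> (a t)\<^sup>2 / L * exp (L * x)"
        using t L by (intro mult_left_mono) auto
      finally show "a t * exp (L * t) \<le> exp (L * x) / L * (a t)\<^sup>2 + L / 4 * exp (L * t)"
        by (simp add: mult.commute)
    qed
    also have "\<dots> = exp (L * x) / L * integral {0..x} (\<lambda>t. (a t)\<^sup>2) + L / 4 * integral {0..x} (\<lambda>t. exp (L * t))"
      by (subst Henstock_Kurzweil_Integration.integral_add[OF integrable_on_mult_right[OF a2x] integrable_on_mult_right[OF e(1)]])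
         (simp only: Henstock_Kurzweil_Integration.integral_mult_right)
    also have "\<dots> \<le> exp (L * x) / L * S + L / 4 * (exp (L * x) / L)"
      unfolding S_def using L e a2 a2x sub by (intro add_mono mult_left_mono integral_subset_le) auto
    also have "\<dots> = exp (L * x) * (S / L + 1 / 4)" using L by (simp add: field_simps)
    also have "\<dots> \<le> exp (L * x) * (1 / 2)"
      using S by (intro mult_left_mono) (auto simp: L_def field_simps)
    finally show "integral {0..x} (\<lambda>t. a t * exp (L * t)) \<le> exp (L * x) / 2" by simp
  qed
qed

text \<open>Admissibility of the exponent \<open>L\<close> for the kernel \<open>a\<close> in the weighted supremum norm. The factor \<open>1/2\<close>
drives both the Gronwall estimate and the Picard iteration.\<close>

definition exp_dominated :: "real \<Rightarrow> (real \<Rightarrow> real) \<Rightarrow> bool" where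
  "exp_dominated L a \<longleftrightarrow> L > 0 \<and> a absolutely_integrable_on {0..pi} \<and> (\<forall>t\<in>{0..pi}. 0 \<le> a t) \<and>
     (\<forall>x\<in>{0..pi}. integral {0..x} (\<lambda>t. a t * exp (L * t)) \<le> exp (L * x) / 2)"

lemma continuous_times_absolutely_integrable:
  fixes a y :: "real \<Rightarrow> real"
  assumes "a absolutely_integrable_on {c..b}" "continuous_on {c..b} y"
  shows "(\<lambda>t. a t * y t) absolutely_integrable_on {c..b}"
proof -
  have "(\<lambda>t. y t * a t) absolutely_integrable_on {c..b}"
    using assms by (intro absolutely_integrable_bounded_measurable_product_real)
       (auto intro!: continuous_imp_measurable_on_sets_lebesgue compact_imp_bounded compact_continuous_image)
  then show ?thesis by (simp add: mult.commute)
qed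

lemma exp_dominated_integral_le:
  assumes L: "exp_dominated L a" and y: "continuous_on {0..pi} y" and x: "x \<in> {0..pi}" and N: "N \<ge> 0"
    and le: "\<And>t. t \<in> {0..x} \<Longrightarrow> y t \<le> N * exp (L * t)"
  shows "integral {0..x} (\<lambda>t. a t * y t) \<le> N * exp (L * x) / 2"
proof -
  have sub: "{0..x} \<subseteq> {0..pi}" using x by auto
  have a: "a absolutely_integrable_on {0..x}"
    using L sub unfolding exp_dominated_def by (meson absolutely_integrable_on_subinterval)
  have i: "(\<lambda>t. a t * exp (L * t)) absolutely_integrable_on {0..x}"
    by (intro continuous_times_absolutely_integrable a continuous_intros)
  have "integral {0..x} (\<lambda>t. a t * y t) \<le> integral {0..x} (\<lambda>t. N * (a t * exp (L * t)))"
  proof (rule integral_le)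
    show "(\<lambda>t. a t * y t) integrable_on {0..x}"
      using continuous_times_absolutely_integrable[OF a continuous_on_subset[OF y sub]]
      by (rule absolutely_integrable_on_def[THEN iffD1, THEN conjunct1])
    show "(\<lambda>t. N * (a t * exp (L * t))) integrable_on {0..x}"
      using i by (intro integrable_on_mult_right) (simp add: absolutely_integrable_on_def)
    show "a t * y t \<le> N * (a t * exp (L * t))" if "t \<in> {0..x}" for t
      using mult_left_mono[OF le[OF that], of "a t"] L sub that
      by (auto simp: exp_dominated_def algebra_simps)
  qed
  also have "\<dots> = N * integral {0..x} (\<lambda>t. a t * exp (L * t))" by simp
  also have "\<dots> \<le> N * (exp (L * x) / 2)"
    using L x N by (intro mult_left_mono) (auto simp: exp_dominated_def)
  finally show ?thesis by simp
qed

text \<open>At a point where \<open>y t / exp (L t)\<close> is maximal, the integral is at most half of the maximum.\<close>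

lemma exp_dominated_gronwall:
  assumes L: "exp_dominated L a" and y: "continuous_on {0..pi} y"
    and c: "c \<ge> 0" and le: "\<And>x. x \<in> {0..pi} \<Longrightarrow> y x \<le> c + integral {0..x} (\<lambda>t. a t * y t)"
    and x: "x \<in> {0..pi}"
  shows "y x \<le> 2 * c * exp (L * x)"
proof -
  have "continuous_on {0..pi} (\<lambda>x. y x / exp (L * x))" by (intro continuous_intros y) auto
  then obtain x0 where x0: "x0 \<in> {0..pi}" "\<And>t. t \<in> {0..pi} \<Longrightarrow> y t / exp (L * t) \<le> y x0 / exp (L * x0)"
    using continuous_attains_sup[of "{0..pi}" "\<lambda>x. y x / exp (L * x)"] by auto
  define N where "N = max 0 (y x0 / exp (L * x0))"
  have yN: "y t \<le> N * exp (L * t)" if "t \<in> {0..pi}" for t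
    using order_trans[OF x0(2)[OF that], of N] by (simp add: N_def field_simps)
  have Lp: "L > 0" using L by (simp add: exp_dominated_def)
  have "N \<le> 2 * c"
  proof (cases "y x0 \<le> 0")
    case True
    then have "N = 0" by (simp add: N_def max_def field_simps)
    then show ?thesis using c by simp
  next
    case False
    then have N: "N = y x0 / exp (L * x0)" by (simp add: N_def max_def field_simps)
    have "y x0 \<le> c + N * exp (L * x0) / 2"
      using le[OF x0(1)] exp_dominated_integral_le[OF L y x0(1), of N] yN x0(1) by (force simp: N_def)
    also have "\<dots> \<le> c * exp (L * x0) + N * exp (L * x0) / 2"
      using c x0(1) Lp by (simp add: mult_le_cancel_left1)
    finally have "N \<le> c + N / 2" by (simp add: N field_simps)
    then show ?thesis by simp
  qed
  then have "N * exp (L * x) \<le> 2 * c * exp (L * x)" by simp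
  then show ?thesis using yN[OF x] by linarith
qed

lemma absolutely_integrable_matrix_mult:
  fixes P Y :: "real \<Rightarrow> complex^'m^'m"
  assumes P: "P absolutely_integrable_on {c..d}" and Y: "continuous_on {c..d} Y"
  shows "(\<lambda>t. P t ** Y t) absolutely_integrable_on {c..d}"
proof -
  have "bilinear (\<lambda>(B :: complex^'m^'m) (A :: complex^'m^'m). A ** B)"
    using bounded_bilinear.flip[OF bounded_bilinear_matrix_mult] by (rule bilinear_conv_bounded_bilinear[THEN iffD2])
  then show ?thesis
    using P Y
    by (intro absolutely_integrable_bounded_measurable_product[where h = "\<lambda>B A. A ** B" and f = Y and g = P])
       (auto intro!: continuous_imp_measurable_on_sets_lebesgue compact_imp_bounded compact_continuous_image)
qed

lemma norm_integral_matrix_mult_le: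
  fixes P Y :: "real \<Rightarrow> complex^'m^'m"
  assumes P: "P absolutely_integrable_on {c..d}" and Y: "continuous_on {c..d} Y"
    and a: "a absolutely_integrable_on {c..d}"
    and Pa: "\<And>t. t \<in> {c..d} \<Longrightarrow> norm (P t) \<le> a t"
    and y: "continuous_on {c..d} y" and Yy: "\<And>t. t \<in> {c..d} \<Longrightarrow> norm (Y t) \<le> y t"
  shows "norm (integral {c..d} (\<lambda>t. P t ** Y t)) \<le> integral {c..d} (\<lambda>t. a t * y t)"
proof (rule integral_norm_bound_integral)
  show "(\<lambda>t. P t ** Y t) integrable_on {c..d}"
    using absolutely_integrable_matrix_mult[OF P Y] by (simp add: absolutely_integrable_on_def)
  show "(\<lambda>t. a t * y t) integrable_on {c..d}"
    using continuous_times_absolutely_integrable[OF a y] by (simp add: absolutely_integrable_on_def)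
  show "norm (P t ** Y t) \<le> a t * y t" if "t \<in> {c..d}" for t
    using norm_matrix_mult_le[of "P t" "Y t"] Pa[OF that] Yy[OF that]
    by (meson mult_mono norm_ge_zero order_trans)
qed

text \<open>The equation \<open>Y'' = P Y\<close> as an integral system for \<open>Y\<close> and \<open>Z = Y'\<close>. The free terms are functions, not
only initial values, because increments and derivatives of solutions with respect to \<open>\<lambda>\<close> satisfy such a
system with the same \<open>P\<close> and nonconstant free terms.\<close>

definition volterra ::
  "(real \<Rightarrow> complex^'m^'m) \<Rightarrow> (real \<Rightarrow> complex^'m^'m) \<Rightarrow> (real \<Rightarrow> complex^'m^'m) \<Rightarrow>
   (real \<Rightarrow> complex^'m^'m) \<Rightarrow> (real \<Rightarrow> complex^'m^'m) \<Rightarrow> bool" where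
  "volterra P A B Y Z \<longleftrightarrow> continuous_on {0..pi} Y \<and> continuous_on {0..pi} Z \<and>
     (\<forall>x\<in>{0..pi}. Y x = A x + integral {0..x} Z \<and> Z x = B x + integral {0..x} (\<lambda>t. P t ** Y t))"

lemma norm_integral_continuous_le:
  fixes Z :: "real \<Rightarrow> complex^'m^'m"
  assumes Z: "continuous_on {c..d} Z" and z: "continuous_on {c..d} z"
    and a: "a absolutely_integrable_on {c..d}" and a1: "\<And>t. t \<in> {c..d} \<Longrightarrow> 1 \<le> a t"
    and Zz: "\<And>t. t \<in> {c..d} \<Longrightarrow> norm (Z t) \<le> z t"
  shows "norm (integral {c..d} Z) \<le> integral {c..d} (\<lambda>t. a t * z t)"
proof (rule integral_norm_bound_integral)
  show "Z integrable_on {c..d}" using Z by (rule integrable_continuous_real)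
  show "(\<lambda>t. a t * z t) integrable_on {c..d}"
    using continuous_times_absolutely_integrable[OF a z] by (simp add: absolutely_integrable_on_def)
  show "norm (Z t) \<le> a t * z t" if "t \<in> {c..d}" for t
    using mult_mono[OF a1[OF that] Zz[OF that]] a1[OF that] by simp
qed

lemma volterra_step_le:
  fixes P Y Z :: "real \<Rightarrow> complex^'m^'m"
  assumes L: "exp_dominated L a" and P: "P absolutely_integrable_on {0..pi}"
    and Pa: "\<And>t. t \<in> {0..pi} \<Longrightarrow> norm (P t) \<le> a t" and a1: "\<And>t. t \<in> {0..pi} \<Longrightarrow> 1 \<le> a t"
    and Y: "continuous_on {0..pi} Y" and Z: "continuous_on {0..pi} Z" and x: "x \<in> {0..pi}"
  shows "norm (integral {0..x} Z) + norm (integral {0..x} (\<lambda>t. P t ** Y t))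
     \<le> integral {0..x} (\<lambda>t. a t * (norm (Y t) + norm (Z t)))"
proof -
  have sub: "{0..x} \<subseteq> {0..pi}" using x by auto
  have a: "a absolutely_integrable_on {0..x}"
    using L sub unfolding exp_dominated_def by (meson absolutely_integrable_on_subinterval)
  have P': "P absolutely_integrable_on {0..x}" using P sub by (rule absolutely_integrable_on_subinterval)
  note Y' = continuous_on_subset[OF Y sub] and Z' = continuous_on_subset[OF Z sub]
  have 1: "norm (integral {0..x} Z) \<le> integral {0..x} (\<lambda>t. a t * norm (Z t))"
    using a1 sub by (intro norm_integral_continuous_le Z' a continuous_intros) auto
  have 2: "norm (integral {0..x} (\<lambda>t. P t ** Y t)) \<le> integral {0..x} (\<lambda>t. a t * norm (Y t))"
    using Pa sub by (intro norm_integral_matrix_mult_le Y' P' a continuous_intros) auto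
  have "integral {0..x} (\<lambda>t. a t * (norm (Y t) + norm (Z t)))
      = integral {0..x} (\<lambda>t. a t * norm (Y t)) + integral {0..x} (\<lambda>t. a t * norm (Z t))"
    unfolding distrib_left
    by (intro Henstock_Kurzweil_Integration.integral_add
          continuous_times_absolutely_integrable[THEN absolutely_integrable_on_def[THEN iffD1, THEN conjunct1]] a continuous_intros Y' Z')
  then show ?thesis using 1 2 by simp
qed

lemma volterra_bound:
  assumes L: "exp_dominated L a" and P: "P absolutely_integrable_on {0..pi}"
    and Pa: "\<And>t. t \<in> {0..pi} \<Longrightarrow> norm (P t) \<le> a t" and a1: "\<And>t. t \<in> {0..pi} \<Longrightarrow> 1 \<le> a t"
    and sol: "volterra P A B Y Z"
    and c: "\<And>x. x \<in> {0..pi} \<Longrightarrow> norm (A x) + norm (B x) \<le> c"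
    and x: "x \<in> {0..pi}"
  shows "norm (Y x) + norm (Z x) \<le> 2 * c * exp (L * x)"
proof (rule exp_dominated_gronwall[OF L _ _ _ x, where y = "\<lambda>x. norm (Y x) + norm (Z x)"])
  have Y: "continuous_on {0..pi} Y" and Z: "continuous_on {0..pi} Z"
    using sol by (auto simp: volterra_def)
  show "continuous_on {0..pi} (\<lambda>x. norm (Y x) + norm (Z x))" by (intro continuous_intros Y Z)
  have "norm (A 0) + norm (B 0) \<le> c" by (rule c) auto
  then show "0 \<le> c" using norm_ge_zero[of "A 0"] norm_ge_zero[of "B 0"] by linarith
  fix x assume x: "x \<in> {0..pi}"
  have "norm (Y x) + norm (Z x) \<le> (norm (A x) + norm (integral {0..x} Z)) + (norm (B x) + norm (integral {0..x} (\<lambda>t. P t ** Y t)))"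
  proof -
    have YZ: "Y x = A x + integral {0..x} Z" "Z x = B x + integral {0..x} (\<lambda>t. P t ** Y t)"
      using sol x by (auto simp: volterra_def)
    show ?thesis
      by (subst YZ(1), subst YZ(2)) (intro add_mono norm_triangle_ineq)
  qed
  also have "\<dots> = (norm (A x) + norm (B x)) + (norm (integral {0..x} Z) + norm (integral {0..x} (\<lambda>t. P t ** Y t)))"
    by (simp only: ac_simps)
  also have "\<dots> \<le> c + integral {0..x} (\<lambda>t. a t * (norm (Y t) + norm (Z t)))"
    by (rule add_mono[OF c[OF x] volterra_step_le[OF L P Pa a1 Y Z x]])
  finally show "norm (Y x) + norm (Z x) \<le> \<dots>" .
qed

text \<open>Picard iteration. Consecutive iterates differ by at most \<open>N 2\<^sup>-\<^sup>n exp (L x)\<close>, so they converge uniformly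
and the limit may be taken under the integrals.\<close>

lemma volterra_exists:
  fixes P A B :: "real \<Rightarrow> complex^'m^'m"
  assumes L: "exp_dominated L a" and P: "P absolutely_integrable_on {0..pi}"
    and Pa: "\<And>t. t \<in> {0..pi} \<Longrightarrow> norm (P t) \<le> a t" and a1: "\<And>t. t \<in> {0..pi} \<Longrightarrow> 1 \<le> a t"
    and A: "continuous_on {0..pi} A" and B: "continuous_on {0..pi} B"
  obtains Y Z where "volterra P A B Y Z"
proof -
  define T where "T = (\<lambda>X x. (A x + integral {0..x} (\<lambda>t. snd (X t)), B x + integral {0..x} (\<lambda>t. P t ** fst (X t))))"
  define X where "X n = (T ^^ n) (\<lambda>x. (A x, B x))" for n
  have XS: "X (Suc n) x = (A x + integral {0..x} (\<lambda>t. snd (X n t)), B x + integral {0..x} (\<lambda>t. P t ** fst (X n t)))" for n x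
    by (simp add: X_def T_def)
  have int: "(\<lambda>t. P t ** Y t) integrable_on {0..x}" if "continuous_on {0..pi} Y" "x \<in> {0..pi}"
    for Y :: "real \<Rightarrow> complex^'m^'m" and x
  proof -
    have sub: "{0..x} \<subseteq> {0..pi}" using that by auto
    show ?thesis
      using absolutely_integrable_matrix_mult[OF absolutely_integrable_on_subinterval[OF P sub] continuous_on_subset[OF that(1) sub]]
      by (simp add: absolutely_integrable_on_def)
  qed
  have cont: "continuous_on {0..pi} (X n)" for n
  proof (induction n)
    case 0
    then show ?case by (simp add: X_def continuous_on_Pair A B)
  next
    case (Suc n)
    have 1: "continuous_on {0..pi} (\<lambda>t. fst (X n t))" "continuous_on {0..pi} (\<lambda>t. snd (X n t))"
      using Suc by (rule continuous_on_fst continuous_on_snd)+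
    have "(\<lambda>t. P t ** fst (X n t)) integrable_on {0..pi}" by (rule int[OF 1(1)]) auto
    moreover have "(\<lambda>t. snd (X n t)) integrable_on {0..pi}" using 1(2) by (rule integrable_continuous_real)
    ultimately show ?case unfolding XS by (intro continuous_intros A B indefinite_integral_continuous_1)
  qed
  define d where "d n x = X (Suc n) x - X n x" for n x
  have contfs: "continuous_on {0..pi} (\<lambda>t. fst (X n t))" "continuous_on {0..pi} (\<lambda>t. snd (X n t))" for n
    using cont[of n] by (rule continuous_on_fst continuous_on_snd)+
  have dS: "fst (d (Suc n) x) = integral {0..x} (\<lambda>t. snd (d n t))"
    "snd (d (Suc n) x) = integral {0..x} (\<lambda>t. P t ** fst (d n t))" if x: "x \<in> {0..pi}" for n x
  proof -
    have sub: "{0..x} \<subseteq> {0..pi}" using x by auto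
    show "fst (d (Suc n) x) = integral {0..x} (\<lambda>t. snd (d n t))"
      unfolding d_def XS[of "Suc n"] XS[of n x] snd_diff fst_diff fst_conv
      by (subst Henstock_Kurzweil_Integration.integral_diff)
         (auto intro!: integrable_continuous_real continuous_on_subset[OF contfs(2) sub])
    show "snd (d (Suc n) x) = integral {0..x} (\<lambda>t. P t ** fst (d n t))"
      unfolding d_def XS[of "Suc n"] XS[of n x] snd_diff fst_diff snd_conv matrix_mult.diff_right
      by (subst Henstock_Kurzweil_Integration.integral_diff) (auto intro!: int contfs x)
  qed
  have contd: "continuous_on {0..pi} (\<lambda>t. fst (d n t))" "continuous_on {0..pi} (\<lambda>t. snd (d n t))" for n
    unfolding d_def by (intro continuous_on_fst continuous_on_snd continuous_on_diff cont)+
  have Lp: "L > 0" using L by (simp add: exp_dominated_def)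
  have "bounded ((\<lambda>t. norm (fst (d 0 t)) + norm (snd (d 0 t))) ` {0..pi})"
    by (intro compact_imp_bounded compact_continuous_image continuous_intros contd) auto
  then obtain N where N: "N > 0" "\<And>t. t \<in> {0..pi} \<Longrightarrow> norm (fst (d 0 t)) + norm (snd (d 0 t)) \<le> N"
    unfolding bounded_pos by force
  have dn: "norm (fst (d n x)) + norm (snd (d n x)) \<le> N * (1/2) ^ n * exp (L * x)" if "x \<in> {0..pi}" for n x
    using that
  proof (induction n arbitrary: x)
    case 0
    then have "N \<le> N * exp (L * x)" using N Lp by simp
    then show ?case using N(2)[OF 0] by simp
  next
    case (Suc n)
    have "norm (fst (d (Suc n) x)) + norm (snd (d (Suc n) x)) \<le> integral {0..x} (\<lambda>t. a t * (norm (fst (d n t)) + norm (snd (d n t))))"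
      unfolding dS[OF Suc.prems] by (rule volterra_step_le[OF L P Pa a1 contd Suc.prems])
    also have "\<dots> \<le> N * (1/2) ^ n * exp (L * x) / 2"
      using Suc.prems N by (intro exp_dominated_integral_le[OF L _ Suc.prems] Suc.IH continuous_intros contd) auto
    finally show ?case by simp
  qed
  have tel: "(\<Sum>i<n. d i x) = X n x - X 0 x" for n x
    unfolding d_def by (rule sum_lessThan_telescope)
  have "uniform_limit {0..pi} (\<lambda>n x. \<Sum>i<n. d i x) (\<lambda>x. suminf (\<lambda>i. d i x)) sequentially"
  proof (rule Weierstrass_m_test)
    show "summable (\<lambda>n. N * (1/2) ^ n * exp (L * pi))"
      by (intro summable_mult2 summable_mult summable_geometric) auto
    fix n x assume x: "x \<in> {0..pi}"
    have "norm (d n x) \<le> norm (fst (d n x)) + norm (snd (d n x))"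
      by (metis norm_Pair_le prod.collapse)
    also have "\<dots> \<le> N * (1/2) ^ n * exp (L * x)" by (rule dn[OF x])
    also have "\<dots> \<le> N * (1/2) ^ n * exp (L * pi)" using x Lp N by (intro mult_left_mono) auto
    finally show "norm (d n x) \<le> \<dots>" .
  qed
  then have ul: "uniform_limit {0..pi} (\<lambda>n x. X n x - X 0 x) (\<lambda>x. suminf (\<lambda>i. d i x)) sequentially"
    unfolding tel .
  define W where "W x = X 0 x + suminf (\<lambda>i. d i x)" for x
  have ulW: "uniform_limit {0..pi} X W sequentially"
    using uniform_limit_add[OF uniform_limit_const[where c = "X 0"] ul] by (simp add: W_def[abs_def])
  have ulY: "uniform_limit {0..pi} (\<lambda>n x. fst (X n x)) (\<lambda>x. fst (W x)) sequentially"
    by (rule bounded_linear.uniform_limit[OF bounded_linear_fst ulW])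
  have ulZ: "uniform_limit {0..pi} (\<lambda>n x. snd (X n x)) (\<lambda>x. snd (W x)) sequentially"
    by (rule bounded_linear.uniform_limit[OF bounded_linear_snd ulW])
  have cW: "continuous_on {0..pi} W"
    by (rule uniform_limit_theorem[OF always_eventually ulW]) (simp_all add: cont)
  have cY: "continuous_on {0..pi} (\<lambda>x. fst (W x))" and cZ: "continuous_on {0..pi} (\<lambda>x. snd (W x))"
    using continuous_on_fst[OF cW] continuous_on_snd[OF cW] by blast+
  have lim: "(\<lambda>n. integral {0..x} (\<lambda>t. R t ** F n t)) \<longlonglongrightarrow> integral {0..x} (\<lambda>t. R t ** G t)"
    if R: "R absolutely_integrable_on {0..pi}" and u: "uniform_limit {0..pi} F G sequentially"
      and F: "\<And>n. continuous_on {0..pi} (F n)" and G: "continuous_on {0..pi} G" and x: "x \<in> {0..pi}"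
    for R G :: "real \<Rightarrow> complex^'m^'m" and F and x
  proof -
    have sub: "{0..x} \<subseteq> {0..pi}" using x by auto
    have R': "R absolutely_integrable_on {0..x}" using R sub by (rule absolutely_integrable_on_subinterval)
    have nR: "(\<lambda>t. norm (R t)) absolutely_integrable_on {0..x}" using R' by (rule absolutely_integrable_norm[unfolded o_def])
    define I where "I = integral {0..x} (\<lambda>t. norm (R t))"
    have I: "I \<ge> 0" unfolding I_def using nR by (intro integral_nonneg) (auto simp: absolutely_integrable_on_def)
    show ?thesis
    proof (rule LIMSEQ_I)
      fix e :: real assume e: "e > 0"
      then have "e / (I + 1) > 0" using I by simp
      then obtain n0 where n0: "\<And>n t. n \<ge> n0 \<Longrightarrow> t \<in> {0..pi} \<Longrightarrow> dist (F n t) (G t) < e / (I + 1)"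
        using u unfolding uniform_limit_iff eventually_sequentially by blast
      have "norm (integral {0..x} (\<lambda>t. R t ** F n t) - integral {0..x} (\<lambda>t. R t ** G t)) < e" if n: "n \<ge> n0" for n
      proof -
        have i: "(\<lambda>t. R t ** F n t) integrable_on {0..x}" "(\<lambda>t. R t ** G t) integrable_on {0..x}"
          using absolutely_integrable_matrix_mult[OF R' continuous_on_subset[OF F sub]]
            absolutely_integrable_matrix_mult[OF R' continuous_on_subset[OF G sub]]
          by (auto simp: absolutely_integrable_on_def)
        have "integral {0..x} (\<lambda>t. R t ** F n t) - integral {0..x} (\<lambda>t. R t ** G t) = integral {0..x} (\<lambda>t. R t ** (F n t - G t))"
          using i by (simp add: Henstock_Kurzweil_Integration.integral_diff matrix_mult.diff_right)
        also have "norm \<dots> \<le> integral {0..x} (\<lambda>t. norm (R t) * (e / (I + 1)))"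
          using n0[OF n] sub
          by (intro norm_integral_matrix_mult_le R' nR continuous_intros continuous_on_subset[OF F sub] continuous_on_subset[OF G sub])
             (auto simp: dist_norm intro!: less_imp_le)
        also have "\<dots> = I * (e / (I + 1))" by (simp add: I_def)
        also have "\<dots> < e" using I e by (simp add: field_simps)
        finally show ?thesis .
      qed
      then show "\<exists>n0. \<forall>n\<ge>n0. norm (integral {0..x} (\<lambda>t. R t ** F n t) - integral {0..x} (\<lambda>t. R t ** G t)) < e" by blast
    qed
  qed
  have XW: "(\<lambda>n. X n x) \<longlonglongrightarrow> W x" if "x \<in> {0..pi}" for x
    using tendsto_uniform_limitI[OF ulW that] .
  have "volterra P A B (\<lambda>x. fst (W x)) (\<lambda>x. snd (W x))"
    unfolding volterra_def
  proof (intro conjI ballI cY cZ)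
    fix x assume x: "x \<in> {0..pi}"
    have XW': "(\<lambda>n. X (Suc n) x) \<longlonglongrightarrow> W x" using XW[OF x] by (rule LIMSEQ_Suc)
    have "(\<lambda>t. mat 1 :: complex^'m^'m) absolutely_integrable_on {0..pi}"
      by (intro absolutely_integrable_continuous_real continuous_intros)
    from lim[OF this ulZ contfs(2) cZ x]
    have "(\<lambda>n. A x + integral {0..x} (\<lambda>t. snd (X n t))) \<longlonglongrightarrow> A x + integral {0..x} (\<lambda>t. snd (W t))"
      by (intro tendsto_intros) simp
    moreover have "(\<lambda>n. A x + integral {0..x} (\<lambda>t. snd (X n t))) \<longlonglongrightarrow> fst (W x)"
      using tendsto_fst[OF XW'] by (simp add: XS)
    ultimately show "fst (W x) = A x + integral {0..x} (\<lambda>t. snd (W t))" using LIMSEQ_unique by blast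
    have "(\<lambda>n. B x + integral {0..x} (\<lambda>t. P t ** fst (X n t))) \<longlonglongrightarrow> B x + integral {0..x} (\<lambda>t. P t ** fst (W t))"
      by (intro tendsto_intros lim[OF P ulY contfs(1) cY x])
    moreover have "(\<lambda>n. B x + integral {0..x} (\<lambda>t. P t ** fst (X n t))) \<longlonglongrightarrow> snd (W x)"
      using tendsto_snd[OF XW'] by (simp add: XS)
    ultimately show "snd (W x) = B x + integral {0..x} (\<lambda>t. P t ** fst (W t))" using LIMSEQ_unique by blast
  qed
  then show ?thesis by (rule that)
qed

section \<open>The spectral coefficient and linearity\<close>

lemma L2_potential_bound_square_integrable:
  fixes Q :: "real \<Rightarrow> complex^'m^'m"
  assumes "L2_potential Q"
  shows "(\<lambda>t. (K * (norm (Q t) + c))\<^sup>2) integrable_on {0..pi}"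
proof -
  have n: "(\<lambda>t. norm (Q t)) integrable_on {0..pi}"
    using absolutely_integrable_norm[OF L2_potential_absolutely_integrable[OF assms]]
    by (simp add: absolutely_integrable_on_def o_def)
  have "(\<lambda>t. K\<^sup>2 * (norm (Q t))\<^sup>2 + (2 * K\<^sup>2 * c) * norm (Q t) + K\<^sup>2 * c\<^sup>2) integrable_on {0..pi}"
    by (intro integrable_add integrable_on_mult_right n L2_potential_square_integrable[OF assms]) auto
  then show ?thesis by (simp add: power2_eq_square algebra_simps)
qed

lemma coefficient_absolutely_integrable:
  fixes Q :: "real \<Rightarrow> complex^'m^'m"
  assumes "L2_potential Q"
  shows "(\<lambda>t. Q t - mat lam) absolutely_integrable_on {0..pi}"
proof -
  have "(\<lambda>t. mat lam :: complex^'m^'m) absolutely_integrable_on {0..pi}"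
    by (rule absolutely_integrable_continuous_real) (rule continuous_on_const)
  then show ?thesis
    by (rule set_integral_diff(1)[OF L2_potential_absolutely_integrable[OF assms]])
qed

text \<open>One kernel, and with it one exponent, serves all parameters in a disc; this makes the later estimates
uniform in \<open>\<lambda>\<close> and \<open>\<mu>\<close>.\<close>

lemma coefficient_weight:
  fixes Q :: "real \<Rightarrow> complex^'m^'m"
  assumes Q: "L2_potential Q" and R: "R \<ge> 0"
  obtains L a where "exp_dominated L a" "\<And>t. 1 \<le> a t"
    "\<And>t lam. norm lam \<le> R \<Longrightarrow> norm (Q t - mat lam) \<le> a t"
proof -
  (* The summand 1 makes a dominate the coefficient 1 of the equation Y' = Z as well. *)
  define c where "c = R * norm (mat 1 :: complex^'m^'m) + 1"
  define a where "a t = norm (Q t) + c" for t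
  have c: "c \<ge> 1" using R by (simp add: c_def)
  have ai: "a absolutely_integrable_on {0..pi}"
    unfolding a_def
    by (rule set_integral_add(1)[OF absolutely_integrable_norm[OF L2_potential_absolutely_integrable[OF Q], unfolded o_def]
        absolutely_integrable_continuous_real[OF continuous_on_const]])
  have "(\<lambda>t. (a t)\<^sup>2) integrable_on {0..pi}"
    using L2_potential_bound_square_integrable[OF Q, of 1 c] by (simp add: a_def)
  from exponential_weight[OF ai this] obtain L where L: "L > 0"
    "\<And>x. x \<in> {0..pi} \<Longrightarrow> integral {0..x} (\<lambda>t. a t * exp (L * t)) \<le> exp (L * x) / 2" by blast
  have a1: "1 \<le> a t" for t unfolding a_def by (rule add_increasing[OF norm_ge_zero c])
  have "norm (Q t - mat lam) \<le> a t" if "norm lam \<le> R" for t lam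
  proof -
    have "norm (Q t - mat lam) \<le> norm (Q t) + norm (mat lam :: complex^'m^'m)" by (rule norm_triangle_ineq4)
    also have "norm (mat lam :: complex^'m^'m) \<le> R * norm (mat 1 :: complex^'m^'m)"
      by (subst norm_mat) (intro mult_right_mono that norm_ge_zero)
    finally show ?thesis by (simp add: a_def c_def)
  qed
  moreover have "exp_dominated L a"
    unfolding exp_dominated_def using L ai a1 by (auto intro: order_trans[OF zero_le_one])
  ultimately show ?thesis using a1 that by blast
qed

lemma volterra_integrable:
  fixes P Y :: "real \<Rightarrow> complex^'m^'m"
  assumes "P absolutely_integrable_on {0..pi}" "continuous_on {0..pi} Y" "x \<in> {0..pi}"
  shows "(\<lambda>t. P t ** Y t) integrable_on {0..x}"
proof -
  have sub: "{0..x} \<subseteq> {0..pi}" using assms by auto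
  show ?thesis
    using absolutely_integrable_matrix_mult[OF absolutely_integrable_on_subinterval[OF assms(1) sub] continuous_on_subset[OF assms(2) sub]]
    by (simp add: absolutely_integrable_on_def)
qed

lemma continuous_integrable_initial:
  fixes Y :: "real \<Rightarrow> 'a::banach"
  assumes "continuous_on {0..pi} Y" "x \<in> {0..pi}"
  shows "Y integrable_on {0..x}"
proof (rule integrable_continuous_real)
  show "continuous_on {0..x} Y"
    by (rule continuous_on_subset[OF assms(1)]) (use assms(2) in auto)
qed

lemma volterra_diff:
  fixes P Y Y' :: "real \<Rightarrow> complex^'m^'m"
  assumes P: "P absolutely_integrable_on {0..pi}"
    and 1: "volterra P A B Y Z" and 2: "volterra P A' B' Y' Z'"
  shows "volterra P (\<lambda>x. A x - A' x) (\<lambda>x. B x - B' x) (\<lambda>x. Y x - Y' x) (\<lambda>x. Z x - Z' x)"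
proof -
  have c: "continuous_on {0..pi} Y" "continuous_on {0..pi} Z" "continuous_on {0..pi} Y'" "continuous_on {0..pi} Z'"
    using 1 2 by (auto simp: volterra_def)
  have "integral {0..x} (\<lambda>t. Z t - Z' t) = integral {0..x} Z - integral {0..x} Z'"
    "integral {0..x} (\<lambda>t. P t ** (Y t - Y' t)) = integral {0..x} (\<lambda>t. P t ** Y t) - integral {0..x} (\<lambda>t. P t ** Y' t)"
    if "x \<in> {0..pi}" for x
    using continuous_integrable_initial[OF c(2) that] continuous_integrable_initial[OF c(4) that]
      volterra_integrable[OF P c(1) that] volterra_integrable[OF P c(3) that]
    by (simp_all add: Henstock_Kurzweil_Integration.integral_diff matrix_mult.diff_right)
  then show ?thesis
    using 1 2 by (auto simp: volterra_def intro!: continuous_intros)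
qed

lemma volterra_mult_right:
  fixes P Y :: "real \<Rightarrow> complex^'m^'m"
  assumes P: "P absolutely_integrable_on {0..pi}" and 1: "volterra P A B Y Z"
  shows "volterra P (\<lambda>x. A x ** C) (\<lambda>x. B x ** C) (\<lambda>x. Y x ** C) (\<lambda>x. Z x ** C)"
proof -
  have c: "continuous_on {0..pi} Y" "continuous_on {0..pi} Z"
    using 1 by (auto simp: volterra_def)
  note bl = matrix_mult.bounded_linear_left[of C]
  have "integral {0..x} (\<lambda>t. Z t ** C) = integral {0..x} Z ** C"
    "integral {0..x} (\<lambda>t. P t ** (Y t ** C)) = integral {0..x} (\<lambda>t. P t ** Y t) ** C"
    if "x \<in> {0..pi}" for x
    using integral_linear[OF continuous_integrable_initial[OF c(2) that] bl]
      integral_linear[OF volterra_integrable[OF P c(1) that] bl]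
    by (simp_all add: o_def matrix_mul_assoc)
  moreover have "continuous_on {0..pi} (\<lambda>x. Y x ** C)" "continuous_on {0..pi} (\<lambda>x. Z x ** C)"
    by (intro matrix_mult.continuous_on c continuous_intros)+
  ultimately show ?thesis
    using 1 by (auto simp: volterra_def matrix_mult.add_left)
qed

section \<open>Caratheodory solutions\<close>

lemma AE_lebesgue_on_negligible:
  assumes "AE x in lebesgue_on {a..b::real}. P x"
  obtains N where "negligible N" "\<And>x. x \<in> {a..b} - N \<Longrightarrow> P x"
proof -
  have "AE x in lebesgue. x \<in> {a..b} \<longrightarrow> P x"
    using assms by (subst (asm) AE_restrict_space_iff) auto
  then obtain N where "N \<in> null_sets lebesgue" "{x \<in> space lebesgue. \<not> (x \<in> {a..b} \<longrightarrow> P x)} \<subseteq> N"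
    unfolding eventually_ae_filter by blast
  then show ?thesis
    by (intro that[of N]) (auto simp: negligible_iff_null_sets)
qed

lemma negligible_AE_lebesgue_on:
  assumes "negligible N" "\<And>x. x \<in> {a..b} - N \<Longrightarrow> P x"
  shows "AE x in lebesgue_on {a..b::real}. P x"
proof -
  have "AE x in lebesgue. x \<in> {a..b} \<longrightarrow> P x"
    by (rule AE_I'[of N]) (use assms in \<open>auto simp: negligible_iff_null_sets\<close>)
  then show ?thesis by (subst AE_restrict_space_iff) auto
qed

lemma solution_derivative:
  assumes "solution Q lam Y" "x \<in> {0..pi}"
  shows "(Y has_vector_derivative D Y x) (at x within {0..pi})"
proof -
  have "Y differentiable (at x within {0..pi})"
    using assms unfolding solution_def differentiable_on_def by blast
  then show ?thesis unfolding D_def by (rule vector_derivative_works[THEN iffD1])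
qed

lemma solution_second_derivative:
  fixes Y :: "real \<Rightarrow> complex^'m^'m"
  assumes "solution Q lam Y"
  obtains N where "negligible N"
    "\<And>x. x \<in> {0..pi} - N \<Longrightarrow> (D Y has_vector_derivative (Q x - mat lam) ** Y x) (at x)"
proof -
  have ae: "AE x in lebesgue_on {0..pi}. \<exists>Y2. (D Y has_vector_derivative Y2) (at x) \<and>
        - Y2 + Q x ** Y x = mat lam ** Y x"
    using assms by (simp add: solution_def)
  obtain N where N: "negligible N" "\<And>x. x \<in> {0..pi} - N \<Longrightarrow> \<exists>Y2. (D Y has_vector_derivative Y2) (at x) \<and>
        - Y2 + Q x ** Y x = mat lam ** Y x"
    using AE_lebesgue_on_negligible[OF ae] by blast
  show ?thesis
  proof (rule that[OF N(1)])
    fix x assume "x \<in> {0..pi} - N"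
    then obtain Y2 where Y2: "(D Y has_vector_derivative Y2) (at x)" "- Y2 + Q x ** Y x = mat lam ** Y x"
      using N(2) by blast
    have "Y2 = (Q x - mat lam) ** Y x"
      using Y2(2) by (simp add: matrix_mult.diff_left algebra_simps)
    then show "(D Y has_vector_derivative (Q x - mat lam) ** Y x) (at x)" using Y2(1) by simp
  qed
qed

text \<open>The ordinary fundamental theorem of calculus applies to \<open>Y\<close>, which is differentiable everywhere;
for \<open>D Y\<close> its absolutely continuous version is needed.\<close>

lemma solution_imp_volterra:
  fixes Y :: "real \<Rightarrow> complex^'m^'m"
  assumes sol: "solution Q lam Y"
  shows "volterra (\<lambda>t. Q t - mat lam) (\<lambda>_. Y 0) (\<lambda>_. D Y 0) Y (D Y)"
  unfolding volterra_def
proof (intro conjI ballI)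
  have ac: "abs_cont_on 0 pi (D Y)" using sol by (simp add: solution_def)
  show "continuous_on {0..pi} Y"
    using solution_derivative[OF sol] by (intro continuous_on_vector_derivative)
  show "continuous_on {0..pi} (D Y)" using ac by (rule abs_cont_on_imp_continuous_on)
  fix x assume x: "x \<in> {0..pi}"
  have sub: "{0..x} \<subseteq> {0..pi}" using x by auto
  have "(D Y has_integral (Y x - Y 0)) {0..x}"
    using x sub by (intro fundamental_theorem_of_calculus has_vector_derivative_within_subset[OF solution_derivative[OF sol] sub]) auto
  then show "Y x = Y 0 + integral {0..x} (D Y)" by (simp add: integral_unique)
  obtain N where N: "negligible N"
    "\<And>x. x \<in> {0..pi} - N \<Longrightarrow> (D Y has_vector_derivative (Q x - mat lam) ** Y x) (at x)"
    using solution_second_derivative[OF sol] by blast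
  have "((\<lambda>t. (Q t - mat lam) ** Y t) has_integral (D Y x - D Y 0)) {0..x}"
    using x sub N(2)
    by (intro abs_cont_has_integral[OF _ _ N(1)] abs_cont_on_subset[OF ac]) (auto intro: has_vector_derivative_at_within)
  then show "D Y x = D Y 0 + integral {0..x} (\<lambda>t. (Q t - mat lam) ** Y t)" by (simp add: integral_unique)
qed

text \<open>Here \<open>Z\<close> is an indefinite integral. It is absolutely continuous because the integrand is dominated by a
square integrable function, and it has the right derivative almost everywhere by Lebesgue's theorem.\<close>

lemma volterra_imp_solution:
  fixes Y :: "real \<Rightarrow> complex^'m^'m"
  assumes Q: "L2_potential Q" and vol: "volterra (\<lambda>t. Q t - mat lam) (\<lambda>_. A) (\<lambda>_. B) Y Z"
  shows "solution Q lam Y" "Y 0 = A" "\<And>x. x \<in> {0..pi} \<Longrightarrow> D Y x = Z x" "D Y 0 = B"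
proof -
  define P where "P t = Q t - mat lam" for t
  have P: "P absolutely_integrable_on {0..pi}"
    unfolding P_def by (rule coefficient_absolutely_integrable[OF Q])
  have cont: "continuous_on {0..pi} Y" "continuous_on {0..pi} Z"
    and eq: "\<And>x. x \<in> {0..pi} \<Longrightarrow> Y x = A + integral {0..x} Z"
      "\<And>x. x \<in> {0..pi} \<Longrightarrow> Z x = B + integral {0..x} (\<lambda>t. P t ** Y t)"
    using vol by (auto simp: volterra_def P_def)
  have dY: "(Y has_vector_derivative Z x) (at x within {0..pi})" if x: "x \<in> {0..pi}" for x
  proof -
    have "((\<lambda>x. A + integral {0..x} Z) has_vector_derivative Z x) (at x within {0..pi})"
      using has_vector_derivative_add[OF has_vector_derivative_const[of A] integral_has_vector_derivative[OF cont(2) x]]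
      by simp
    then show ?thesis
      by (rule has_vector_derivative_transform[OF x, rotated]) (simp add: eq(1))
  qed
  show DY: "D Y x = Z x" if "x \<in> {0..pi}" for x
    unfolding D_def using dY[OF that] vector_derivative_within_cbox[of 0 pi x Y "Z x"] that by auto
  show "Y 0 = A" "D Y 0 = B" using eq[of 0] DY[of 0] by auto
  have int: "(\<lambda>t. P t ** Y t) integrable_on {0..pi}" by (rule volterra_integrable[OF P cont(1)]) auto
  have "bounded (Y ` {0..pi})" by (intro compact_imp_bounded compact_continuous_image cont) auto
  then obtain K where K: "K > 0" "\<And>t. t \<in> {0..pi} \<Longrightarrow> norm (Y t) \<le> K" unfolding bounded_pos by blast
  have ac: "abs_cont_on 0 pi (\<lambda>x. integral {0..x} (\<lambda>t. P t ** Y t))"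
  proof (rule abs_cont_indefinite_integral[OF int])
    show "(\<lambda>t. (K * (norm (Q t) + norm (mat lam :: complex^'m^'m)))\<^sup>2) integrable_on {0..pi}"
      by (rule L2_potential_bound_square_integrable[OF Q])
    fix t assume t: "t \<in> {0..pi}"
    have "norm (P t ** Y t) \<le> norm (P t) * norm (Y t)" by (rule norm_matrix_mult_le)
    also have "\<dots> \<le> (norm (Q t) + norm (mat lam :: complex^'m^'m)) * K"
      unfolding P_def by (intro mult_mono norm_triangle_ineq4 K t) auto
    finally show "norm (P t ** Y t) \<le> K * (norm (Q t) + norm (mat lam :: complex^'m^'m))" by (simp add: mult.commute)
  qed
  have "abs_cont_on 0 pi (D Y)"
    by (rule abs_cont_on_dominated[OF ac ac, of 1]) (simp_all add: DY eq(2))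
  moreover have "Y differentiable_on {0..pi}"
    using dY unfolding differentiable_on_def has_vector_derivative_def differentiable_def by blast
  moreover have "AE x in lebesgue_on {0..pi}. \<exists>Y2. (D Y has_vector_derivative Y2) (at x) \<and>
        - Y2 + Q x ** Y x = mat lam ** Y x"
  proof -
    obtain N where N: "negligible N"
      "\<And>x. x \<in> {0<..<pi} - N \<Longrightarrow> ((\<lambda>x. integral {0..x} (\<lambda>t. P t ** Y t)) has_vector_derivative P x ** Y x) (at x)"
      using indefinite_integral_has_vector_derivative_ae[OF int] by blast
    show ?thesis
    proof (rule negligible_AE_lebesgue_on[of "N \<union> {0, pi}"])
      show "negligible (N \<union> {0, pi})" by (rule negligible_Un[OF N(1) negligible_finite]) simp
      fix x assume "x \<in> {0..pi} - (N \<union> {0, pi})"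
      then have x: "x \<in> {0<..<pi}" "x \<notin> N" by auto
      have "((\<lambda>x. B + integral {0..x} (\<lambda>t. P t ** Y t)) has_vector_derivative P x ** Y x) (at x)"
        using has_vector_derivative_add[OF has_vector_derivative_const[of B] N(2)] x by simp
      then have "(D Y has_vector_derivative P x ** Y x) (at x)"
        by (rule has_vector_derivative_transform_within_open[OF _ open_greaterThanLessThan x(1)])
           (simp add: DY eq(2))
      moreover have "- (P x ** Y x) + Q x ** Y x = mat lam ** Y x"
        by (simp add: P_def matrix_mult.diff_left)
      ultimately show "\<exists>Y2. (D Y has_vector_derivative Y2) (at x) \<and> - Y2 + Q x ** Y x = mat lam ** Y x" by blast
    qed
  qed
  ultimately show "solution Q lam Y" by (simp add: solution_def)
qed

definition fundamental_solution ::
  "(real \<Rightarrow> complex^'m^'m) \<Rightarrow> complex^'m^'m \<Rightarrow> complex^'m^'m \<Rightarrow> complex \<Rightarrow> real \<Rightarrow> complex^'m^'m" where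
  "fundamental_solution Q A B lam = (SOME Y. solution Q lam Y \<and> Y 0 = A \<and> D Y 0 = B)"

lemma phi_eq_fundamental_solution: "phi Q h = fundamental_solution Q (mat 1) h"
  by (simp add: phi_def fundamental_solution_def fun_eq_iff)

lemma fundamental_solution:
  fixes Q :: "real \<Rightarrow> complex^'m^'m"
  assumes Q: "L2_potential Q"
  shows "solution Q lam (fundamental_solution Q A B lam)"
    "fundamental_solution Q A B lam 0 = A" "D (fundamental_solution Q A B lam) 0 = B"
proof -
  obtain L a where La: "exp_dominated L a" "\<And>t. 1 \<le> a t"
    "\<And>t lam'. norm lam' \<le> norm lam \<Longrightarrow> norm (Q t - mat lam') \<le> a t"
    using coefficient_weight[OF Q norm_ge_zero[of lam]] by blast
  obtain Y Z where "volterra (\<lambda>t. Q t - mat lam) (\<lambda>_. A) (\<lambda>_. B) Y Z"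
    by (rule volterra_exists[OF La(1) coefficient_absolutely_integrable[OF Q] La(3)[OF order_refl] La(2)
          continuous_on_const continuous_on_const])
  from volterra_imp_solution[OF Q this]
  have "\<exists>Y. solution Q lam Y \<and> Y 0 = A \<and> D Y 0 = B" by blast
  from someI_ex[OF this]
  show "solution Q lam (fundamental_solution Q A B lam)"
    "fundamental_solution Q A B lam 0 = A" "D (fundamental_solution Q A B lam) 0 = B"
    unfolding fundamental_solution_def by blast+
qed

lemma fundamental_solution_volterra:
  fixes Q :: "real \<Rightarrow> complex^'m^'m"
  assumes Q: "L2_potential Q"
  shows "volterra (\<lambda>t. Q t - mat lam) (\<lambda>_. A) (\<lambda>_. B)
     (fundamental_solution Q A B lam) (D (fundamental_solution Q A B lam))"
  using solution_imp_volterra[OF fundamental_solution(1)[OF Q, of lam A B]]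
  by (simp add: fundamental_solution[OF Q])

lemma solution_unique:
  fixes Q :: "real \<Rightarrow> complex^'m^'m"
  assumes Q: "L2_potential Q" and Y: "solution Q lam Y" and Y': "solution Q lam Y'"
    and eq: "Y 0 = Y' 0" "D Y 0 = D Y' 0" and x: "x \<in> {0..pi}"
  shows "Y x = Y' x" "D Y x = D Y' x"
proof -
  obtain L a where La: "exp_dominated L a" "\<And>t. 1 \<le> a t"
    "\<And>t lam'. norm lam' \<le> norm lam \<Longrightarrow> norm (Q t - mat lam') \<le> a t"
    using coefficient_weight[OF Q norm_ge_zero[of lam]] by blast
  note P = coefficient_absolutely_integrable[OF Q, of lam]
  have "norm (Y x - Y' x) + norm (D Y x - D Y' x) \<le> 2 * 0 * exp (L * x)"
    by (rule volterra_bound[OF La(1) P La(3)[OF order_refl] La(2)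
          volterra_diff[OF P solution_imp_volterra[OF Y] solution_imp_volterra[OF Y']] _ x])
       (simp add: eq)
  then have "norm (Y x - Y' x) + norm (D Y x - D Y' x) \<le> 0" by simp
  then have "norm (Y x - Y' x) = 0" "norm (D Y x - D Y' x) = 0"
    using norm_ge_zero[of "Y x - Y' x"] norm_ge_zero[of "D Y x - D Y' x"] by linarith+
  then show "Y x = Y' x" "D Y x = D Y' x" by simp_all
qed

section \<open>The boundary matrices and the Weyl matrix\<close>

text \<open>For the data \<open>mat 1\<close>, \<open>h\<close> this is the matrix \<open>V(\<phi>)\<close>, whose determinant is the characteristic function;
for the data \<open>0\<close>, \<open>mat 1\<close> it is \<open>V(S)\<close>.\<close>

definition boundary_value ::
  "(real \<Rightarrow> complex^'m^'m) \<Rightarrow> complex^'m^'m \<Rightarrow> complex^'m^'m \<Rightarrow> complex^'m^'m \<Rightarrow> complex \<Rightarrow> complex^'m^'m" where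
  "boundary_value Q H A B lam = V H (fundamental_solution Q A B lam)"

lemma Delta_eq_det_boundary_value: "Delta Q h H lam = det (boundary_value Q H (mat 1) h lam)"
  by (simp add: Delta_def boundary_value_def phi_eq_fundamental_solution)

text \<open>The solutions with \<open>U Y = mat 1\<close> are the functions \<open>S + \<phi> C\<close>, and \<open>C\<close> is the value at \<open>0\<close>.\<close>

lemma solution_combination:
  fixes Q :: "real \<Rightarrow> complex^'m^'m" and h :: "complex^'m^'m" and lam :: complex
  assumes Q: "L2_potential Q"
  defines "Y \<equiv> \<lambda>C x. fundamental_solution Q 0 (mat 1) lam x + fundamental_solution Q (mat 1) h lam x ** C"
  shows "solution Q lam (Y C)" "Y C 0 = C" "D (Y C) 0 = mat 1 + h ** C"
    "V H (Y C) = boundary_value Q H 0 (mat 1) lam + boundary_value Q H (mat 1) h lam ** C"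
proof -
  note P = coefficient_absolutely_integrable[OF Q, of lam]
  let ?S = "fundamental_solution Q 0 (mat 1) lam" and ?F = "fundamental_solution Q (mat 1) h lam"
  have "volterra (\<lambda>t. Q t - mat lam) (\<lambda>_. 0 - mat 1 ** (- C)) (\<lambda>_. mat 1 - h ** (- C))
     (\<lambda>x. ?S x - ?F x ** (- C)) (\<lambda>x. D ?S x - D ?F x ** (- C))"
    by (intro volterra_diff volterra_mult_right P fundamental_solution_volterra[OF Q])
  then have "volterra (\<lambda>t. Q t - mat lam) (\<lambda>_. C) (\<lambda>_. mat 1 + h ** C) (Y C) (\<lambda>x. D ?S x + D ?F x ** C)"
    unfolding Y_def by (simp add: matrix_mult.minus_right)
  note v = volterra_imp_solution[OF Q this]
  show "solution Q lam (Y C)" "Y C 0 = C" "D (Y C) 0 = mat 1 + h ** C" by fact+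
  have "D (Y C) pi = D ?S pi + D ?F pi ** C" by (rule v(3)) auto
  then show "V H (Y C) = boundary_value Q H 0 (mat 1) lam + boundary_value Q H (mat 1) h lam ** C"
    by (simp add: V_def boundary_value_def Y_def matrix_mult.add_left matrix_mult.add_right matrix_mul_assoc)
qed

text \<open>If \<open>V(\<phi>)\<close> is invertible, \<open>C = - V(\<phi>)\<inverse> V(S)\<close> makes \<open>S + \<phi> C\<close> a Weyl solution, so the choice in the
definition of \<open>Phi\<close> is effective; uniqueness then identifies the chosen solution with \<open>S + \<phi> M(\<lambda>)\<close>,
and its vanishing boundary value is the asserted equation.\<close>

lemma Weyl_equation:
  fixes Q :: "real \<Rightarrow> complex^'m^'m"
  assumes Q: "L2_potential Q" and nz: "Delta Q h H lam \<noteq> 0"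
  shows "boundary_value Q H (mat 1) h lam ** Weyl Q h H lam = - boundary_value Q H 0 (mat 1) lam"
proof -
  define W where "W = boundary_value Q H (mat 1) h lam"
  define T where "T = boundary_value Q H 0 (mat 1) lam"
  note comb = solution_combination[OF Q, where lam = lam and h = h]
  obtain W' where W': "W ** W' = mat 1"
    using nz unfolding Delta_eq_det_boundary_value W_def[symmetric] invertible_det_nz[symmetric] invertible_def by blast
  have "solution Q lam Y \<and> U h Y = mat 1 \<and> V H Y = 0"
    if "Y = (\<lambda>x. fundamental_solution Q 0 (mat 1) lam x + fundamental_solution Q (mat 1) h lam x ** - (W' ** T))" for Y
  proof -
    have "W ** - (W' ** T) = - T"
      by (simp add: matrix_mult.minus_right matrix_mul_assoc W')
    then show ?thesis
      using comb(1-3)[of "- (W' ** T)"] comb(4)[of H "- (W' ** T)"] that by (simp add: U_def W_def T_def)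
  qed
  then have "\<exists>Y. solution Q lam Y \<and> U h Y = mat 1 \<and> V H Y = 0" by blast
  from someI_ex[OF this]
  have Phi: "solution Q lam (Phi Q h H lam)" "U h (Phi Q h H lam) = mat 1" "V H (Phi Q h H lam) = 0"
    unfolding Phi_def by blast+
  define M where "M = Weyl Q h H lam"
  have M: "Phi Q h H lam 0 = M" by (simp add: M_def Weyl_def)
  have DM: "D (Phi Q h H lam) 0 = mat 1 + h ** M"
    using Phi(2) by (simp add: U_def M algebra_simps)
  let ?Y = "\<lambda>x. fundamental_solution Q 0 (mat 1) lam x + fundamental_solution Q (mat 1) h lam x ** M"
  have eq0: "Phi Q h H lam 0 = ?Y 0" "D (Phi Q h H lam) 0 = D ?Y 0"
    by (simp_all only: M DM comb(2,3))
  have "Phi Q h H lam pi = ?Y pi" "D (Phi Q h H lam) pi = D ?Y pi"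
    using solution_unique[OF Q Phi(1) comb(1) eq0, of pi] by auto
  then have "V H (Phi Q h H lam) = V H ?Y" by (simp add: V_def)
  then have "T + W ** M = 0" using comb(4)[of H M] Phi(3) by (simp add: W_def T_def)
  then show ?thesis
    unfolding W_def[symmetric] T_def[symmetric] M_def[symmetric] by (simp add: add_eq_0_iff)
qed

lemma holomorphic_on_det:
  fixes F :: "complex \<Rightarrow> complex^'m^'m"
  assumes "\<And>i j. (\<lambda>z. F z $ i $ j) holomorphic_on S"
  shows "(\<lambda>z. det (F z)) holomorphic_on S"
  unfolding det_def by (intro holomorphic_intros assms)

lemma matrix_equation_cramer:
  fixes W M T :: "complex^'m^'m"
  assumes "W ** M = T" "det W \<noteq> 0"
  shows "M $ k $ l = det (\<chi> i j. if j = k then T $ i $ l else W $ i $ j) / det W"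
proof -
  have "W *v (column l M) = column l T"
    using assms(1) by (auto simp: vec_eq_iff matrix_vector_mult_def column_def matrix_matrix_mult_def)
  then have "column l M = (\<chi> k. det (\<chi> i j. if j = k then column l T $ i else W $ i $ j) / det W)"
    by (rule cramer[OF assms(2), THEN iffD1])
  then have "column l M $ k = det (\<chi> i j. if j = k then column l T $ i else W $ i $ j) / det W"
    by simp
  then show ?thesis by (simp only: column_def vec_lambda_beta)
qed

section \<open>Analyticity in the spectral parameter\<close>

lemma has_field_derivative_quadratic:
  fixes f :: "complex \<Rightarrow> complex"
  assumes "\<And>\<delta>. norm \<delta> \<le> 1 \<Longrightarrow> norm (f (z + \<delta>) - f z - \<delta> * f') \<le> C * (norm \<delta>)\<^sup>2"
  shows "(f has_field_derivative f') (at z)"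
  unfolding has_field_derivative_def has_derivative_at_alt
proof (intro conjI allI impI)
  show "bounded_linear ((*) f')" by (rule bounded_linear_mult_right)
  fix e :: real assume e: "e > 0"
  define d where "d = min 1 (e / (\<bar>C\<bar> + 1))"
  have "norm (f y - f z - f' * (y - z)) \<le> e * norm (y - z)" if y: "norm (y - z) < d" for y
  proof -
    have "norm (f y - f z - f' * (y - z)) \<le> C * (norm (y - z))\<^sup>2"
      using assms[of "y - z"] y by (simp add: d_def mult.commute)
    also have "\<dots> \<le> ((\<bar>C\<bar> + 1) * norm (y - z)) * norm (y - z)"
      unfolding power2_eq_square mult.assoc[symmetric] by (intro mult_right_mono) auto
    also have "(\<bar>C\<bar> + 1) * norm (y - z) \<le> e"
      using y e by (simp add: d_def field_simps)
    finally show ?thesis by (simp add: mult_right_mono)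
  qed
  then show "\<exists>d>0. \<forall>y. norm (y - z) < d \<longrightarrow> norm (f y - f z - f' * (y - z)) \<le> e * norm (y - z)"
    using e by (intro exI[of _ d]) (auto simp: d_def)
qed

text \<open>A change of the spectral parameter only adds a free term.\<close>

lemma volterra_shift:
  fixes Q Y :: "real \<Rightarrow> complex^'m^'m"
  assumes Q: "L2_potential Q" and v: "volterra (\<lambda>t. Q t - mat lam) A B Y Z"
  shows "volterra (\<lambda>t. Q t - mat lam0) A (\<lambda>x. B x + mat (lam0 - lam) ** integral {0..x} Y) Y Z"
proof -
  have c: "continuous_on {0..pi} Y" using v by (simp add: volterra_def)
  have "integral {0..x} (\<lambda>t. (Q t - mat lam) ** Y t)
      = mat (lam0 - lam) ** integral {0..x} Y + integral {0..x} (\<lambda>t. (Q t - mat lam0) ** Y t)" if x: "x \<in> {0..pi}" for x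
  proof -
    have "(Q t - mat lam) ** Y t = mat (lam0 - lam) ** Y t + (Q t - mat lam0) ** Y t" for t
      by (simp add: matrix_mult.diff_left vec_eq_iff algebra_simps)
    moreover have "(\<lambda>t. mat (lam0 - lam) ** Y t) integrable_on {0..x}"
      using integrable_linear[OF continuous_integrable_initial[OF c x] matrix_mult.bounded_linear_right[of "mat (lam0 - lam)"]]
      by (simp add: o_def)
    moreover have "integral {0..x} (\<lambda>t. mat (lam0 - lam) ** Y t) = mat (lam0 - lam) ** integral {0..x} Y"
      using integral_linear[OF continuous_integrable_initial[OF c x] matrix_mult.bounded_linear_right[of "mat (lam0 - lam)"]]
      by (simp add: o_def)
    ultimately show ?thesis
      using volterra_integrable[OF coefficient_absolutely_integrable[OF Q] c x]
      by (simp add: Henstock_Kurzweil_Integration.integral_add)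
  qed
  then show ?thesis using v by (simp add: volterra_def)
qed

text \<open>The derivative of the solution \<open>Y\<close> with respect to \<open>\<lambda>\<close> at \<open>\<lambda>\<^sub>0\<close> is the solution \<open>Y\<^sub>1\<close> of
\<open>Y\<^sub>1'' = (Q - \<lambda>\<^sub>0) Y\<^sub>1 - Y\<close> with vanishing initial values. Both the increment of \<open>Y\<close> and its remainder after
subtracting \<open>\<delta> Y\<^sub>1\<close> solve systems with small free terms; the Gronwall estimate bounds the former by a
multiple of \<open>\<delta>\<close> and then the latter by a multiple of \<open>\<delta>\<^sup>2\<close>.\<close>

lemma boundary_value_holomorphic:
  fixes Q :: "real \<Rightarrow> complex^'m^'m"
  assumes Q: "L2_potential Q"
  shows "(\<lambda>lam. boundary_value Q H A B lam $ i $ j) holomorphic_on S"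
proof -
  have "\<exists>d. ((\<lambda>lam. boundary_value Q H A B lam $ i $ j) has_field_derivative d) (at lam0)" for lam0
  proof -
    define Y where "Y = fundamental_solution Q A B"
    define Z where "Z lam = D (Y lam)" for lam
    define P where "P t = Q t - mat lam0" for t
    have P: "P absolutely_integrable_on {0..pi}"
      unfolding P_def by (rule coefficient_absolutely_integrable[OF Q])
    obtain L a where La: "exp_dominated L a" "\<And>t. 1 \<le> a t"
      "\<And>t lam. norm lam \<le> norm lam0 + 1 \<Longrightarrow> norm (Q t - mat lam) \<le> a t"
      using coefficient_weight[OF Q, of "norm lam0 + 1"] by auto
    have Lp: "L > 0" using La(1) by (simp add: exp_dominated_def)
    have Pa: "norm (P t) \<le> a t" for t unfolding P_def by (rule La(3)) simp
    have vol: "volterra (\<lambda>t. Q t - mat lam) (\<lambda>_. A) (\<lambda>_. B) (Y lam) (Z lam)" for lam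
      unfolding Y_def Z_def by (rule fundamental_solution_volterra[OF Q])
    have cont: "continuous_on {0..pi} (Y lam)" for lam using vol[of lam] by (simp add: volterra_def)
    define e where "e = exp (L * pi)"
    have e: "exp (L * x) \<le> e" if "x \<in> {0..pi}" for x using that Lp by (simp add: e_def)
    have forced: "norm (E x) + norm (E' x) \<le> 2 * pi * e * (norm c * M)"
      if v: "volterra P (\<lambda>_. 0) (\<lambda>x. mat c ** integral {0..x} F) E E'" and F: "continuous_on {0..pi} F"
        and M: "\<And>t. t \<in> {0..pi} \<Longrightarrow> norm (F t) \<le> M" and x: "x \<in> {0..pi}"
      for c M x and F E E' :: "real \<Rightarrow> complex^'m^'m"
    proof -
      have M0: "M \<ge> 0" using order_trans[OF norm_ge_zero M[of 0]] by simp
      have "norm (E x) + norm (E' x) \<le> 2 * (norm c * (M * pi)) * exp (L * x)"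
      proof (rule volterra_bound[OF La(1) P Pa La(2) v _ x])
        fix x :: real assume x: "x \<in> {0..pi}"
        have "norm (integral {0..x} F) \<le> M * (x - 0)"
          using x M F by (intro integral_bound continuous_on_subset[OF F]) auto
        also have "\<dots> \<le> M * pi" using x M0 by (intro mult_left_mono) auto
        finally show "norm (0 :: complex^'m^'m) + norm (mat c ** integral {0..x} F) \<le> norm c * (M * pi)"
          by (simp add: norm_mat_mult mult_left_mono)
      qed
      also have "\<dots> \<le> 2 * (norm c * (M * pi)) * e"
        using e[OF x] M0 by (intro mult_left_mono) auto
      finally show ?thesis by (simp add: ac_simps)
    qed
    define K where "K = 2 * (norm A + norm B) * e"
    have bound: "norm (Y lam x) \<le> K" if "norm (lam - lam0) \<le> 1" "x \<in> {0..pi}" for lam x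
    proof -
      have "norm lam \<le> norm lam0 + 1" using that(1) norm_triangle_sub[of lam lam0] by linarith
      then have "norm (Y lam x) + norm (Z lam x) \<le> 2 * (norm A + norm B) * exp (L * x)"
        by (intro volterra_bound[OF La(1) coefficient_absolutely_integrable[OF Q] La(3) La(2) vol _ that(2)]) auto
      also have "\<dots> \<le> K" unfolding K_def using e[OF that(2)] by (intro mult_left_mono) auto
      finally show ?thesis using norm_ge_zero[of "Z lam x"] by linarith
    qed
    (* The increments solve the system for lam0 with a free term of order lam - lam0. *)
    have shift: "volterra P (\<lambda>_. 0) (\<lambda>x. mat (lam0 - lam) ** integral {0..x} (Y lam))
        (\<lambda>x. Y lam x - Y lam0 x) (\<lambda>x. Z lam x - Z lam0 x)" for lam
      using volterra_diff[OF P volterra_shift[OF Q vol, of lam0 lam, folded P_def] vol[of lam0, folded P_def]]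
      by simp
    have lip: "norm (Y lam x - Y lam0 x) \<le> 2 * pi * e * (norm (lam - lam0) * K)"
      if "norm (lam - lam0) \<le> 1" "x \<in> {0..pi}" for lam x
    proof -
      have "norm (Y lam x - Y lam0 x) \<le> norm (Y lam x - Y lam0 x) + norm (Z lam x - Z lam0 x)" by simp
      also have "\<dots> \<le> 2 * pi * e * (norm (lam0 - lam) * K)"
        by (rule forced[OF shift cont bound[OF that(1)] that(2)])
      finally show ?thesis by (simp only: norm_minus_commute[of lam0 lam])
    qed
    have "continuous_on {0..pi} (\<lambda>x. mat (- 1) ** integral {0..x} (Y lam0))"
      by (intro matrix_mult.continuous_on continuous_on_const indefinite_integral_continuous_1 integrable_continuous_real cont)
    then obtain Y1 Z1 where Y1: "volterra P (\<lambda>_. 0) (\<lambda>x. mat (- 1) ** integral {0..x} (Y lam0)) Y1 Z1"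
      using volterra_exists[OF La(1) P Pa La(2) continuous_on_const] by metis
    (* After subtraction of the linear part the free term is of second order. *)
    have rem: "volterra P (\<lambda>_. 0) (\<lambda>x. mat (lam0 - lam) ** integral {0..x} (\<lambda>t. Y lam t - Y lam0 t))
        (\<lambda>x. Y lam x - Y lam0 x - Y1 x ** mat (lam - lam0)) (\<lambda>x. Z lam x - Z lam0 x - Z1 x ** mat (lam - lam0))" for lam
    proof -
      have "mat (lam0 - lam) ** integral {0..x} (Y lam) - mat (- 1) ** integral {0..x} (Y lam0) ** mat (lam - lam0)
          = mat (lam0 - lam) ** integral {0..x} (\<lambda>t. Y lam t - Y lam0 t)" if "x \<in> {0..pi}" for x
        using continuous_integrable_initial[OF cont that]
        by (simp add: Henstock_Kurzweil_Integration.integral_diff vec_eq_iff algebra_simps)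
      then show ?thesis
        using volterra_diff[OF P shift[of lam] volterra_mult_right[OF P Y1, of "mat (lam - lam0)"]]
        by (simp add: volterra_def)
    qed
    define C where "C = (1 + norm H) * (2 * pi * e * (2 * pi * e * K))"
    define d where "d = (Z1 pi + H ** Y1 pi) $ i $ j"
    have "norm (boundary_value Q H A B (lam0 + \<delta>) $ i $ j - boundary_value Q H A B lam0 $ i $ j - \<delta> * d) \<le> C * (norm \<delta>)\<^sup>2"
      if \<delta>: "norm \<delta> \<le> 1" for \<delta>
    proof -
      define EY EZ where "EY = Y (lam0 + \<delta>) pi - Y lam0 pi - Y1 pi ** mat \<delta>"
        and "EZ = Z (lam0 + \<delta>) pi - Z lam0 pi - Z1 pi ** mat \<delta>"
      have "norm EY + norm EZ \<le> 2 * pi * e * (norm (- \<delta>) * (2 * pi * e * (norm \<delta> * K)))"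
      proof -
        have "norm (Y (lam0 + \<delta>) t - Y lam0 t) \<le> 2 * pi * e * (norm \<delta> * K)" if "t \<in> {0..pi}" for t
          using lip[of "lam0 + \<delta>" t] \<delta> that by simp
        from forced[OF rem[of "lam0 + \<delta>"] _ this, of pi] show ?thesis
          by (simp add: EY_def EZ_def continuous_on_diff cont)
      qed
      then have E: "norm EY + norm EZ \<le> 2 * pi * e * (2 * pi * e * K) * (norm \<delta>)\<^sup>2"
        by (simp add: power2_eq_square ac_simps)
      have "boundary_value Q H A B (lam0 + \<delta>) $ i $ j - boundary_value Q H A B lam0 $ i $ j - \<delta> * d
          = (EZ + H ** EY) $ i $ j"
        unfolding boundary_value_def V_def d_def EY_def EZ_def Z_def Y_def
        by (simp add: matrix_mult.diff_right matrix_mult.add_right matrix_mul_assoc algebra_simps)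
      also have "norm \<dots> \<le> norm (EZ + H ** EY)" by (rule norm_entry_le)
      also have "\<dots> \<le> norm EZ + norm H * norm EY"
        by (rule order_trans[OF norm_triangle_ineq add_left_mono[OF norm_matrix_mult_le]])
      also have "\<dots> \<le> (1 + norm H) * (norm EY + norm EZ)"
        by (simp add: algebra_simps)
      also have "\<dots> \<le> (1 + norm H) * (2 * pi * e * (2 * pi * e * K) * (norm \<delta>)\<^sup>2)"
        by (intro mult_left_mono E) auto
      finally show ?thesis by (simp add: C_def mult.assoc)
    qed
    from has_field_derivative_quadratic[OF this] show ?thesis by blast
  qed
  then show ?thesis
    unfolding holomorphic_on_def field_differentiable_def using has_field_derivative_at_within by blast
qed

section \<open>Variation of constants with an integer frequency\<close>

lemma abs_cont_on_C1:
  fixes f :: "real \<Rightarrow> real"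
  assumes d: "\<And>t. (f has_real_derivative f' t) (at t)" and c: "continuous_on {a..b} f'"
  shows "abs_cont_on a b f"
proof -
  have "bounded (f' ` {a..b})" using c by (intro compact_imp_bounded compact_continuous_image) auto
  then obtain K where K: "\<And>t. t \<in> {a..b} \<Longrightarrow> \<bar>f' t\<bar> \<le> K" unfolding bounded_iff by (metis (no_types) imageI real_norm_def)
  show ?thesis
  proof (rule abs_cont_on_lipschitz[of _ _ _ K])
    fix s t assume st: "a \<le> s" "s \<le> t" "t \<le> b"
    show "norm (f t - f s) \<le> K * (t - s)"
    proof (cases "s = t")
      case False
      then obtain z where z: "s < z" "z < t" "f t - f s = (t - s) * f' z"
        using MVT2[of s t f f'] d st by auto
      then show ?thesis using K[of z] st by (simp add: abs_mult mult.commute mult_right_mono)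
    qed simp
  qed
qed

lemma solution_abs_cont:
  fixes Y :: "real \<Rightarrow> complex^'m^'m"
  assumes sol: "solution Q lam Y"
  shows "abs_cont_on 0 pi Y" "abs_cont_on 0 pi (D Y)" "continuous_on {0..pi} Y" "continuous_on {0..pi} (D Y)"
proof -
  show ac: "abs_cont_on 0 pi (D Y)" using sol by (simp add: solution_def)
  show c: "continuous_on {0..pi} (D Y)" by (rule abs_cont_on_imp_continuous_on[OF ac])
  have "bounded (D Y ` {0..pi})" using c by (intro compact_imp_bounded compact_continuous_image) auto
  then obtain K where K: "\<And>t. t \<in> {0..pi} \<Longrightarrow> norm (D Y t) \<le> K" unfolding bounded_iff by (meson imageI)
  have ai: "abs_cont_on 0 pi (\<lambda>x. integral {0..x} (D Y))"
    by (rule abs_cont_indefinite_integral[where g = "\<lambda>_. K"])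
       (use K c in \<open>auto intro: integrable_continuous_real\<close>)
  have Y: "Y x = Y 0 + integral {0..x} (D Y)" if "x \<in> {0..pi}" for x
    using solution_imp_volterra[OF sol] that unfolding volterra_def by blast
  have diff: "Y t - Y s = integral {0..t} (D Y) - integral {0..s} (D Y)" if "0 \<le> s" "s \<le> t" "t \<le> pi" for s t
  proof -
    have "Y t = Y 0 + integral {0..t} (D Y)" "Y s = Y 0 + integral {0..s} (D Y)" by (rule Y; use that in simp)+
    then show ?thesis by (metis add_diff_cancel_left)
  qed
  show acY: "abs_cont_on 0 pi Y"
    by (rule abs_cont_on_dominated[OF ai ai, of 1]) (simp_all add: diff)
  show "continuous_on {0..pi} Y" by (rule abs_cont_on_imp_continuous_on[OF acY])
qed

text \<open>Lagrange's identity: if \<open>p' = - q\<close> and \<open>q' = k p\<close>, then \<open>p Y' + q Y\<close> has the derivative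
\<open>p (Y'' + k Y)\<close>. Trigonometric \<open>p\<close> give the variation of constants formulas for the frequency \<open>sqrt k\<close>.\<close>

lemma solution_multiplier_integral:
  fixes Y :: "real \<Rightarrow> complex^'m^'m" and p q :: "real \<Rightarrow> real"
  assumes sol: "solution Q lam Y"
    and p: "\<And>t. (p has_real_derivative - q t) (at t)" and q: "\<And>t. (q has_real_derivative k * p t) (at t)"
    and x: "x \<in> {0..pi}"
  shows "((\<lambda>t. p t *\<^sub>R ((Q t - mat (lam - of_real k)) ** Y t)) has_integral
     (p x *\<^sub>R D Y x + q x *\<^sub>R Y x) - (p 0 *\<^sub>R D Y 0 + q 0 *\<^sub>R Y 0)) {0..x}"
proof -
  have cp: "continuous_on {0..pi} p" "continuous_on {0..pi} q"
    using p q by (meson DERIV_isCont continuous_at_imp_continuous_on)+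
  have ac: "abs_cont_on 0 pi p" "abs_cont_on 0 pi q"
    by (rule abs_cont_on_C1[OF p], intro continuous_intros cp) (rule abs_cont_on_C1[OF q], intro continuous_intros cp)
  have acF: "abs_cont_on 0 pi (\<lambda>t. p t *\<^sub>R D Y t + q t *\<^sub>R Y t)"
    by (intro abs_cont_on_add abs_cont_on_bilinear[OF bounded_bilinear_scaleR] ac solution_abs_cont[OF sol])
  obtain N where N: "negligible N"
    "\<And>x. x \<in> {0..pi} - N \<Longrightarrow> (D Y has_vector_derivative (Q x - mat lam) ** Y x) (at x)"
    using solution_second_derivative[OF sol] by blast
  have sub: "{0..x} \<subseteq> {0..pi}" using x by auto
  show ?thesis
  proof (rule abs_cont_has_integral[OF _ abs_cont_on_subset[OF acF] N(1)])
    fix t assume t: "t \<in> {0..x} - N"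
    then have t': "t \<in> {0..pi}" "t \<in> {0..pi} - N" using sub by auto
    have 1: "(Y has_vector_derivative D Y t) (at t within {0..x})"
      by (rule has_vector_derivative_within_subset[OF solution_derivative[OF sol t'(1)] sub])
    have 2: "(D Y has_vector_derivative (Q t - mat lam) ** Y t) (at t within {0..x})"
      by (rule has_vector_derivative_at_within[OF N(2)[OF t'(2)]])
    have "((\<lambda>t. p t *\<^sub>R D Y t + q t *\<^sub>R Y t) has_vector_derivative
       (p t *\<^sub>R ((Q t - mat lam) ** Y t) + (- q t) *\<^sub>R D Y t) + (q t *\<^sub>R D Y t + (k * p t) *\<^sub>R Y t)) (at t within {0..x})"
      by (intro has_vector_derivative_add has_vector_derivative_scaleR 1 2 DERIV_subset[OF p] DERIV_subset[OF q]) auto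
    also have "(p t *\<^sub>R ((Q t - mat lam) ** Y t) + (- q t) *\<^sub>R D Y t) + (q t *\<^sub>R D Y t + (k * p t) *\<^sub>R Y t)
        = p t *\<^sub>R ((Q t - mat (lam - of_real k)) ** Y t)"
      by (simp add: matrix_mult.diff_left vec_eq_iff scaleR_conv_of_real[where 'a = complex] algebra_simps)
    finally show "((\<lambda>t. p t *\<^sub>R D Y t + q t *\<^sub>R Y t) has_vector_derivative
        p t *\<^sub>R ((Q t - mat (lam - of_real k)) ** Y t)) (at t within {0..x})" .
  qed (use x in auto)
qed

text \<open>The frequency of comparison is the integer \<open>n\<close> and not the square root of the spectral parameter. This
keeps the kernels real and bounded, and the terms with \<open>sin (n \<pi>)\<close> at the right end point vanish.\<close>

lemma solution_oscillation_formula: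
  fixes Y :: "real \<Rightarrow> complex^'m^'m"
  assumes sol: "solution Q ((of_nat n)\<^sup>2 + mu) Y" and n: "n \<ge> 1"
  shows "x \<in> {0..pi} \<Longrightarrow> Y x = cos (n * x) *\<^sub>R Y 0 + (sin (n * x) / n) *\<^sub>R D Y 0
      + integral {0..x} (\<lambda>t. (sin (n * (x - t)) / n) *\<^sub>R ((Q t - mat mu) ** Y t))"
    and "(- 1) ^ n *\<^sub>R D Y pi = D Y 0 + integral {0..pi} (\<lambda>t. cos (n * t) *\<^sub>R ((Q t - mat mu) ** Y t))"
proof -
  have k: "(of_nat n)\<^sup>2 + mu - of_real ((real n)\<^sup>2) = mu" by simp
  have n0: "real n \<noteq> 0" using n by simp
  {
    assume x: "x \<in> {0..pi}"
    have "((\<lambda>t. (sin (n * (x - t)) / n) *\<^sub>R ((Q t - mat mu) ** Y t)) has_integral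
       ((sin (n * (x - x)) / n) *\<^sub>R D Y x + cos (n * (x - x)) *\<^sub>R Y x) - ((sin (n * (x - 0)) / n) *\<^sub>R D Y 0 + cos (n * (x - 0)) *\<^sub>R Y 0)) {0..x}"
      by (rule solution_multiplier_integral[OF sol _ _ x, where k = "(real n)\<^sup>2", unfolded k])
         (use n0 in \<open>auto intro!: derivative_eq_intros simp: power2_eq_square field_simps\<close>)
    then have "integral {0..x} (\<lambda>t. (sin (n * (x - t)) / n) *\<^sub>R ((Q t - mat mu) ** Y t))
       = Y x - ((sin (n * x) / n) *\<^sub>R D Y 0 + cos (n * x) *\<^sub>R Y 0)"
      by (simp add: integral_unique)
    then show "Y x = cos (n * x) *\<^sub>R Y 0 + (sin (n * x) / n) *\<^sub>R D Y 0
      + integral {0..x} (\<lambda>t. (sin (n * (x - t)) / n) *\<^sub>R ((Q t - mat mu) ** Y t))"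
      by simp
  }
  have "((\<lambda>t. cos (n * t) *\<^sub>R ((Q t - mat mu) ** Y t)) has_integral
       (cos (n * pi) *\<^sub>R D Y pi + (n * sin (n * pi)) *\<^sub>R Y pi) - (cos (real n * 0) *\<^sub>R D Y 0 + (n * sin (real n * 0)) *\<^sub>R Y 0)) {0..pi}"
    by (rule solution_multiplier_integral[OF sol, where k = "(real n)\<^sup>2", unfolded k])
       (auto intro!: derivative_eq_intros simp: power2_eq_square)
  then show "(- 1) ^ n *\<^sub>R D Y pi = D Y 0 + integral {0..pi} (\<lambda>t. cos (n * t) *\<^sub>R ((Q t - mat mu) ** Y t))"
    by (simp add: integral_unique cos_npi)
qed

lemma norm_oscillating_integral_le:
  fixes P F :: "real \<Rightarrow> complex^'m^'m"
  assumes P: "P absolutely_integrable_on {0..pi}" and F: "continuous_on {0..pi} F"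
    and a: "a absolutely_integrable_on {0..pi}" and Pa: "\<And>t. norm (P t) \<le> a t"
    and s: "continuous_on {0..pi} s" "\<And>t. \<bar>s t\<bar> \<le> \<sigma>"
    and y: "continuous_on {0..pi} y" "\<And>t. t \<in> {0..pi} \<Longrightarrow> norm (F t) \<le> y t" and x: "x \<in> {0..pi}"
  shows "norm (integral {0..x} (\<lambda>t. s t *\<^sub>R (P t ** F t))) \<le> integral {0..x} (\<lambda>t. a t * (\<sigma> * y t))"
proof -
  have sub: "{0..x} \<subseteq> {0..pi}" using x by auto
  have "norm (integral {0..x} (\<lambda>t. P t ** (s t *\<^sub>R F t))) \<le> integral {0..x} (\<lambda>t. a t * (\<sigma> * y t))"
  proof (rule norm_integral_matrix_mult_le)
    show "P absolutely_integrable_on {0..x}" "a absolutely_integrable_on {0..x}"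
      using P a sub by (auto intro: absolutely_integrable_on_subinterval)
    show "continuous_on {0..x} (\<lambda>t. s t *\<^sub>R F t)" "continuous_on {0..x} (\<lambda>t. \<sigma> * y t)"
      by (intro continuous_intros continuous_on_subset[OF F sub] continuous_on_subset[OF s(1) sub] continuous_on_subset[OF y(1) sub])+
    fix t assume t: "t \<in> {0..x}"
    show "norm (P t) \<le> a t" by (rule Pa)
    have "0 \<le> \<sigma>" using order_trans[OF abs_ge_zero s(2)] .
    then show "norm (s t *\<^sub>R F t) \<le> \<sigma> * y t"
      using s(2)[of t] y(2)[of t] t sub by (auto intro!: mult_mono)
  qed
  then show ?thesis by (simp add: matrix_mult.scaleR_right)
qed

text \<open>The Gronwall estimate applies to the first formula because its kernel is bounded by \<open>a\<close> for every \<open>n\<close>;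
thus \<open>M\<close> does not depend on \<open>n\<close>. Inserting it into the formula gains the factor \<open>1/n\<close> of the sine kernel.\<close>

lemma solution_oscillation_bound:
  fixes Y :: "real \<Rightarrow> complex^'m^'m"
  assumes Q: "L2_potential Q" and sol: "solution Q ((of_nat n)\<^sup>2 + mu) Y" and n: "n \<ge> 1"
    and La: "exp_dominated L a" "\<And>t. norm (Q t - mat mu) \<le> a t" and x: "x \<in> {0..pi}"
  defines "M \<equiv> 2 * (norm (Y 0) + norm (D Y 0)) * exp (L * pi)"
  shows "norm (Y x) \<le> M"
    and "norm (Y x - cos (n * x) *\<^sub>R Y 0) \<le> (norm (D Y 0) + integral {0..pi} a * M) / n"
proof -
  note P = coefficient_absolutely_integrable[OF Q, of mu]
  note cY = solution_abs_cont(3)[OF sol]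
  have a: "a absolutely_integrable_on {0..pi}" and Lp: "L > 0" and a0: "\<And>t. t \<in> {0..pi} \<Longrightarrow> 0 \<le> a t"
    using La(1) by (auto simp: exp_dominated_def)
  have n1: "1 / real n \<le> 1" using n by simp
  have tail: "norm (integral {0..x} (\<lambda>t. (sin (n * (x - t)) / n) *\<^sub>R ((Q t - mat mu) ** Y t)))
      \<le> integral {0..x} (\<lambda>t. a t * (1 / n * y t))"
    if "x \<in> {0..pi}" "continuous_on {0..pi} y" "\<And>t. t \<in> {0..pi} \<Longrightarrow> norm (Y t) \<le> y t" for x y
    using n that by (intro norm_oscillating_integral_le[OF P cY a La(2)] continuous_intros)
       (auto simp: divide_right_mono)
  have Yf: "norm (Y x) \<le> (norm (Y 0) + norm (D Y 0)) + integral {0..x} (\<lambda>t. a t * norm (Y t))"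
    if x: "x \<in> {0..pi}" for x
  proof -
    have sub: "{0..x} \<subseteq> {0..pi}" using x by auto
    have "norm (Y x) \<le> norm (cos (n * x) *\<^sub>R Y 0) + norm ((sin (n * x) / n) *\<^sub>R D Y 0)
        + norm (integral {0..x} (\<lambda>t. (sin (n * (x - t)) / n) *\<^sub>R ((Q t - mat mu) ** Y t)))"
      by (subst solution_oscillation_formula(1)[OF sol n x])
         (rule order_trans[OF norm_triangle_ineq add_right_mono[OF norm_triangle_ineq]])
    also have "norm (cos (n * x) *\<^sub>R Y 0) \<le> norm (Y 0)"
      by (simp add: mult_left_le_one_le)
    also have "norm ((sin (n * x) / n) *\<^sub>R D Y 0) \<le> norm (D Y 0)"
    proof -
      have s: "\<bar>sin (n * x)\<bar> / n \<le> 1" using n order_trans[OF abs_sin_le_one[of "n * x"], of "real n"] by simp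
      show ?thesis using mult_right_mono[OF s norm_ge_zero[of "D Y 0"]] by simp
    qed
    also have "norm (integral {0..x} (\<lambda>t. (sin (n * (x - t)) / n) *\<^sub>R ((Q t - mat mu) ** Y t)))
        \<le> integral {0..x} (\<lambda>t. a t * (1 / n * norm (Y t)))"
      by (rule tail[OF x]) (auto intro: continuous_intros cY)
    also have "\<dots> \<le> integral {0..x} (\<lambda>t. a t * norm (Y t))"
    proof (rule integral_le)
      have a': "a absolutely_integrable_on {0..x}" using a sub by (rule absolutely_integrable_on_subinterval)
      show "(\<lambda>t. a t * (1 / n * norm (Y t))) integrable_on {0..x}" "(\<lambda>t. a t * norm (Y t)) integrable_on {0..x}"
        by (intro continuous_times_absolutely_integrable[OF a', THEN absolutely_integrable_on_def[THEN iffD1, THEN conjunct1]]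
             continuous_intros continuous_on_subset[OF cY sub])+
      show "a t * (1 / n * norm (Y t)) \<le> a t * norm (Y t)" if "t \<in> {0..x}" for t
        using a0[of t] that sub n1 by (intro mult_left_mono mult_left_le_one_le) auto
    qed
    finally show ?thesis by simp
  qed
  have bd: "norm (Y x) \<le> M" if x: "x \<in> {0..pi}" for x
  proof -
    have "norm (Y x) \<le> 2 * (norm (Y 0) + norm (D Y 0)) * exp (L * x)"
      by (rule exp_dominated_gronwall[OF La(1) _ _ Yf x]) (auto intro: continuous_intros cY)
    also have "\<dots> \<le> M" unfolding M_def using x Lp by (intro mult_left_mono) auto
    finally show ?thesis .
  qed
  show "norm (Y x) \<le> M" by (rule bd[OF x])
  have M: "M \<ge> 0" by (simp add: M_def)
  have "Y x - cos (n * x) *\<^sub>R Y 0 = (sin (n * x) / n) *\<^sub>R D Y 0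
        + integral {0..x} (\<lambda>t. (sin (n * (x - t)) / n) *\<^sub>R ((Q t - mat mu) ** Y t))"
    by (subst solution_oscillation_formula(1)[OF sol n x]) simp
  also have "norm \<dots> \<le> norm (D Y 0) / n + integral {0..pi} a * M / n"
  proof (rule order_trans[OF norm_triangle_ineq add_mono])
    show "norm ((sin (n * x) / n) *\<^sub>R D Y 0) \<le> norm (D Y 0) / n"
      using n mult_right_mono[OF abs_sin_le_one[of "n * x"], of "norm (D Y 0)"] by (simp add: divide_right_mono)
    have "norm (integral {0..x} (\<lambda>t. (sin (n * (x - t)) / n) *\<^sub>R ((Q t - mat mu) ** Y t)))
        \<le> integral {0..x} (\<lambda>t. a t * (1 / n * M))"
      by (rule tail[OF x continuous_on_const bd])
    also have "\<dots> = integral {0..x} a * (M / n)" by simp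
    also have "\<dots> \<le> integral {0..pi} a * (M / n)"
      using a x M a0 by (intro mult_right_mono integral_subset_le)
         (auto simp: absolutely_integrable_on_def intro: integrable_on_subinterval)
    finally show "norm (integral {0..x} (\<lambda>t. (sin (n * (x - t)) / n) *\<^sub>R ((Q t - mat mu) ** Y t))) \<le> integral {0..pi} a * M / n"
      by simp
  qed
  finally show "norm (Y x - cos (n * x) *\<^sub>R Y 0) \<le> (norm (D Y 0) + integral {0..pi} a * M) / n"
    by (simp add: add_divide_distrib)
qed

lemma has_integral_cos:
  assumes "k \<noteq> 0"
  shows "((\<lambda>t. cos (k * t)) has_integral sin (k * pi) / k) {0..pi}"
proof -
  have "((\<lambda>t. cos (k * t)) has_integral (sin (k * pi) / k - sin (k * 0) / k)) {0..pi}"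
    using assms
    by (intro fundamental_theorem_of_calculus)
       (auto intro!: derivative_eq_intros simp: has_real_derivative_iff_has_vector_derivative[symmetric])
  then show ?thesis by simp
qed

lemma has_integral_cos_even:
  assumes "k \<noteq> 0"
  shows "((\<lambda>t. cos (2 * (of_int k * t))) has_integral 0) {0..pi}"
proof -
  have "((\<lambda>t. cos (2 * of_int k * t)) has_integral sin (2 * of_int k * pi) / (2 * of_int k)) {0..pi}"
    using assms by (intro has_integral_cos) auto
  moreover have "sin (2 * of_int k * pi) = 0"
    using sin_zero_iff_int2[of "2 * of_int k * pi"] by (metis of_int_mult of_int_numeral)
  ultimately show ?thesis by (simp add: mult.assoc)
qed

lemma has_integral_cos_square:
  assumes n: "n \<ge> 1"
  shows "((\<lambda>t. (cos (real n * t))\<^sup>2) has_integral pi / 2) {0..pi}"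
proof -
  have "((\<lambda>t. 1 / 2 * cos (2 * (of_int (int n) * t)) + 1 / 2) has_integral (1 / 2 * 0 + (pi - 0) *\<^sub>R (1 / 2))) {0..pi}"
    using n has_integral_const_real[of "1/2 :: real" 0 pi]
    by (intro has_integral_add has_integral_mult_right has_integral_cos_even) auto
  moreover have "1 / 2 * cos (2 * (of_int (int n) * t)) + 1 / 2 = (cos (real n * t))\<^sup>2" for t
    by (simp add: cos_double_cos diff_divide_distrib)
  ultimately show ?thesis by simp
qed

lemma scaled_product_integrable:
  fixes P F :: "real \<Rightarrow> complex^'m^'m"
  assumes "P absolutely_integrable_on {0..pi}" "continuous_on {0..pi} F" "continuous_on {0..pi} s"
  shows "(\<lambda>t. s t *\<^sub>R (P t ** F t)) integrable_on {0..pi}"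
  using volterra_integrable[OF assms(1) continuous_on_scaleR[OF assms(3,2)], of pi]
  by (simp add: matrix_mult.scaleR_right)

definition cos_coefficient :: "(real \<Rightarrow> complex^'m^'m) \<Rightarrow> nat \<Rightarrow> complex^'m^'m" where
  "cos_coefficient Q n = integral {0..pi} (\<lambda>t. cos (2 * (real n * t)) *\<^sub>R Q t)"

text \<open>In the formula for \<open>Y'(\<pi>)\<close>, replacing \<open>Y t\<close> by \<open>cos (n t) A\<close> costs \<open>O(1/n)\<close>. What remains is the
integral of \<open>cos\<^sup>2 (n t) (Q t - \<mu>) A\<close>, which \<open>cos\<^sup>2 (n t) = (1 + cos (2 n t)) / 2\<close> splits into a mean value
and a Fourier coefficient.\<close>

lemma boundary_value_asymptotics:
  fixes Q :: "real \<Rightarrow> complex^'m^'m"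
  assumes Q: "L2_potential Q" and R: "R \<ge> 0"
  obtains C where "\<And>n mu. n \<ge> 1 \<Longrightarrow> norm mu \<le> R \<Longrightarrow>
    norm ((- 1) ^ n *\<^sub>R boundary_value Q H A B ((of_nat n)\<^sup>2 + mu) -
      (B + H ** A + ((1/2) *\<^sub>R integral {0..pi} Q + (1/2) *\<^sub>R cos_coefficient Q n - mat (of_real (pi / 2) * mu)) ** A))
    \<le> C / n"
proof -
  obtain L a where La: "exp_dominated L a" "\<And>t. 1 \<le> a t"
    "\<And>t mu. norm mu \<le> R \<Longrightarrow> norm (Q t - mat mu) \<le> a t"
    using coefficient_weight[OF Q R] by blast
  have a: "a absolutely_integrable_on {0..pi}" using La(1) by (simp add: exp_dominated_def)
  define M where "M = 2 * (norm A + norm B) * exp (L * pi)"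
  define C1 where "C1 = norm B + integral {0..pi} a * M"
  define C where "C = integral {0..pi} a * C1 + norm H * C1"
  show ?thesis
  proof (rule that[of C])
    fix n :: nat and mu :: complex
    assume n: "n \<ge> 1" and mu: "norm mu \<le> R"
    define lam where "lam = (of_nat n)\<^sup>2 + mu"
    define Y where "Y = fundamental_solution Q A B lam"
    have sol: "solution Q ((of_nat n)\<^sup>2 + mu) Y" and Y0: "Y 0 = A" "D Y 0 = B"
      using fundamental_solution[OF Q, where lam = lam and A = A and B = B] by (simp_all add: Y_def lam_def)
    note cY = solution_abs_cont(3)[OF sol]
    define P where "P t = Q t - mat mu" for t
    have P: "P absolutely_integrable_on {0..pi}"
      unfolding P_def by (rule coefficient_absolutely_integrable[OF Q])
    have close: "norm (Y x - cos (real n * x) *\<^sub>R A) \<le> C1 / n" if "x \<in> {0..pi}" for x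
      using solution_oscillation_bound(2)[OF Q sol n La(1) La(3)[OF mu] that]
      by (simp add: Y0 C1_def M_def)
    have cc: "continuous_on {0..pi} (\<lambda>t. cos (real n * t))" by (intro continuous_intros)
    have cA: "continuous_on {0..pi} (\<lambda>t. cos (real n * t) *\<^sub>R A)" by (intro continuous_intros)
    define E1 where "E1 = integral {0..pi} (\<lambda>t. cos (real n * t) *\<^sub>R (P t ** (Y t - cos (real n * t) *\<^sub>R A)))"
    define I where "I = (1/2) *\<^sub>R integral {0..pi} Q + (1/2) *\<^sub>R cos_coefficient Q n - mat (of_real (pi / 2) * mu)"
    have Qi: "Q absolutely_integrable_on {0..pi}" by (rule L2_potential_absolutely_integrable[OF Q])
    have main: "integral {0..pi} (\<lambda>t. cos (real n * t) *\<^sub>R (P t ** (cos (real n * t) *\<^sub>R A))) = I ** A"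
    proof -
      have 1: "(Q has_integral integral {0..pi} Q) {0..pi}"
        using Qi by (simp add: absolutely_integrable_on_def integrable_integral)
      have c2: "continuous_on {0..pi} (\<lambda>t. cos (2 * (real n * t)))" by (intro continuous_intros)
      have "(\<lambda>t. cos (2 * (real n * t)) *\<^sub>R (Q t ** mat 1)) integrable_on {0..pi}"
        by (rule scaled_product_integrable[OF Qi continuous_on_const c2])
      then have 2: "((\<lambda>t. cos (2 * (real n * t)) *\<^sub>R Q t) has_integral cos_coefficient Q n) {0..pi}"
        unfolding cos_coefficient_def by (simp add: integrable_integral)
      have 3: "((\<lambda>t. (cos (real n * t))\<^sup>2 *\<^sub>R (mat mu :: complex^'m^'m)) has_integral (pi / 2) *\<^sub>R mat mu) {0..pi}"
        by (rule has_integral_scaleR_left[OF has_integral_cos_square[OF n]])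
      have "((\<lambda>t. (1/2) *\<^sub>R Q t + (1/2) *\<^sub>R (cos (2 * (real n * t)) *\<^sub>R Q t) - (cos (real n * t))\<^sup>2 *\<^sub>R mat mu)
          has_integral ((1/2) *\<^sub>R integral {0..pi} Q + (1/2) *\<^sub>R cos_coefficient Q n - (pi / 2) *\<^sub>R mat mu)) {0..pi}"
        by (intro has_integral_diff has_integral_add has_integral_cmul 1 2 3)
      also have "(pi / 2) *\<^sub>R mat mu = (mat (of_real (pi / 2) * mu) :: complex^'m^'m)"
        by (simp add: vec_eq_iff mat_def scaleR_conv_of_real[where 'a = complex])
      also have "(\<lambda>t. (1/2) *\<^sub>R Q t + (1/2) *\<^sub>R (cos (2 * (real n * t)) *\<^sub>R Q t) - (cos (real n * t))\<^sup>2 *\<^sub>R mat mu)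
          = (\<lambda>t. (cos (real n * t))\<^sup>2 *\<^sub>R P t)"
        by (simp add: P_def cos_double_cos scaleR_diff_right scaleR_left_diff_distrib)
      finally have "((\<lambda>t. (cos (real n * t))\<^sup>2 *\<^sub>R P t ** A) has_integral I ** A) {0..pi}"
        unfolding I_def[symmetric]
        by (rule has_integral_linear[OF _ matrix_mult.bounded_linear_left[of A], unfolded o_def])
      then show ?thesis
        by (simp add: matrix_mult.scaleR_left matrix_mult.scaleR_right power2_eq_square integral_unique)
    qed
    have "(- 1) ^ n *\<^sub>R D Y pi = B + integral {0..pi} (\<lambda>t. cos (real n * t) *\<^sub>R (P t ** Y t))"
      unfolding P_def using solution_oscillation_formula(2)[OF sol n] by (simp add: Y0)
    also have "integral {0..pi} (\<lambda>t. cos (real n * t) *\<^sub>R (P t ** Y t)) = I ** A + E1"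
    proof -
      have "I ** A + E1 = integral {0..pi} (\<lambda>t. cos (real n * t) *\<^sub>R (P t ** (cos (real n * t) *\<^sub>R A))
          + cos (real n * t) *\<^sub>R (P t ** (Y t - cos (real n * t) *\<^sub>R A)))"
        unfolding E1_def main[symmetric]
        by (intro Henstock_Kurzweil_Integration.integral_add[symmetric] scaled_product_integrable P cc cA continuous_on_diff cY)
      then show ?thesis by (simp add: matrix_mult.diff_right scaleR_diff_right)
    qed
    finally have DY: "(- 1) ^ n *\<^sub>R D Y pi = B + (I ** A + E1)" .
    define E2 where "E2 = H ** ((- 1) ^ n *\<^sub>R (Y pi - cos (real n * pi) *\<^sub>R A))"
    have "(- 1) ^ n *\<^sub>R (Y pi - cos (real n * pi) *\<^sub>R A) = (- 1) ^ n *\<^sub>R Y pi - A"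
      by (simp add: cos_npi scaleR_diff_right power_mult_distrib[symmetric])
    then have HY: "(- 1) ^ n *\<^sub>R (H ** Y pi) = H ** A + E2"
      by (simp add: E2_def matrix_mult.diff_right matrix_mult.scaleR_right)
    have "(- 1) ^ n *\<^sub>R boundary_value Q H A B lam - (B + H ** A + I ** A) = E1 + E2"
      unfolding boundary_value_def V_def Y_def[symmetric] scaleR_add_right DY HY by (simp add: algebra_simps)
    also have "norm \<dots> \<le> C / n"
    proof (rule order_trans[OF norm_triangle_ineq])
      have "norm E1 \<le> integral {0..pi} (\<lambda>t. a t * (1 * (C1 / n)))"
        unfolding E1_def
      proof (rule norm_oscillating_integral_le[where y = "\<lambda>_. C1 / n", OF P _ a _ cc _ continuous_on_const])
        show "continuous_on {0..pi} (\<lambda>t. Y t - cos (real n * t) *\<^sub>R A)" by (rule continuous_on_diff[OF cY cA])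
        show "norm (Y t - cos (real n * t) *\<^sub>R A) \<le> C1 / n" if "t \<in> {0..pi}" for t by (rule close[OF that])
        show "norm (P t) \<le> a t" for t unfolding P_def by (rule La(3)[OF mu])
      qed auto
      then have "norm E1 \<le> integral {0..pi} a * (C1 / n)" by simp
      moreover have "norm E2 \<le> norm H * (C1 / n)"
        unfolding E2_def using close[of pi]
        by (intro order_trans[OF norm_matrix_mult_le mult_left_mono]) auto
      ultimately show "norm E1 + norm E2 \<le> C / n"
        by (simp add: C_def add_divide_distrib)
    qed
    finally show "norm ((- 1) ^ n *\<^sub>R boundary_value Q H A B ((of_nat n)\<^sup>2 + mu) -
      (B + H ** A + ((1/2) *\<^sub>R integral {0..pi} Q + (1/2) *\<^sub>R cos_coefficient Q n - mat (of_real (pi / 2) * mu)) ** A)) \<le> C / n"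
      by (simp only: I_def lam_def)
  qed
qed

section \<open>Square summable sequences and Bessel's inequality\<close>

lemma integral_cos_cos:
  assumes "m \<noteq> n" "m \<ge> 1" "n \<ge> 1"
  shows "((\<lambda>t. cos (2 * (real m * t)) * cos (2 * (real n * t))) has_integral 0) {0..pi}"
proof -
  have "((\<lambda>t. 1 / 2 * cos (2 * (of_int (int m + int n) * t)) + 1 / 2 * cos (2 * (of_int (int m - int n) * t)))
      has_integral (1 / 2 * 0 + 1 / 2 * 0)) {0..pi}"
    using assms by (intro has_integral_add has_integral_mult_right has_integral_cos_even) auto
  moreover have "1 / 2 * cos (2 * (of_int (int m + int n) * t)) + 1 / 2 * cos (2 * (of_int (int m - int n) * t))
      = cos (2 * (real m * t)) * cos (2 * (real n * t))" for t
    by (simp add: cos_times_cos algebra_simps)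
  ultimately show ?thesis by simp
qed

text \<open>Bessel's inequality, obtained by expanding the integral of the square of
\<open>f - (2 / \<pi>) (\<Sum>n. c\<^sub>n cos (2 n t))\<close>.\<close>

lemma bessel_cos:
  fixes f :: "real \<Rightarrow> real"
  assumes f: "f absolutely_integrable_on {0..pi}" and f2: "(\<lambda>t. (f t)\<^sup>2) integrable_on {0..pi}"
  shows "summable (\<lambda>n. (integral {0..pi} (\<lambda>t. cos (2 * (real n * t)) * f t))\<^sup>2)"
proof -
  define c where "c n = integral {0..pi} (\<lambda>t. cos (2 * (real n * t)) * f t)" for n :: nat
  have fc: "((\<lambda>t. f t * cos (2 * (real n * t))) has_integral c n) {0..pi}" for n
  proof -
    have "(\<lambda>t. f t * cos (2 * (real n * t))) absolutely_integrable_on {0..pi}"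
      by (intro continuous_times_absolutely_integrable[OF f] continuous_intros)
    then show ?thesis
      unfolding c_def by (simp add: absolutely_integrable_on_def integrable_integral mult.commute)
  qed
  define I where "I = integral {0..pi} (\<lambda>t. (f t)\<^sup>2)"
  have fin: "(\<Sum>n\<in>{1..N}. (c n)\<^sup>2) \<le> pi / 2 * I" for N
  proof -
    define g where "g t = (\<Sum>n\<in>{1..N}. c n * cos (2 * (real n * t)))" for t
    have fg: "((\<lambda>t. f t * g t) has_integral (\<Sum>n\<in>{1..N}. c n * c n)) {0..pi}"
    proof -
      have "((\<lambda>t. \<Sum>n\<in>{1..N}. c n * (f t * cos (2 * (real n * t)))) has_integral (\<Sum>n\<in>{1..N}. c n * c n)) {0..pi}"
        by (intro has_integral_sum has_integral_mult_right fc) auto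
      then show ?thesis by (simp add: g_def sum_distrib_left ac_simps)
    qed
    have gg: "((\<lambda>t. g t * g t) has_integral (\<Sum>n\<in>{1..N}. c n * c n * (pi / 2))) {0..pi}"
    proof -
      have "((\<lambda>t. c m * c n * (cos (2 * (real m * t)) * cos (2 * (real n * t)))) has_integral
          (if n = m then c m * c m * (pi / 2) else 0)) {0..pi}" if "m \<in> {1..N}" "n \<in> {1..N}" for m n
      proof (cases "n = m")
        case True
        have "((\<lambda>t. c m * c m * (cos (real (2 * m) * t))\<^sup>2) has_integral c m * c m * (pi / 2)) {0..pi}"
          using that by (intro has_integral_mult_right has_integral_cos_square) auto
        then show ?thesis using True by (simp add: power2_eq_square mult.assoc)
      next
        case False
        then show ?thesis using has_integral_mult_right[OF integral_cos_cos[of m n], of "c m * c n"] that by auto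
      qed
      then have "((\<lambda>t. \<Sum>m\<in>{1..N}. \<Sum>n\<in>{1..N}. c m * c n * (cos (2 * (real m * t)) * cos (2 * (real n * t)))) has_integral
          (\<Sum>m\<in>{1..N}. \<Sum>n\<in>{1..N}. if n = m then c m * c m * (pi / 2) else 0)) {0..pi}"
        by (intro has_integral_sum) auto
      moreover have "(\<Sum>m\<in>{1..N}. \<Sum>n\<in>{1..N}. if n = m then c m * c m * (pi / 2) else 0) = (\<Sum>n\<in>{1..N}. c n * c n * (pi / 2))"
        by (intro sum.cong refl) (subst sum.delta, auto)
      ultimately show ?thesis by (simp add: g_def sum_product ac_simps)
    qed
    have sq: "((\<lambda>t. (f t)\<^sup>2 - (4 / pi) * (f t * g t) + (4 / pi\<^sup>2) * (g t * g t)) has_integral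
        I - (4 / pi) * (\<Sum>n\<in>{1..N}. c n * c n) + (4 / pi\<^sup>2) * (\<Sum>n\<in>{1..N}. c n * c n * (pi / 2))) {0..pi}"
      unfolding I_def by (intro has_integral_add has_integral_diff has_integral_mult_right fg gg integrable_integral f2)
    have "(f t)\<^sup>2 - (4 / pi) * (f t * g t) + (4 / pi\<^sup>2) * (g t * g t) = (f t - 2 / pi * g t)\<^sup>2" for t
      by (simp add: power2_eq_square field_simps)
    then have "0 \<le> I - (4 / pi) * (\<Sum>n\<in>{1..N}. c n * c n) + (4 / pi\<^sup>2) * (\<Sum>n\<in>{1..N}. c n * c n * (pi / 2))"
      by (intro has_integral_nonneg[OF sq]) simp
    also have "\<dots> = I - (2 / pi) * (\<Sum>n\<in>{1..N}. (c n)\<^sup>2)"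
    proof -
      have "(\<Sum>n\<in>{1..N}. c n * c n * (pi / 2)) = (\<Sum>n\<in>{1..N}. c n * c n) * (pi / 2)"
        by (rule sum_distrib_right[symmetric])
      then show ?thesis by (simp add: power2_eq_square field_simps)
    qed
    finally show ?thesis by (simp add: field_simps)
  qed
  have "summable (\<lambda>n. (c (Suc n))\<^sup>2)"
  proof (rule bounded_imp_summable)
    show "(\<Sum>k\<le>n. (c (Suc k))\<^sup>2) \<le> pi / 2 * I" for n
    proof -
      have "(\<Sum>k\<le>n. (c (Suc k))\<^sup>2) = (\<Sum>k\<in>{1..Suc n}. (c k)\<^sup>2)"
        by (rule sum.reindex_bij_witness[of _ "\<lambda>k. k - 1" Suc]) auto
      then show ?thesis using fin[of "Suc n"] by simp
    qed
  qed auto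
  then show ?thesis unfolding c_def[symmetric] by (rule summable_Suc_iff[THEN iffD1])
qed

lemma summable_square_add:
  fixes f g :: "nat \<Rightarrow> real"
  assumes "summable (\<lambda>n. (f n)\<^sup>2)" "summable (\<lambda>n. (g n)\<^sup>2)"
  shows "summable (\<lambda>n. (f n + g n)\<^sup>2)"
proof (rule summable_comparison_test')
  show "summable (\<lambda>n. 2 * (f n)\<^sup>2 + 2 * (g n)\<^sup>2)"
    by (intro summable_add summable_mult assms)
  have "(f n + g n)\<^sup>2 \<le> 2 * (f n)\<^sup>2 + 2 * (g n)\<^sup>2" for n
    using zero_le_power2[of "f n - g n"] by (simp add: power2_eq_square algebra_simps)
  then show "norm ((f n + g n)\<^sup>2) \<le> 2 * (f n)\<^sup>2 + 2 * (g n)\<^sup>2" for n by simp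
qed

lemma summable_square_mult:
  fixes f :: "nat \<Rightarrow> real"
  assumes "summable (\<lambda>n. (f n)\<^sup>2)"
  shows "summable (\<lambda>n. (c * f n)\<^sup>2)"
  unfolding power_mult_distrib by (intro summable_mult assms)

lemma summable_square_inverse: "summable (\<lambda>n. (C / real n)\<^sup>2)"
proof -
  have "summable (\<lambda>n. C\<^sup>2 * inverse ((real n)\<^sup>2))"
    by (intro summable_mult inverse_power_summable) auto
  then show ?thesis by (simp add: divide_inverse power_mult_distrib power_inverse)
qed

lemma summable_square_sum:
  fixes f :: "'a \<Rightarrow> nat \<Rightarrow> real"
  assumes "finite A" "\<And>i. i \<in> A \<Longrightarrow> summable (\<lambda>n. (f i n)\<^sup>2)"
  shows "summable (\<lambda>n. (\<Sum>i\<in>A. f i n)\<^sup>2)"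
  using assms by (induction A rule: finite_induct) (auto intro: summable_square_add)

lemma summable_square_tendsto_0:
  fixes f :: "nat \<Rightarrow> real"
  assumes "summable (\<lambda>n. (f n)\<^sup>2)"
  shows "f \<longlonglongrightarrow> 0"
proof -
  have "(\<lambda>n. sqrt ((f n)\<^sup>2)) \<longlonglongrightarrow> sqrt 0"
    by (intro tendsto_intros summable_LIMSEQ_zero[OF assms])
  then show ?thesis by (simp add: tendsto_rabs_zero_iff)
qed

lemma l2_matrixI:
  fixes K :: "nat \<Rightarrow> complex^'m^'m"
  assumes e: "summable (\<lambda>n. (e n)\<^sup>2)" and le: "\<And>n. n \<ge> N \<Longrightarrow> norm (K n) \<le> e n"
  shows "l2_matrix K"
  unfolding l2_matrix_def
proof (rule summable_comparison_test'[where N = N])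
  show "summable (\<lambda>n. (real CARD('m) * e n)\<^sup>2)" by (rule summable_square_mult[OF e])
  show "norm ((mnorm (K n))\<^sup>2) \<le> (real CARD('m) * e n)\<^sup>2" if "n \<ge> N" for n
  proof -
    have "mnorm (K n) \<le> real CARD('m) * e n"
      by (rule order_trans[OF mnorm_le_norm mult_left_mono[OF le[OF that] of_nat_0_le_iff]])
    then show ?thesis using mnorm_nonneg[of "K n"] by (simp add: power_mono)
  qed
qed

lemma cos_coefficient_square_summable:
  fixes Q :: "real \<Rightarrow> complex^'m^'m"
  assumes Q: "L2_potential Q"
  shows "summable (\<lambda>n. (norm (cos_coefficient Q n))\<^sup>2)"
proof -
  have *: "summable (\<lambda>n. (\<phi> (cos_coefficient Q n))\<^sup>2)"
    if \<phi>: "bounded_linear \<phi>" "\<And>A. \<bar>\<phi> A\<bar> \<le> norm A" for \<phi> :: "complex^'m^'m \<Rightarrow> real"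
  proof -
    have ai: "(\<lambda>t. \<phi> (Q t)) absolutely_integrable_on {0..pi}"
      using absolutely_integrable_linear[OF L2_potential_absolutely_integrable[OF Q] \<phi>(1)] by (simp add: o_def)
    have "(\<lambda>t. (\<phi> (Q t))\<^sup>2) absolutely_integrable_on {0..pi}"
    proof (rule measurable_bounded_by_integrable_imp_absolutely_integrable)
      have "(\<lambda>t. \<phi> (Q t)) \<in> borel_measurable (lebesgue_on {0..pi})"
        using ai absolutely_integrable_measurable[of "{0..pi}" "\<lambda>t. \<phi> (Q t)"] by auto
      then show "(\<lambda>t. (\<phi> (Q t))\<^sup>2) \<in> borel_measurable (lebesgue_on {0..pi})" by (intro borel_measurable_power)
      show "(\<lambda>t. (norm (Q t))\<^sup>2) integrable_on {0..pi}" by (rule L2_potential_square_integrable[OF Q])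
      show "norm ((\<phi> (Q t))\<^sup>2) \<le> (norm (Q t))\<^sup>2" for t
        using power_mono[OF \<phi>(2)[of "Q t"] abs_ge_zero, of 2] by simp
    qed auto
    then have i2: "(\<lambda>t. (\<phi> (Q t))\<^sup>2) integrable_on {0..pi}" by (simp add: absolutely_integrable_on_def)
    have "\<phi> (cos_coefficient Q n) = integral {0..pi} (\<lambda>t. cos (2 * (real n * t)) * \<phi> (Q t))" for n
    proof -
      have c2: "continuous_on {0..pi} (\<lambda>t. cos (2 * (real n * t)))" by (intro continuous_intros)
      have "(\<lambda>t. cos (2 * (real n * t)) *\<^sub>R (Q t ** mat 1)) integrable_on {0..pi}"
        by (rule scaled_product_integrable[OF L2_potential_absolutely_integrable[OF Q] continuous_on_const c2])
      then have "(\<lambda>t. cos (2 * (real n * t)) *\<^sub>R Q t) integrable_on {0..pi}" by simp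
      from integral_linear[OF this \<phi>(1)] show ?thesis
        unfolding cos_coefficient_def by (simp add: o_def linear_simps(5)[OF \<phi>(1)])
    qed
    then show ?thesis using bessel_cos[OF ai i2] by simp
  qed
  have entry: "summable (\<lambda>n. (norm (cos_coefficient Q n $ j $ k))\<^sup>2)" for j k
  proof -
    have l: "bounded_linear (\<lambda>A :: complex^'m^'m. A $ j $ k)"
      by (intro bounded_linear_compose[OF bounded_linear_vec_nth bounded_linear_vec_nth])
    have "summable (\<lambda>n. (Re (cos_coefficient Q n $ j $ k))\<^sup>2)" "summable (\<lambda>n. (Im (cos_coefficient Q n $ j $ k))\<^sup>2)"
      using bounded_linear_compose[OF bounded_linear_Re l] bounded_linear_compose[OF bounded_linear_Im l]
      by (auto intro!: * order_trans[OF abs_Re_le_cmod norm_entry_le] order_trans[OF abs_Im_le_cmod norm_entry_le])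
    then show ?thesis unfolding cmod_power2 by (rule summable_add)
  qed
  show ?thesis unfolding norm_matrix_power2 by (intro summable_sum entry)
qed

section \<open>Asymptotics of the boundary matrices and of the eigenvalues\<close>

lemma boundary_value_l2_asymptotics:
  fixes Q :: "real \<Rightarrow> complex^'m^'m"
  assumes A: "in_A Q h H (diag_mat w)" and R: "R \<ge> 0"
  shows "\<exists>e. summable (\<lambda>n. (e n)\<^sup>2) \<and> (\<forall>n\<ge>1. \<forall>mu. norm mu \<le> R \<longrightarrow>
       norm ((- 1) ^ n *\<^sub>R boundary_value Q H (mat 1) h ((of_nat n)\<^sup>2 + mu) - (diag_mat w - mat (of_real (pi / 2) * mu))) \<le> e n \<and>
       norm ((- 1) ^ n *\<^sub>R boundary_value Q H 0 (mat 1) ((of_nat n)\<^sup>2 + mu) - mat 1) \<le> e n)"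
proof -
  have Q: "L2_potential Q" and \<omega>: "h + H + (1/2) *\<^sub>R integral {0..pi} Q = diag_mat w"
    using A by (auto simp: in_A_def)
  obtain C1 where C1: "\<And>n mu. n \<ge> 1 \<Longrightarrow> norm mu \<le> R \<Longrightarrow>
    norm ((- 1) ^ n *\<^sub>R boundary_value Q H (mat 1) h ((of_nat n)\<^sup>2 + mu) -
      (h + H ** mat 1 + ((1/2) *\<^sub>R integral {0..pi} Q + (1/2) *\<^sub>R cos_coefficient Q n - mat (of_real (pi / 2) * mu)) ** mat 1))
    \<le> C1 / n"
    using boundary_value_asymptotics[OF Q R, of H "mat 1" h] by blast
  obtain C2 where C2: "\<And>n mu. n \<ge> 1 \<Longrightarrow> norm mu \<le> R \<Longrightarrow>
    norm ((- 1) ^ n *\<^sub>R boundary_value Q H 0 (mat 1) ((of_nat n)\<^sup>2 + mu) -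
      (mat 1 + H ** 0 + ((1/2) *\<^sub>R integral {0..pi} Q + (1/2) *\<^sub>R cos_coefficient Q n - mat (of_real (pi / 2) * mu)) ** 0))
    \<le> C2 / n"
    using boundary_value_asymptotics[OF Q R, of H 0 "mat 1"] by blast
  define e where "e n = (\<bar>C1\<bar> + \<bar>C2\<bar>) / real n + 1 / 2 * norm (cos_coefficient Q n)" for n
  show ?thesis
  proof (intro exI[of _ e] conjI allI impI)
    show "summable (\<lambda>n. (e n)\<^sup>2)"
      unfolding e_def
      by (intro summable_square_add summable_square_inverse summable_square_mult cos_coefficient_square_summable Q)
    fix n :: nat and mu :: complex assume n: "n \<ge> 1" and mu: "norm mu \<le> R"
    define X where "X = (- 1) ^ n *\<^sub>R boundary_value Q H (mat 1) h ((of_nat n)\<^sup>2 + mu)"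
    have le: "C1 / real n \<le> (\<bar>C1\<bar> + \<bar>C2\<bar>) / real n" "C2 / real n \<le> (\<bar>C1\<bar> + \<bar>C2\<bar>) / real n"
      by (auto intro!: divide_right_mono)
    have "X - (diag_mat w - mat (of_real (pi / 2) * mu))
        = (X - (h + H ** mat 1 + ((1/2) *\<^sub>R integral {0..pi} Q + (1/2) *\<^sub>R cos_coefficient Q n - mat (of_real (pi / 2) * mu)) ** mat 1))
          + (1/2) *\<^sub>R cos_coefficient Q n"
      unfolding \<omega>[symmetric] by simp
    also have "norm \<dots> \<le> C1 / n + 1 / 2 * norm (cos_coefficient Q n)"
      unfolding X_def by (rule order_trans[OF norm_triangle_ineq add_mono[OF C1[OF n mu]]]) simp
    finally show "norm ((- 1) ^ n *\<^sub>R boundary_value Q H (mat 1) h ((of_nat n)\<^sup>2 + mu) - (diag_mat w - mat (of_real (pi / 2) * mu))) \<le> e n"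
      using le(1) unfolding X_def e_def by linarith
    have "norm ((- 1) ^ n *\<^sub>R boundary_value Q H 0 (mat 1) ((of_nat n)\<^sup>2 + mu) - mat 1) \<le> C2 / n"
      using C2[OF n mu] by simp
    also have "\<dots> \<le> e n" using le(2) by (simp add: e_def add_increasing2)
    finally show "norm ((- 1) ^ n *\<^sub>R boundary_value Q H 0 (mat 1) ((of_nat n)\<^sup>2 + mu) - mat 1) \<le> e n" .
  qed
qed

text \<open>Squaring \<open>n + (\<omega>\<^sub>q / \<pi> + \<kappa>\<^sub>n) / n\<close>.\<close>

lemma eigenvalue_l2_asymptotics:
  assumes "eigenvalue_indexing Q h H w lam"
  obtains \<epsilon> where "summable (\<lambda>n. (\<epsilon> n)\<^sup>2)"
    "\<And>n q. n \<ge> 1 \<Longrightarrow> norm (lam n q - ((of_nat n)\<^sup>2 + 2 * w q / of_real pi)) \<le> \<epsilon> n"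
proof -
  have "\<exists>\<kappa>. \<forall>q. l2_scalar (\<kappa> q) \<and> (\<forall>n\<ge>1. csqrt (lam n q) =
        of_nat n + w q / (of_real pi * of_nat n) + \<kappa> q n / of_nat n)"
    using assms unfolding eigenvalue_indexing_def by (intro choice) blast
  then obtain \<kappa> where \<kappa>: "\<And>q. summable (\<lambda>n. (norm (\<kappa> q n))\<^sup>2)"
    "\<And>q n. n \<ge> 1 \<Longrightarrow> csqrt (lam n q) = of_nat n + w q / (of_real pi * of_nat n) + \<kappa> q n / of_nat n"
    unfolding l2_scalar_def by blast
  have "\<exists>B. \<forall>n. norm (w q / of_real pi + \<kappa> q n) \<le> B" for q
  proof -
    have "(\<lambda>n. w q / of_real pi + \<kappa> q n) \<longlonglongrightarrow> w q / of_real pi + 0"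
      using summable_square_tendsto_0[OF \<kappa>(1)[of q]] by (intro tendsto_intros) (rule tendsto_norm_zero_cancel)
    then have "Bseq (\<lambda>n. w q / of_real pi + \<kappa> q n)" by (rule convergentI[THEN convergent_imp_Bseq])
    then show ?thesis unfolding Bseq_def by blast
  qed
  then obtain B where B: "\<And>q n. norm (w q / of_real pi + \<kappa> q n) \<le> B q" by metis
  (* The two summands bound 2 kappa and the square of (w / pi + kappa) / n. *)
  define \<epsilon>' where "\<epsilon>' q n = 2 * norm (\<kappa> q n) + (B q)\<^sup>2 / real n" for q n
  have bd: "norm (lam n q - ((of_nat n)\<^sup>2 + 2 * w q / of_real pi)) \<le> \<epsilon>' q n" if n: "n \<ge> 1" for n q
  proof -
    define z where "z = w q / of_real pi + \<kappa> q n"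
    have n0: "(of_nat n :: complex) \<noteq> 0" using n by simp
    have "csqrt (lam n q) = of_nat n + z / of_nat n"
      using \<kappa>(2)[OF n, of q] by (simp add: z_def add_divide_distrib)
    then have "lam n q = (of_nat n + z / of_nat n)\<^sup>2" by (metis power2_csqrt)
    also have "\<dots> = (of_nat n)\<^sup>2 + 2 * z + z\<^sup>2 / (of_nat n)\<^sup>2"
      using n0 by (simp add: power2_eq_square field_simps)
    finally have "lam n q - ((of_nat n)\<^sup>2 + 2 * w q / of_real pi) = 2 * \<kappa> q n + z\<^sup>2 / (of_nat n)\<^sup>2"
      by (simp add: z_def distrib_left)
    also have "norm \<dots> \<le> 2 * norm (\<kappa> q n) + (norm z)\<^sup>2 / (real n)\<^sup>2"
      by (rule order_trans[OF norm_triangle_ineq]) (simp add: norm_mult norm_divide norm_power)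
    also have "(norm z)\<^sup>2 / (real n)\<^sup>2 \<le> (B q)\<^sup>2 / real n"
    proof (rule frac_le)
      show "(norm z)\<^sup>2 \<le> (B q)\<^sup>2" using B[of q n] by (intro power_mono) (auto simp: z_def)
      show "real n \<le> (real n)\<^sup>2" using n by (simp add: power2_eq_square)
    qed (use n in auto)
    finally show ?thesis by (simp add: \<epsilon>'_def)
  qed
  have nn: "\<epsilon>' q n \<ge> 0" for q n by (simp add: \<epsilon>'_def)
  show ?thesis
  proof (rule that[of "\<lambda>n. \<Sum>q\<in>UNIV. \<epsilon>' q n"])
    show "summable (\<lambda>n. (\<Sum>q\<in>UNIV. \<epsilon>' q n)\<^sup>2)"
      unfolding \<epsilon>'_def
      by (intro summable_square_sum summable_square_add summable_square_mult summable_square_inverse \<kappa>(1)) auto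
    fix n q assume n: "n \<ge> (1::nat)"
    show "norm (lam n q - ((of_nat n)\<^sup>2 + 2 * w q / of_real pi)) \<le> (\<Sum>q\<in>UNIV. \<epsilon>' q n)"
      using bd[OF n, of q] member_le_sum[of q UNIV "\<lambda>q. \<epsilon>' q n"] nn by fastforce
  qed
qed

text \<open>Squares of different integers \<open>n\<close>, \<open>n'\<close> differ by at least \<open>n\<close>, whereas the distances of all
eigenvalues \<open>\<lambda>\<^sub>n\<^sub>q\<close> from \<open>n\<^sup>2\<close> are bounded; so for large \<open>n\<close> an eigenvalue near \<open>n\<^sup>2\<close> has first index \<open>n\<close>, and
its second index is determined up to its group by the separation of the \<open>\<omega>\<^sub>q\<close>.\<close>

lemma eigenvalue_localization:
  fixes w :: "'m::finite \<Rightarrow> complex"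
  assumes \<epsilon>: "\<epsilon> \<longlonglongrightarrow> (0::real)" "\<And>n q. n \<ge> 1 \<Longrightarrow> norm (lam n q - ((of_nat n)\<^sup>2 + 2 * w q / of_real pi)) \<le> \<epsilon> n"
    and \<delta>: "\<delta> > 0" "\<And>q q'. w q \<noteq> w q' \<Longrightarrow> 3 * \<delta> \<le> norm (2 * w q / of_real pi - 2 * w q' / of_real pi)"
  obtains N where "N \<ge> 1"
    "\<And>n q. n \<ge> N \<Longrightarrow> norm (lam n q - ((of_nat n)\<^sup>2 + 2 * w q / of_real pi)) < \<delta>"
    "\<And>n q n' q'. n \<ge> N \<Longrightarrow> norm (lam n' q' - ((of_nat n)\<^sup>2 + 2 * w q / of_real pi)) < 2 * \<delta> \<Longrightarrow> n' = n \<and> w q' = w q"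
proof -
  define err where "err n q = norm (lam n q - ((of_nat n)\<^sup>2 + 2 * w q / of_real pi))" for n q
  obtain N1 where N1: "\<And>n. n \<ge> N1 \<Longrightarrow> \<epsilon> n < \<delta>"
    using order_tendstoD(2)[OF \<epsilon>(1) \<delta>(1)] unfolding eventually_sequentially by blast
  have err1: "err n q < \<delta>" if "n \<ge> max 1 N1" for n q
    using \<epsilon>(2)[of n q] N1[of n] that by (simp add: err_def)
  have "finite (range (\<lambda>(n, q). err (min n (max 1 N1)) q))"
  proof (rule finite_subset)
    show "range (\<lambda>(n, q). err (min n (max 1 N1)) q) \<subseteq> (\<lambda>(n, q). err n q) ` ({..max 1 N1} \<times> UNIV)" by force
  qed auto
  then obtain B0 where B0: "\<And>n q. err (min n (max 1 N1)) q \<le> B0"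
    by (metis (no_types, lifting) bdd_above.unfold bdd_above_finite case_prod_conv rangeI)
  define B where "B = max B0 \<delta>"
  have B: "err n q \<le> B" for n q
  proof (cases "n \<ge> max 1 N1")
    case True
    then show ?thesis using err1[of n q] by (simp add: B_def)
  next
    case False
    then have "min n (max 1 N1) = n" using min.absorb1[of n "max 1 N1"] by linarith
    then show ?thesis using B0[of n q] by (simp add: B_def)
  qed
  define Wm where "Wm = Max (range (\<lambda>q. norm (2 * w q / of_real pi)))"
  have Wm: "norm (2 * w q / of_real pi) \<le> Wm" for q unfolding Wm_def by (intro Max_ge) auto
  obtain N2 where N2: "real N2 > 2 * \<delta> + B + 2 * Wm" using reals_Archimedean2 by blast
  show ?thesis
  proof (rule that[of "max (max 1 N1) N2"])
    fix n q assume n: "n \<ge> max (max 1 N1) N2"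
    show "norm (lam n q - ((of_nat n)\<^sup>2 + 2 * w q / of_real pi)) < \<delta>" using err1[of n q] n by (simp add: err_def)
    fix n' q' assume close: "norm (lam n' q' - ((of_nat n)\<^sup>2 + 2 * w q / of_real pi)) < 2 * \<delta>"
    have tri: "norm (x - y - u + v) \<le> norm x + norm y + norm u + norm v" for x y u v :: complex
      using norm_triangle_ineq[of "x - y - u" v] norm_triangle_ineq4[of "x - y" u] norm_triangle_ineq4[of x y] by linarith
    have "n' = n"
    proof (rule ccontr)
      assume ne: "n' \<noteq> n"
      have "(of_nat n' :: complex)\<^sup>2 - (of_nat n)\<^sup>2 = (lam n' q' - ((of_nat n)\<^sup>2 + 2 * w q / of_real pi))
          - (lam n' q' - ((of_nat n')\<^sup>2 + 2 * w q' / of_real pi)) - 2 * w q' / of_real pi + 2 * w q / of_real pi"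
        by simp
      also have "norm \<dots> \<le> 2 * \<delta> + err n' q' + norm (2 * w q' / of_real pi) + norm (2 * w q / of_real pi)"
        unfolding err_def by (rule order_trans[OF tri]) (use close in simp)
      also have "\<dots> \<le> 2 * \<delta> + B + Wm + Wm" by (intro add_mono Wm B order_refl)
      also have "\<dots> < real N2" using N2 by simp
      also have "\<dots> \<le> real n" using n by simp
      finally have "norm ((of_nat n' :: complex)\<^sup>2 - (of_nat n)\<^sup>2) < real n" .
      moreover have "norm ((of_nat n' :: complex)\<^sup>2 - (of_nat n)\<^sup>2) = real (n' + n) * \<bar>real n' - real n\<bar>"
      proof -
        have "(of_nat n' :: complex)\<^sup>2 - (of_nat n)\<^sup>2 = of_real ((real n' + real n) * (real n' - real n))"
          by (simp add: power2_eq_square algebra_simps)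
        then show ?thesis by (simp only: norm_of_real) (simp add: abs_mult)
      qed
      moreover have "real n * 1 \<le> real (n' + n) * \<bar>real n' - real n\<bar>"
        using ne by (intro mult_mono) (auto simp: abs_if)
      ultimately show False by simp
    qed
    moreover have "w q' = w q"
    proof (rule ccontr)
      assume "w q' \<noteq> w q"
      then have "3 * \<delta> \<le> norm (2 * w q' / of_real pi - 2 * w q / of_real pi)" by (rule \<delta>(2))
      also have "2 * w q' / of_real pi - 2 * w q / of_real pi = (lam n' q' - ((of_nat n)\<^sup>2 + 2 * w q / of_real pi))
          - (lam n' q' - ((of_nat n')\<^sup>2 + 2 * w q' / of_real pi))"
        using \<open>n' = n\<close> by simp
      also have "norm \<dots> < 2 * \<delta> + \<delta>"
      proof -
        have "norm (lam n' q' - ((of_nat n')\<^sup>2 + 2 * w q' / of_real pi)) < \<delta>"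
          using err1[of n q'] n \<open>n' = n\<close> unfolding err_def by simp
        then show ?thesis by (rule le_less_trans[OF norm_triangle_ineq4 add_strict_mono[OF close]])
      qed
      finally show False by simp
    qed
    ultimately show "n' = n \<and> w q' = w q" by blast
  qed auto
qed

section \<open>Poles and residues of the Weyl matrix\<close>

lemma Delta_holomorphic:
  fixes Q :: "real \<Rightarrow> complex^'m^'m"
  assumes "L2_potential Q"
  shows "Delta Q h H holomorphic_on S"
proof -
  have "(\<lambda>lam. det (boundary_value Q H (mat 1) h lam)) holomorphic_on S"
    by (intro holomorphic_on_det boundary_value_holomorphic assms)
  then show ?thesis by (simp add: Delta_eq_det_boundary_value[abs_def])
qed

lemma tendsto_det:
  fixes X :: "'a \<Rightarrow> complex^'m^'m"
  assumes "(X \<longlongrightarrow> A) F"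
  shows "((\<lambda>n. det (X n)) \<longlongrightarrow> det A) F"
  unfolding det_def by (intro tendsto_intros assms)

text \<open>For a fixed \<open>\<mu>\<close> different from all \<open>2 \<omega>\<^sub>j / \<pi>\<close>, the determinant of \<open>(-1)\<^sup>n V(\<phi>)\<close> at \<open>n\<^sup>2 + \<mu>\<close> tends to
the product of the nonzero numbers \<open>\<omega>\<^sub>j - \<pi> \<mu> / 2\<close>.\<close>

lemma Delta_not_identically_zero:
  fixes Q :: "real \<Rightarrow> complex^'m^'m"
  assumes A: "in_A Q h H (diag_mat w)"
  shows "\<exists>z. Delta Q h H z \<noteq> 0"
proof -
  obtain mu where mu: "mu \<notin> (\<lambda>j. 2 * w j / of_real pi) ` UNIV"
    using ex_new_if_finite[OF infinite_UNIV_char_0 finite_imageI[OF finite_class.finite_UNIV]] by blast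
  obtain e where e: "summable (\<lambda>n. (e n)\<^sup>2)"
    "\<forall>n\<ge>1. \<forall>mu'. norm mu' \<le> norm mu \<longrightarrow>
       norm ((- 1) ^ n *\<^sub>R boundary_value Q H (mat 1) h ((of_nat n)\<^sup>2 + mu') - (diag_mat w - mat (of_real (pi / 2) * mu'))) \<le> e n \<and>
       norm ((- 1) ^ n *\<^sub>R boundary_value Q H 0 (mat 1) ((of_nat n)\<^sup>2 + mu') - mat 1) \<le> e n"
    using boundary_value_l2_asymptotics[OF A norm_ge_zero[of mu]] by (elim exE conjE)
  define X where "X n = (- 1) ^ n *\<^sub>R boundary_value Q H (mat 1) h ((of_nat n)\<^sup>2 + mu)" for n
  define A0 where "A0 = (diag_mat w - mat (of_real (pi / 2) * mu) :: complex^'m^'m)"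
  have "((\<lambda>n. X n - A0) \<longlongrightarrow> 0) sequentially"
  proof (rule Lim_null_comparison)
    show "eventually (\<lambda>n. norm (X n - A0) \<le> e n) sequentially"
      using e(2) unfolding X_def A0_def eventually_sequentially by (meson order_refl)
    show "e \<longlonglongrightarrow> 0" by (rule summable_square_tendsto_0[OF e(1)])
  qed
  then have "X \<longlonglongrightarrow> A0" by (rule LIM_zero_cancel)
  then have "(\<lambda>n. det (X n)) \<longlonglongrightarrow> det A0" by (rule tendsto_det)
  moreover have "det A0 \<noteq> 0"
  proof -
    have "det A0 = (\<Prod>j\<in>UNIV. A0 $ j $ j)"
      by (rule det_diagonal) (simp add: A0_def diag_mat_def mat_def)
    moreover have "A0 $ j $ j \<noteq> 0" for j
    proof -
      have "mu \<noteq> 2 * w j / of_real pi" using mu by blast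
      then show ?thesis by (auto simp: A0_def diag_mat_def mat_def field_simps)
    qed
    ultimately show ?thesis by simp
  qed
  ultimately have "eventually (\<lambda>n. det (X n) \<noteq> 0) sequentially" by (rule tendsto_imp_eventually_ne)
  then obtain n where n: "det (X n) \<noteq> 0" unfolding eventually_sequentially by blast
  have "X n = mat (of_real ((- 1) ^ n)) ** boundary_value Q H (mat 1) h ((of_nat n)\<^sup>2 + mu)"
    by (simp add: X_def vec_eq_iff scaleR_conv_of_real[where 'a = complex])
  then have "det (boundary_value Q H (mat 1) h ((of_nat n)\<^sup>2 + mu)) \<noteq> 0"
    using n by (simp add: det_mul)
  then show ?thesis unfolding Delta_eq_det_boundary_value by blast
qed

text \<open>The multiplicity of a zero of an analytic function that does not vanish identically is positive, so
such a zero occurs in the family.\<close>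

lemma eigenvalue_in_range:
  fixes Q :: "real \<Rightarrow> complex^'m^'m"
  assumes Q: "L2_potential Q" and nz: "Delta Q h H z0 \<noteq> 0"
    and idx: "eigenvalue_indexing Q h H w lam" and z: "Delta Q h H z = 0"
  shows "\<exists>n q. lam n q = z"
proof -
  have "\<exists>w\<in>UNIV. Delta Q h H w \<noteq> 0" using nz by blast
  from zorder_exist_zero[OF Delta_holomorphic[OF Q] open_UNIV connected_UNIV UNIV_I this, of z]
  have "zorder (Delta Q h H) z > 0" using z by simp
  moreover have "int (card {(n,q). lam n q = z}) = zorder (Delta Q h H) z"
    using idx z unfolding eigenvalue_indexing_def by blast
  ultimately have "{(n,q). lam n q = z} \<noteq> {}" by fastforce
  then show ?thesis by blast
qed

text \<open>Cramer's rule exhibits the entries of the Weyl matrix as quotients of entire functions. Hence they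
have no essential singularities.\<close>

lemma Weyl_entry_eq:
  fixes Q :: "real \<Rightarrow> complex^'m^'m"
  assumes Q: "L2_potential Q" and nz: "Delta Q h H lam \<noteq> 0"
  shows "Weyl Q h H lam $ j $ k =
    det (\<chi> i l. if l = j then - boundary_value Q H 0 (mat 1) lam $ i $ k else boundary_value Q H (mat 1) h lam $ i $ l)
      / Delta Q h H lam"
  using matrix_equation_cramer[OF Weyl_equation[OF Q nz], of j k] nz
  by (simp add: Delta_eq_det_boundary_value cong: if_cong)

lemma Weyl_numerator_holomorphic:
  fixes Q :: "real \<Rightarrow> complex^'m^'m"
  assumes Q: "L2_potential Q"
  shows "(\<lambda>lam. det (\<chi> i l. if l = j then - boundary_value Q H 0 (mat 1) lam $ i $ k
      else boundary_value Q H (mat 1) h lam $ i $ l)) holomorphic_on S"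
proof (rule holomorphic_on_det)
  fix i l
  show "(\<lambda>lam. (\<chi> i l. if l = j then - boundary_value Q H 0 (mat 1) lam $ i $ k
      else boundary_value Q H (mat 1) h lam $ i $ l) $ i $ l) holomorphic_on S"
    by (cases "l = j") (auto intro!: holomorphic_intros boundary_value_holomorphic[OF Q])
qed

lemma Weyl_entry_holomorphic:
  fixes Q :: "real \<Rightarrow> complex^'m^'m"
  assumes Q: "L2_potential Q" and nz: "\<And>lam. lam \<in> S \<Longrightarrow> Delta Q h H lam \<noteq> 0"
  shows "(\<lambda>lam. Weyl Q h H lam $ j $ k) holomorphic_on S"
proof (rule holomorphic_transform)
  show "(\<lambda>lam. det (\<chi> i l. if l = j then - boundary_value Q H 0 (mat 1) lam $ i $ k
      else boundary_value Q H (mat 1) h lam $ i $ l) / Delta Q h H lam) holomorphic_on S"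
    by (intro holomorphic_on_divide Weyl_numerator_holomorphic Delta_holomorphic Q nz)
qed (simp add: Weyl_entry_eq[OF Q nz])

lemma Delta_isolated_zero:
  fixes Q :: "real \<Rightarrow> complex^'m^'m"
  assumes Q: "L2_potential Q" and z: "Delta Q h H z = 0" and z0: "Delta Q h H z0 \<noteq> 0"
  shows "\<exists>r>0. \<forall>y\<in>ball z r - {z}. Delta Q h H y \<noteq> 0"
proof (rule isolated_zeros[OF Delta_holomorphic[OF Q] open_UNIV connected_UNIV UNIV_I z UNIV_I z0])
  fix r :: real assume "0 < r" "\<And>y. y \<in> ball z r - {z} \<Longrightarrow> Delta Q h H y \<noteq> 0"
  then show "\<exists>r>0. \<forall>y\<in>ball z r - {z}. Delta Q h H y \<noteq> 0" by auto
qed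

text \<open>At a pole of the entry this is the assumption that the pole is simple. If the entry has no pole at \<open>z\<close>,
it has a finite limit there, being a quotient of analytic functions, and both sides vanish.\<close>

lemma Weyl_entry_residue_limit:
  fixes Q :: "real \<Rightarrow> complex^'m^'m"
  assumes Q: "L2_potential Q" and z: "Delta Q h H z = 0" and z0: "Delta Q h H z0 \<noteq> 0"
    and simple: "all_poles_simple (Weyl Q h H)"
  shows "((\<lambda>lam. Weyl Q h H lam $ j $ k * (lam - z)) \<longlongrightarrow> residue (\<lambda>lam. Weyl Q h H lam $ j $ k) z) (at z)"
proof -
  define g where "g lam = Weyl Q h H lam $ j $ k" for lam
  obtain r where r: "r > 0" "\<forall>y\<in>ball z r - {z}. Delta Q h H y \<noteq> 0"
    using Delta_isolated_zero[OF Q z z0] by (elim exE conjE)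
  note nz = bspec[OF r(2)]
  have hol: "g holomorphic_on ball z r - {z}"
    unfolding g_def by (rule Weyl_entry_holomorphic[OF Q nz])
  have "\<exists>c. ((\<lambda>lam. g lam * (lam - z)) \<longlongrightarrow> c) (at z)"
  proof (cases "is_pole g z")
    case True
    then have ord: "zorder g z = -1"
      using simple unfolding all_poles_simple_def g_def[abs_def] by blast
    from zorder_exist_pole[OF hol open_ball _ True] r(1) ord
    obtain s where s: "s > 0" "zor_poly g z holomorphic_on cball z s"
      "\<And>y. y \<in> cball z s - {z} \<Longrightarrow> g y = zor_poly g z y / (y - z)"
      by auto
    have "zor_poly g z holomorphic_on ball z s" using s(2) ball_subset_cball by (rule holomorphic_on_subset)
    then have "isCont (zor_poly g z) z"
      using s(1) by (meson centre_in_ball continuous_on_eq_continuous_at holomorphic_on_imp_continuous_on open_ball)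
    then have "(zor_poly g z \<longlongrightarrow> zor_poly g z z) (at z)" by (simp add: isCont_def)
    moreover have "eventually (\<lambda>y. y \<in> ball z s - {z}) (at z)"
      using eventually_at_in_open[of "ball z s" z] s(1) by simp
    then have "eventually (\<lambda>y. zor_poly g z y = g y * (y - z)) (at z)"
      by (rule eventually_mono) (use s(3) in \<open>auto simp: less_imp_le\<close>)
    ultimately have "((\<lambda>y. g y * (y - z)) \<longlongrightarrow> zor_poly g z z) (at z)"
      by (rule Lim_transform_eventually)
    then show ?thesis by blast
  next
    case False
    define num where "num lam = det (\<chi> i l. if l = j then - boundary_value Q H 0 (mat 1) lam $ i $ k
      else boundary_value Q H (mat 1) h lam $ i $ l)" for lam
    have num: "num holomorphic_on UNIV"
      unfolding num_def by (rule Weyl_numerator_holomorphic[OF Q])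
    have "not_essential (\<lambda>y. num y / Delta Q h H y) z"
      by (intro not_essential_divide not_essential_holomorphic[OF _ UNIV_I open_UNIV]
            isolated_singularity_at_holomorphic[of _ UNIV] holomorphic_on_subset[OF num] Delta_holomorphic[OF Q] num) auto
    moreover have "eventually (\<lambda>y. y \<in> ball z r - {z}) (at z)"
      using eventually_at_in_open[of "ball z r" z] r(1) by simp
    then have "eventually (\<lambda>y. g y = num y / Delta Q h H y) (at z)"
      by (rule eventually_mono) (simp add: g_def num_def Weyl_entry_eq[OF Q nz])
    ultimately have "not_essential g z" using not_essential_cong[of g _ z z] by simp
    then obtain c where "(g \<longlongrightarrow> c) (at z)" using False unfolding not_essential_def by blast
    then have "((\<lambda>lam. g lam * (lam - z)) \<longlongrightarrow> c * (z - z)) (at z)" by (intro tendsto_intros)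
    then show ?thesis by blast
  qed
  then obtain c where c: "((\<lambda>lam. g lam * (lam - z)) \<longlongrightarrow> c) (at z)" by blast
  moreover have "residue g z = c"
    by (rule residue_simple'[OF open_ball _ hol c]) (use r(1) in simp)
  ultimately show ?thesis by (simp add: g_def[abs_def])
qed

text \<open>Multiply \<open>V(\<phi>) M = - V(S)\<close> by \<open>\<lambda> - z\<close> and let \<open>\<lambda>\<close> tend to \<open>z\<close>.\<close>

lemma boundary_value_mult_residue:
  fixes Q :: "real \<Rightarrow> complex^'m^'m"
  assumes Q: "L2_potential Q" and z: "Delta Q h H z = 0" and z0: "Delta Q h H z0 \<noteq> 0"
    and simple: "all_poles_simple (Weyl Q h H)"
  shows "boundary_value Q H (mat 1) h z ** matrix_residue (Weyl Q h H) z = 0"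
proof -
  define W where "W = boundary_value Q H (mat 1) h"
  define T where "T = boundary_value Q H 0 (mat 1)"
  obtain r where r: "r > 0" "\<forall>y\<in>ball z r - {z}. Delta Q h H y \<noteq> 0"
    using Delta_isolated_zero[OF Q z z0] by (elim exE conjE)
  note nz = bspec[OF r(2)]
  have cont: "((\<lambda>y. boundary_value Q H A B y $ i $ j) \<longlongrightarrow> boundary_value Q H A B z $ i $ j) (at z)" for A B i j
    using holomorphic_on_imp_continuous_on[OF boundary_value_holomorphic[OF Q, of H A B i j UNIV]]
    by (simp add: continuous_on_eq_continuous_at isCont_def)
  have "(W z ** matrix_residue (Weyl Q h H) z) $ i $ k = 0" for i k
  proof -
    have "((\<lambda>y. \<Sum>j\<in>UNIV. W y $ i $ j * (Weyl Q h H y $ j $ k * (y - z))) \<longlongrightarrow>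
        (\<Sum>j\<in>UNIV. W z $ i $ j * residue (\<lambda>lam. Weyl Q h H lam $ j $ k) z)) (at z)"
      unfolding W_def by (intro tendsto_intros cont Weyl_entry_residue_limit[OF Q z z0 simple])
    moreover have "eventually (\<lambda>y. y \<in> ball z r - {z}) (at z)"
      using eventually_at_in_open[of "ball z r" z] r(1) by simp
    then have "eventually (\<lambda>y. (\<Sum>j\<in>UNIV. W y $ i $ j * (Weyl Q h H y $ j $ k * (y - z))) = - T y $ i $ k * (y - z)) (at z)"
    proof (rule eventually_mono)
      fix y assume "y \<in> ball z r - {z}"
      then have "(W y ** Weyl Q h H y) $ i $ k = - T y $ i $ k"
        using Weyl_equation[OF Q nz] by (simp add: W_def T_def)
      then have "(\<Sum>j\<in>UNIV. W y $ i $ j * Weyl Q h H y $ j $ k) * (y - z) = - T y $ i $ k * (y - z)"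
        by (simp add: matrix_matrix_mult_def)
      then show "(\<Sum>j\<in>UNIV. W y $ i $ j * (Weyl Q h H y $ j $ k * (y - z))) = - T y $ i $ k * (y - z)"
        by (simp add: sum_distrib_right mult.assoc)
    qed
    ultimately have "((\<lambda>y. - T y $ i $ k * (y - z)) \<longlongrightarrow>
        (\<Sum>j\<in>UNIV. W z $ i $ j * residue (\<lambda>lam. Weyl Q h H lam $ j $ k) z)) (at z)"
      by (rule Lim_transform_eventually)
    moreover have "((\<lambda>y. - T y $ i $ k * (y - z)) \<longlongrightarrow> - T z $ i $ k * (z - z)) (at z)"
      unfolding T_def by (intro tendsto_intros cont)
    ultimately have "(\<Sum>j\<in>UNIV. W z $ i $ j * residue (\<lambda>lam. Weyl Q h H lam $ j $ k) z) = - T z $ i $ k * (z - z)"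
      by (rule tendsto_unique[rotated]) simp
    then show ?thesis by (simp add: matrix_matrix_mult_def matrix_residue_def)
  qed
  then show ?thesis by (simp add: W_def vec_eq_iff)
qed

lemma norm_diag_mat_le:
  assumes "\<And>j. norm (a j) \<le> c"
  shows "norm (diag_mat a :: complex^'m^'m) \<le> real CARD('m) * c"
proof -
  have "norm (diag_mat a :: complex^'m^'m) \<le> (\<Sum>i\<in>UNIV. \<Sum>j\<in>UNIV. norm ((diag_mat a :: complex^'m^'m) $ i $ j))"
    by (rule norm_matrix_le_sum)
  also have "\<dots> = (\<Sum>i\<in>(UNIV :: 'm set). norm (a i))"
    by (simp add: diag_mat_def if_distrib cong: if_cong)
  also have "\<dots> \<le> real CARD('m) * c" using sum_bounded_above[of UNIV "\<lambda>i. norm (a i)" c] assms by simp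
  finally show ?thesis .
qed

section \<open>Asymptotics of the residues\<close>

text \<open>With \<open>A = diag_mat a\<close> the equation reads \<open>M = - A\<inverse> - A\<inverse> ((T - 1) + (X - A) M)\<close>. Smallness of
\<open>A\<inverse> (X - A)\<close> first yields \<open>norm M \<le> 2 k + 1\<close>, and then the right-hand side differs from \<open>- A\<inverse>\<close> by a
multiple of \<open>e\<close>.\<close>

lemma perturbed_diagonal_equation:
  fixes X M T :: "complex^'m^'m"
  assumes a: "\<And>j. \<rho> \<le> norm (a j)" and \<rho>: "\<rho> > 0" and eq: "X ** M = - T"
    and X: "norm (X - diag_mat a) \<le> e" and T: "norm (T - mat 1) \<le> e"
  defines "k \<equiv> real CARD('m) / \<rho>"
  assumes small: "k * e \<le> 1 / 2"
  shows "norm (M - diag_mat (\<lambda>j. - 1 / a j)) \<le> k * (2 * k + 2) * e"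
proof -
  define B where "B = (diag_mat (\<lambda>j. 1 / a j) :: complex^'m^'m)"
  have a0: "a j \<noteq> 0" for j using a[of j] \<rho> by auto
  have k: "k > 0" using \<rho> by (simp add: k_def)
  have e: "e \<ge> 0" using norm_ge_zero X by (rule order_trans)
  have nB: "norm B \<le> k"
  proof -
    have "norm B \<le> real CARD('m) * (1 / \<rho>)"
      unfolding B_def using a \<rho> by (intro norm_diag_mat_le) (simp add: norm_divide frac_le)
    then show ?thesis by (simp add: k_def)
  qed
  have BA: "B ** diag_mat a = mat 1"
    using a0 by (simp add: B_def vec_eq_iff matrix_matrix_mult_def diag_mat_def mat_def if_distrib[of "\<lambda>x. x * _"] cong: if_cong)
  have "M = B ** (diag_mat a ** M)" by (simp add: matrix_mul_assoc BA)
  also have "diag_mat a ** M = - T - (X - diag_mat a) ** M"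
    by (simp add: matrix_mult.diff_left eq)
  finally have "M + B = - (B ** ((T - mat 1) + (X - diag_mat a) ** M))"
    by (simp add: matrix_mult.diff_right matrix_mult.add_right matrix_mult.minus_right)
  then have "norm (M + B) \<le> k * (e + e * norm M)"
  proof -
    assume eq: "M + B = - (B ** ((T - mat 1) + (X - diag_mat a) ** M))"
    have "norm ((T - mat 1) + (X - diag_mat a) ** M) \<le> e + e * norm M"
      by (intro order_trans[OF norm_triangle_ineq add_mono[OF T order_trans[OF norm_matrix_mult_le mult_right_mono[OF X]]]]) simp
    then have "norm (B ** ((T - mat 1) + (X - diag_mat a) ** M)) \<le> k * (e + e * norm M)"
      using nB k by (intro order_trans[OF norm_matrix_mult_le mult_mono]) auto
    then show ?thesis by (simp add: eq)
  qed
  then have MB: "norm (M + B) \<le> k * e * (1 + norm M)" by (simp add: algebra_simps)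
  have "norm M \<le> norm (M + B) + norm B" using norm_triangle_ineq4[of "M + B" B] by simp
  also have "\<dots> \<le> 1 / 2 * (1 + norm M) + k"
    using nB by (intro add_mono order_trans[OF MB mult_right_mono[OF small]]) auto
  finally have half: "norm M \<le> 1 / 2 * (1 + norm M) + k" .
  have "x \<le> 2 * k + 1" if "x \<le> 1 / 2 * (1 + x) + k" for x :: real
    using that by (simp add: field_simps)
  from this[OF half] have "norm M \<le> 2 * k + 1" .
  then have "k * e * (1 + norm M) \<le> k * e * (2 * k + 2)" using k e by (intro mult_left_mono) auto
  with MB have "norm (M + B) \<le> k * (2 * k + 2) * e" by (simp add: ac_simps)
  moreover have "M - diag_mat (\<lambda>j. - 1 / a j) = M + B"
    by (simp add: B_def vec_eq_iff diag_mat_def)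
  ultimately show ?thesis by (simp only:)
qed

text \<open>The residue theorem for \<open>f\<close>, compared on the circle with a function \<open>g\<close> whose contour integral is known.\<close>

lemma residue_sum_estimate:
  assumes \<delta>: "\<delta> > 0" and pts: "finite pts" "pts \<subseteq> ball c \<delta>"
    and f: "f holomorphic_on ball c (2 * \<delta>) - pts"
    and g: "(g has_contour_integral 2 * of_real pi * \<i> * s) (circlepath c \<delta>)"
    and B: "B \<ge> 0" "\<And>y. norm (y - c) = \<delta> \<Longrightarrow> norm (f y - g y) \<le> B"
  shows "norm ((\<Sum>z\<in>pts. residue f z) - s) \<le> B * \<delta>"
proof -
  define p where "p = circlepath c \<delta>"
  have img: "path_image p \<subseteq> ball c (2 * \<delta>) - pts"
    using \<delta> pts(2) by (auto simp: p_def sphere_def dist_norm)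
  have "contour_integral p f = 2 * pi * \<i> * (\<Sum>z\<in>pts. winding_number p z * residue f z)"
  proof (rule Residue_theorem[OF open_ball connected_ball pts(1) f])
    show "\<forall>z. z \<notin> ball c (2 * \<delta>) \<longrightarrow> winding_number p z = 0"
      using \<delta> by (auto simp: p_def intro!: winding_number_zero_outside[of _ "cball c \<delta>"])
  qed (use img in \<open>auto simp: p_def\<close>)
  also have "(\<Sum>z\<in>pts. winding_number p z * residue f z) = (\<Sum>z\<in>pts. residue f z)"
    using pts(2) by (intro sum.cong) (auto simp: p_def winding_number_circlepath dist_norm norm_minus_commute subset_iff)
  finally have 1: "contour_integral p f = 2 * of_real pi * \<i> * (\<Sum>z\<in>pts. residue f z)" by simp
  have "f contour_integrable_on p"
    using img pts(1) by (intro contour_integrable_holomorphic_simple[OF f]) (auto simp: p_def intro!: open_Diff finite_imp_closed)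
  then have "(f has_contour_integral 2 * of_real pi * \<i> * (\<Sum>z\<in>pts. residue f z)) p"
    using 1 by (metis has_contour_integral_integral)
  then have "((\<lambda>y. f y - g y) has_contour_integral
      (2 * of_real pi * \<i> * (\<Sum>z\<in>pts. residue f z) - 2 * of_real pi * \<i> * s)) (circlepath c \<delta>)"
    unfolding p_def by (intro has_contour_integral_diff g)
  then have "norm (2 * of_real pi * \<i> * (\<Sum>z\<in>pts. residue f z) - 2 * of_real pi * \<i> * s) \<le> B * (2 * pi * \<delta>)"
    by (rule has_contour_integral_bound_circlepath[OF _ B(1) \<delta> B(2)])
  also have "2 * of_real pi * \<i> * (\<Sum>z\<in>pts. residue f z) - 2 * of_real pi * \<i> * s
      = 2 * of_real pi * \<i> * ((\<Sum>z\<in>pts. residue f z) - s)" by (simp add: algebra_simps)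
  finally have "norm (2 * of_real pi * \<i>) * norm ((\<Sum>z\<in>pts. residue f z) - s) \<le> B * (2 * pi * \<delta>)"
    by (simp only: norm_mult)
  moreover have "norm (2 * of_real pi * \<i>) = 2 * pi" by (simp add: norm_mult)
  moreover have "B * (2 * pi * \<delta>) = 2 * pi * (B * \<delta>)" by simp
  ultimately have "2 * pi * norm ((\<Sum>z\<in>pts. residue f z) - s) \<le> 2 * pi * (B * \<delta>)" by metis
  then show ?thesis by (rule mult_left_le_imp_le) simp
qed

lemma positive_separation:
  fixes w :: "'m::finite \<Rightarrow> complex"
  obtains \<delta> where "\<delta> > 0"
    "\<And>q q'. w q \<noteq> w q' \<Longrightarrow> 3 * \<delta> \<le> norm (2 * w q / of_real pi - 2 * w q' / of_real pi)"
proof -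
  define f where "f = (\<lambda>(q, q'). if w q = w q' then 1 else norm (2 * w q / of_real pi - 2 * w q' / of_real pi))"
  have pos: "f x > 0" for x by (cases x) (auto simp: f_def)
  (* The value 1 of f at pairs with equal w only keeps the minimum positive. *)
  define \<delta> where "\<delta> = Min (range f) / 3"
  have "Min (range f) \<in> range f" by (rule Min_in) auto
  then have "\<delta> > 0" using pos by (auto simp: \<delta>_def)
  moreover have "3 * \<delta> \<le> norm (2 * w q / of_real pi - 2 * w q' / of_real pi)" if "w q \<noteq> w q'" for q q'
  proof -
    have "Min (range f) \<le> f (q, q')" by (rule Min_le) auto
    then show ?thesis using that by (simp add: \<delta>_def f_def)
  qed
  ultimately show ?thesis by (rule that)
qed

text \<open>The grouped weight counts every distinct eigenvalue of the group once: the index pair representing such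
a value belongs to the same group by \<open>loc\<close>, although it need not be the pair through which the value is
written.\<close>

lemma residue_sum_eq_alpha_group:
  fixes lam :: "nat \<Rightarrow> 'm::finite \<Rightarrow> complex"
  assumes R: "representatives lam R"
    and loc: "\<And>q n' q'. q \<in> J w ms s \<Longrightarrow> lam n' q' = lam n q \<Longrightarrow> n' = n \<and> q' \<in> J w ms s"
  shows "alpha_group Q h H w lam R ms s n = (\<Sum>z\<in>lam n ` J w ms s. matrix_residue (Weyl Q h H) z)"
proof -
  define I where "I = {q \<in> J w ms s. (n, q) \<in> R}"
  have R': "inj_on (\<lambda>(n, q). lam n q) R" "(\<lambda>(n, q). lam n q) ` R = range (\<lambda>(n, q). lam n q)"
    using R by (auto simp: representatives_def bij_betw_def)
  have "inj_on (lam n) I"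
    using R'(1) by (auto simp: inj_on_def I_def)
  moreover have "lam n ` I = lam n ` J w ms s"
  proof
    show "lam n ` J w ms s \<subseteq> lam n ` I"
    proof
      fix z assume "z \<in> lam n ` J w ms s"
      then obtain q where q: "q \<in> J w ms s" "z = lam n q" by blast
      have "lam n q \<in> (\<lambda>(n, q). lam n q) ` R" unfolding R'(2) by (rule range_eqI[of _ _ "(n, q)"]) simp
      then obtain n' q' where r: "(n', q') \<in> R" "lam n' q' = lam n q" by auto
      have "n' = n" "q' \<in> J w ms s" using loc[OF q(1) r(2)] by auto
      then show "z \<in> lam n ` I" using r q(2) by (intro image_eqI[of _ _ q']) (auto simp: I_def)
    qed
  qed (auto simp: I_def)
  ultimately have "(\<Sum>z\<in>lam n ` J w ms s. matrix_residue (Weyl Q h H) z) = (\<Sum>q\<in>I. alpha Q h H lam n q)"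
    by (metis (no_types, lifting) sum.reindex_cong alpha_def)
  also have "\<dots> = alpha_group Q h H w lam R ms s n"
    unfolding alpha_group_def alpha'_def I_def by (rule sum.inter_filter) simp
  finally show ?thesis by simp
qed

lemma simple_fraction_circle_integral:
  assumes \<delta>: "\<delta> > 0" and b: "b = c \<or> 2 * \<delta> < norm (b - c)"
  shows "((\<lambda>y. a / (y - b)) has_contour_integral 2 * of_real pi * \<i> * (if b = c then a else 0)) (circlepath c \<delta>)"
proof (cases "b = c")
  case True
  have "((\<lambda>y. a / (y - c)) has_contour_integral (2 * of_real pi * \<i> * a)) (circlepath c \<delta>)"
    using Cauchy_integral_circlepath_simple[of "\<lambda>_. a" c \<delta> c] \<delta> by simp
  then show ?thesis using True by simp
next
  case False
  have "((\<lambda>y. a / (y - b)) has_contour_integral 0) (circlepath c \<delta>)"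
  proof (rule Cauchy_theorem_convex_simple)
    show "(\<lambda>y. a / (y - b)) holomorphic_on ball c (2 * \<delta>)"
      using b False by (intro holomorphic_intros) (auto simp: dist_norm norm_minus_commute)
  qed (use \<delta> in \<open>auto simp: dist_norm\<close>)
  then show ?thesis using False by simp
qed

lemma diag_mat_mult_entry: "(diag_mat a ** A) $ i $ j = a i * (A :: complex^'m^'m) $ i $ j"
  by (simp add: matrix_matrix_mult_def diag_mat_def if_distrib[of "\<lambda>x. x * _"] cong: if_cong)

lemma complement_I_group_mult_entry:
  "((mat 1 - I_group w ms s) ** A) $ i $ j = (if i \<in> J w ms s then 0 else (A :: complex^'m^'m) $ i $ j)"
proof -
  have "(mat 1 - I_group w ms s :: complex^'m^'m) = diag_mat (\<lambda>j. if j \<in> J w ms s then 0 else 1)"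
    by (simp add: vec_eq_iff I_group_def diag_mat_def mat_def)
  then show ?thesis by (simp add: diag_mat_mult_entry)
qed

text \<open>What holds for large \<open>n\<close>, with the constants fixed. The discs of radius \<open>\<delta>\<close> about the limit points
\<open>n\<^sup>2 + 2 \<omega>\<^sub>q / \<pi>\<close> contain the eigenvalues of the corresponding group, the discs of radius \<open>2 \<delta>\<close> contain no
others; \<open>e\<close> bounds the errors of the boundary matrices on the closed discs of radius \<open>\<delta>\<close>, and \<open>\<epsilon>\<close> bounds the
distances of the eigenvalues from the limit points.\<close>

locale localized_spectrum =
  fixes Q :: "real \<Rightarrow> complex^'m^'m" and h H :: "complex^'m^'m"
    and w :: "'m \<Rightarrow> complex" and lam :: "nat \<Rightarrow> 'm \<Rightarrow> complex"
    and e \<epsilon> :: "nat \<Rightarrow> real" and \<delta> :: real and N :: nat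
  assumes Q: "L2_potential Q"
    and idx: "eigenvalue_indexing Q h H w lam"
    and nonzero: "\<exists>z. Delta Q h H z \<noteq> 0"
    and e: "summable (\<lambda>n. (e n)\<^sup>2)"
    and \<epsilon>: "summable (\<lambda>n. (\<epsilon> n)\<^sup>2)"
      "\<And>n q. n \<ge> 1 \<Longrightarrow> norm (lam n q - ((of_nat n)\<^sup>2 + 2 * w q / of_real pi)) \<le> \<epsilon> n"
    and \<delta>: "\<delta> > 0"
      "\<And>q q'. w q \<noteq> w q' \<Longrightarrow> 3 * \<delta> \<le> norm (2 * w q / of_real pi - 2 * w q' / of_real pi)"
    and N: "N \<ge> 1"
      "\<And>n q. n \<ge> N \<Longrightarrow> norm (lam n q - ((of_nat n)\<^sup>2 + 2 * w q / of_real pi)) < \<delta>"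
      "\<And>n q n' q'. n \<ge> N \<Longrightarrow> norm (lam n' q' - ((of_nat n)\<^sup>2 + 2 * w q / of_real pi)) < 2 * \<delta> \<Longrightarrow> n' = n \<and> w q' = w q"
    and eW: "\<And>n lam' q. n \<ge> N \<Longrightarrow> norm (lam' - ((of_nat n)\<^sup>2 + 2 * w q / of_real pi)) \<le> \<delta> \<Longrightarrow>
       norm ((- 1) ^ n *\<^sub>R boundary_value Q H (mat 1) h lam' - diag_mat (\<lambda>j. w j - of_real (pi / 2) * (lam' - (of_nat n)\<^sup>2))) \<le> e n"
    and eT: "\<And>n lam' q. n \<ge> N \<Longrightarrow> norm (lam' - ((of_nat n)\<^sup>2 + 2 * w q / of_real pi)) \<le> \<delta> \<Longrightarrow>
       norm ((- 1) ^ n *\<^sub>R boundary_value Q H 0 (mat 1) lam' - mat 1) \<le> e n"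
begin

text \<open>On the circle of radius \<open>\<delta>\<close> about \<open>c n\<close>, the Weyl matrix differs by \<open>O(e n)\<close> from the diagonal matrix
with the entries \<open>(2 / \<pi>) / (\<lambda> - n\<^sup>2 - 2 \<omega>\<^sub>j / \<pi>)\<close>. Only the entries with \<open>j\<close> in the group have their pole
inside the circle.\<close>

lemma grouped_weight_asymptotics:
  assumes R: "representatives lam R"
  shows "\<exists>K. l2_matrix K \<and> (\<forall>n. alpha_group Q h H w lam R ms s n = (2 / pi) *\<^sub>R I_group w ms s + K n)"
proof -
  obtain z0 where z0: "Delta Q h H z0 \<noteq> 0" using nonzero by blast
  define G where "G = J w ms s"
  define c where "c n = (of_nat n)\<^sup>2 + 2 * w (ms s) / of_real pi" for n :: nat
  have G: "q \<in> G \<longleftrightarrow> w q = w (ms s)" for q by (simp add: G_def J_def)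
  (* On the circle all diagonal entries of the limit matrix have norm at least rho. *)
  define \<rho> where "\<rho> = pi / 2 * \<delta>"
  have \<rho>: "\<rho> > 0" using \<delta> by (simp add: \<rho>_def)
  define k where "k = real CARD('m) / \<rho>"
  have k: "k > 0" using \<rho> by (simp add: k_def)
  have "(\<lambda>n. k * e n) \<longlonglongrightarrow> k * 0" by (intro tendsto_intros summable_square_tendsto_0 e)
  then have "eventually (\<lambda>n. k * e n < 1 / 2) sequentially" by (rule order_tendstoD) simp
  then obtain N' where N': "\<And>n. n \<ge> N' \<Longrightarrow> k * e n \<le> 1 / 2"
    unfolding eventually_sequentially by (meson less_imp_le)
  define E where "E n = real CARD('m) * (real CARD('m) * (k * (2 * k + 2) * e n * \<delta>))" for n
  define K where "K n = alpha_group Q h H w lam R ms s n - (2 / pi) *\<^sub>R I_group w ms s" for n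
  have "norm (K n) \<le> E n" if n: "n \<ge> max N N'" for n
  proof -
    have nN: "n \<ge> N" "n \<ge> N'" using n by auto
    define pts where "pts = lam n ` G"
    have close: "norm (lam n q - c n) < \<delta>" if "q \<in> G" for q
      using N(2)[OF nN(1), of q] that by (simp add: c_def G)
    have loc: "n' = n \<and> q' \<in> G" if "norm (lam n' q' - c n) < 2 * \<delta>" for n' q'
      using N(3)[OF nN(1), of n' q' "ms s"] that by (simp add: c_def G)
    have ag: "alpha_group Q h H w lam R ms s n = (\<Sum>z\<in>pts. matrix_residue (Weyl Q h H) z)"
      unfolding pts_def G_def
    proof (rule residue_sum_eq_alpha_group[OF R])
      fix q n' q' assume q: "q \<in> J w ms s" "lam n' q' = lam n q"
      then have "norm (lam n' q' - c n) < 2 * \<delta>" using close[of q] \<delta>(1) by (simp add: G_def)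
      then show "n' = n \<and> q' \<in> J w ms s" using loc by (simp add: G_def)
    qed
    (* A zero of Delta in the larger disc is an eigenvalue, and localization puts it into the group. *)
    have nz: "Delta Q h H y \<noteq> 0" if y: "y \<in> ball (c n) (2 * \<delta>) - pts" for y
    proof
      assume "Delta Q h H y = 0"
      then obtain n' q' where "lam n' q' = y" using eigenvalue_in_range[OF Q z0 idx] by blast
      moreover have "norm (y - c n) < 2 * \<delta>" using y by (simp add: dist_norm norm_minus_commute)
      ultimately have "n' = n \<and> q' \<in> G" using loc by blast
      then show False using y \<open>lam n' q' = y\<close> by (auto simp: pts_def)
    qed
    have pts: "finite pts" "pts \<subseteq> ball (c n) \<delta>"
      using close by (auto simp: pts_def dist_norm norm_minus_commute)
    define M0 where "M0 y = (diag_mat (\<lambda>j. - 1 / (w j - of_real (pi / 2) * (y - (of_nat n)\<^sup>2))) :: complex^'m^'m)" for y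
    have circ: "norm (Weyl Q h H y - M0 y) \<le> k * (2 * k + 2) * e n" if y: "norm (y - c n) = \<delta>" for y
      unfolding M0_def k_def
    proof (rule perturbed_diagonal_equation[OF _ \<rho>])
      show "\<rho> \<le> norm (w j - of_real (pi / 2) * (y - (of_nat n)\<^sup>2))" for j
      proof -
        have "w j - of_real (pi / 2) * (y - (of_nat n)\<^sup>2)
            = of_real (pi / 2) * ((2 * w j / of_real pi - 2 * w (ms s) / of_real pi) - (y - c n))"
          by (simp add: c_def field_simps)
        also have "norm \<dots> = pi / 2 * norm ((2 * w j / of_real pi - 2 * w (ms s) / of_real pi) - (y - c n))"
          by (simp only: norm_mult norm_of_real) simp
        also have "\<dots> \<ge> pi / 2 * \<delta>"
        proof (intro mult_left_mono)
          show "\<delta> \<le> norm ((2 * w j / of_real pi - 2 * w (ms s) / of_real pi) - (y - c n))"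
          proof (cases "w j = w (ms s)")
            case True
            then show ?thesis using y by (simp add: norm_minus_commute)
          next
            case False
            then show ?thesis
              using \<delta>(2)[OF False] y \<delta>(1) norm_triangle_ineq2[of "2 * w j / of_real pi - 2 * w (ms s) / of_real pi" "y - c n"] by linarith
          qed
        qed simp
        finally show ?thesis by (simp add: \<rho>_def)
      qed
      have le: "norm (y - ((of_nat n)\<^sup>2 + 2 * w (ms s) / of_real pi)) \<le> \<delta>" using y by (simp add: c_def)
      show "norm ((- 1) ^ n *\<^sub>R boundary_value Q H (mat 1) h y - diag_mat (\<lambda>j. w j - of_real (pi / 2) * (y - (of_nat n)\<^sup>2))) \<le> e n"
        by (rule eW[OF nN(1) le])
      show "norm ((- 1) ^ n *\<^sub>R boundary_value Q H 0 (mat 1) y - mat 1) \<le> e n"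
        by (rule eT[OF nN(1) le])
      have "y \<in> ball (c n) (2 * \<delta>) - pts" using y pts(2) \<delta>(1) by (auto simp: dist_norm norm_minus_commute)
      from Weyl_equation[OF Q nz[OF this]]
      show "(- 1) ^ n *\<^sub>R boundary_value Q H (mat 1) h y ** Weyl Q h H y = - ((- 1) ^ n *\<^sub>R boundary_value Q H 0 (mat 1) y)"
        by (simp add: matrix_mult.scaleR_left)
      show "real CARD('m) / \<rho> * e n \<le> 1 / 2" using N'[OF nN(2)] by (simp add: k_def)
    qed
    have e0: "e n \<ge> 0" using eT[OF nN(1), of "lam n (ms s)" "ms s"] N(2)[OF nN(1), of "ms s"]
      by (meson less_imp_le norm_ge_zero order_trans)
    have entry: "norm (K n $ i $ j) \<le> k * (2 * k + 2) * e n * \<delta>" for i j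
    proof -
      define a where "a = (if i = j then complex_of_real (2 / pi) else 0)"
      define b where "b = (of_nat n)\<^sup>2 + 2 * w i / of_real pi"
      have M0ij: "M0 y $ i $ j = a / (y - b)" if "y \<noteq> b" for y
      proof (cases "i = j")
        case True
        have "M0 y $ i $ j = - 1 / (w i - of_real (pi / 2) * (y - (of_nat n)\<^sup>2))"
          unfolding M0_def diag_mat_def True by (simp only: vec_lambda_beta if_True refl)
        also have "w i - of_real (pi / 2) * (y - (of_nat n)\<^sup>2) = - (of_real (pi / 2) * (y - b))"
          by (simp add: b_def field_simps)
        also have "- 1 / - (of_real (pi / 2) * (y - b)) = a / (y - b)"
          using True that by (simp add: a_def divide_simps)
        finally show ?thesis .
      next
        case False
        then show ?thesis by (simp add: M0_def diag_mat_def a_def)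
      qed
      have bc: "b = c n \<longleftrightarrow> i \<in> G" by (simp add: b_def c_def G)
      have far: "b = c n \<or> 2 * \<delta> < norm (b - c n)"
      proof (cases "w i = w (ms s)")
        case False
        then show ?thesis using \<delta>(2)[OF False] \<delta>(1) by (simp add: b_def c_def)
      qed (simp add: b_def c_def)
      have "norm ((\<Sum>z\<in>pts. residue (\<lambda>y. Weyl Q h H y $ i $ j) z) - (if b = c n then a else 0)) \<le> (k * (2 * k + 2) * e n) * \<delta>"
      proof (rule residue_sum_estimate[OF \<delta>(1) pts _ simple_fraction_circle_integral[OF \<delta>(1) far]])
        show "(\<lambda>y. Weyl Q h H y $ i $ j) holomorphic_on ball (c n) (2 * \<delta>) - pts"
          by (rule Weyl_entry_holomorphic[OF Q nz])
        show "0 \<le> k * (2 * k + 2) * e n" using k e0 by simp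
        fix y assume y: "norm (y - c n) = \<delta>"
        then have "y \<noteq> b" using far \<delta>(1) by auto
        have "norm (Weyl Q h H y $ i $ j - M0 y $ i $ j) \<le> norm (Weyl Q h H y - M0 y)"
          using norm_entry_le[of "Weyl Q h H y - M0 y" i j] by simp
        also have "\<dots> \<le> k * (2 * k + 2) * e n" by (rule circ[OF y])
        finally show "norm (Weyl Q h H y $ i $ j - a / (y - b)) \<le> k * (2 * k + 2) * e n"
          by (simp add: M0ij[OF \<open>y \<noteq> b\<close>])
      qed
      also have "(\<Sum>z\<in>pts. residue (\<lambda>y. Weyl Q h H y $ i $ j) z) - (if b = c n then a else 0) = K n $ i $ j"
        by (simp add: K_def ag matrix_residue_def I_group_def diag_mat_def bc a_def G_def[symmetric] scaleR_conv_of_real[where 'a = complex])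
      finally show ?thesis .
    qed
    have "norm (K n) \<le> (\<Sum>i\<in>UNIV. \<Sum>j\<in>UNIV. norm (K n $ i $ j))" by (rule norm_matrix_le_sum)
    also have "\<dots> \<le> (\<Sum>i\<in>(UNIV :: 'm set). \<Sum>j\<in>(UNIV :: 'm set). k * (2 * k + 2) * e n * \<delta>)"
      by (intro sum_mono entry)
    also have "\<dots> = E n" by (simp add: E_def)
    finally show ?thesis .
  qed
  moreover have "summable (\<lambda>n. (E n)\<^sup>2)"
  proof -
    have "E n = (real CARD('m) * (real CARD('m) * (k * (2 * k + 2) * \<delta>))) * e n" for n by (simp add: E_def)
    then show ?thesis by (simp only:) (rule summable_square_mult[OF e])
  qed
  ultimately have "l2_matrix K" by (intro l2_matrixI)
  then show ?thesis by (intro exI[of _ K]) (simp add: K_def)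
qed

text \<open>The \<open>i\<close>-th row of \<open>V(\<phi>) \<alpha> = 0\<close> says that \<open>\<omega>\<^sub>i - \<omega>\<^sub>q\<close> times the \<open>i\<close>-th row of \<open>\<alpha>\<close> is of the size of
the errors; outside the group \<open>\<omega>\<^sub>i - \<omega>\<^sub>q\<close> is bounded away from zero.\<close>

lemma off_group_weight_asymptotics:
  assumes simple: "all_poles_simple (Weyl Q h H)"
    and Ca: "\<And>n. mnorm (alpha Q h H lam n q) \<le> Ca" and q: "q \<in> J w ms s"
  shows "\<exists>K. l2_matrix K \<and> (\<forall>n. (mat 1 - I_group w ms s) ** alpha Q h H lam n q = K n)"
proof -
  obtain z0 where z0: "Delta Q h H z0 \<noteq> 0" using nonzero by blast
  have lam0: "Delta Q h H (lam n q) = 0" for n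
    using idx unfolding eigenvalue_indexing_def by blast
  define b where "b = real CARD('m) * Ca"
  have nalpha: "norm (alpha Q h H lam n q) \<le> b" for n
    unfolding b_def by (rule order_trans[OF norm_le_mnorm mult_left_mono[OF Ca]]) simp
  have b: "b \<ge> 0" using order_trans[OF norm_ge_zero nalpha] .
  (* A lower bound for the distances between different values of w. *)
  define r where "r = 3 * \<delta> * (pi / 2)"
  have r: "r > 0" using \<delta> by (simp add: r_def)
  define E where "E n = real CARD('m) * (real CARD('m) * ((e n + pi / 2 * \<epsilon> n) * b / r))" for n
  define K where "K n = (mat 1 - I_group w ms s) ** alpha Q h H lam n q" for n
  have "norm (K n) \<le> E n" if n: "n \<ge> N" for n
  proof -
    define z where "z = lam n q"
    define \<alpha> where "\<alpha> = alpha Q h H lam n q"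
    define d where "d = z - ((of_nat n)\<^sup>2 + 2 * w q / of_real pi)"
    have d: "norm d < \<delta>" "norm d \<le> \<epsilon> n"
      using N(2)[OF n, of q] \<epsilon>(2)[of n q] n N(1) by (auto simp: d_def z_def)
    define X where "X = (- 1) ^ n *\<^sub>R boundary_value Q H (mat 1) h z"
    have X\<alpha>: "X ** \<alpha> = 0"
      using boundary_value_mult_residue[OF Q lam0 z0 simple, of n]
      by (simp add: X_def \<alpha>_def alpha_def z_def matrix_mult.scaleR_left)
    define a where "a j = w j - of_real (pi / 2) * (z - (of_nat n)\<^sup>2)" for j
    have Xa: "norm (X - diag_mat a) \<le> e n"
      unfolding X_def a_def by (rule eW[OF n less_imp_le[OF d(1)[unfolded d_def]]])
    have e0: "e n \<ge> 0" by (rule order_trans[OF norm_ge_zero Xa])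
    have a: "a j = (w j - w q) - of_real (pi / 2) * d" for j
      by (simp add: a_def d_def field_simps)
    have "diag_mat a ** \<alpha> = - ((X - diag_mat a) ** \<alpha>)"
      by (simp add: matrix_mult.diff_left X\<alpha>)
    then have "norm (diag_mat a ** \<alpha>) \<le> e n * b"
      using order_trans[OF norm_matrix_mult_le mult_mono[OF Xa nalpha[of n] e0 norm_ge_zero]] by (simp add: \<alpha>_def)
    then have aj: "norm (a i * \<alpha> $ i $ j) \<le> e n * b" for i j
      using order_trans[OF norm_entry_le[of "diag_mat a ** \<alpha>" i j]]
      by (simp add: diag_mat_mult_entry)
    have entry: "norm (K n $ i $ j) \<le> (e n + pi / 2 * \<epsilon> n) * b / r" for i j
    proof (cases "i \<in> J w ms s")
      case True
      have "K n $ i $ j = 0"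
        using True by (simp add: K_def complement_I_group_mult_entry)
      then show ?thesis using e0 order_trans[OF norm_ge_zero d(2)] b r by simp
    next
      case False
      have Kij: "K n $ i $ j = \<alpha> $ i $ j"
        using False by (simp add: K_def \<alpha>_def complement_I_group_mult_entry)
      have wne: "w i \<noteq> w q" using False q by (simp add: J_def)
      have "r \<le> norm (w i - w q)"
      proof -
        have "2 * w i / of_real pi - 2 * w q / of_real pi = of_real (2 / pi) * (w i - w q)" by (simp add: field_simps)
        then have "norm (2 * w i / of_real pi - 2 * w q / of_real pi) = 2 / pi * norm (w i - w q)"
          by (simp only: norm_mult norm_of_real) simp
        then have "3 * \<delta> \<le> 2 / pi * norm (w i - w q)" using \<delta>(2)[OF wne] by simp
        then show ?thesis by (simp add: r_def field_simps)
      qed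
      then have "r * norm (\<alpha> $ i $ j) \<le> norm ((w i - w q) * \<alpha> $ i $ j)"
        by (simp add: norm_mult mult_right_mono)
      also have "(w i - w q) * \<alpha> $ i $ j = a i * \<alpha> $ i $ j + of_real (pi / 2) * d * \<alpha> $ i $ j"
        by (simp add: a algebra_simps)
      also have "norm \<dots> \<le> e n * b + pi / 2 * \<epsilon> n * b"
      proof (rule order_trans[OF norm_triangle_ineq add_mono[OF aj]])
        have "norm (\<alpha> $ i $ j) \<le> b" using order_trans[OF norm_entry_le nalpha] by (simp add: \<alpha>_def)
        then have "pi / 2 * norm d * norm (\<alpha> $ i $ j) \<le> pi / 2 * \<epsilon> n * b"
          using d(2) order_trans[OF norm_ge_zero d(2)] by (intro mult_mono) auto
        then show "norm (of_real (pi / 2) * d * \<alpha> $ i $ j) \<le> pi / 2 * \<epsilon> n * b"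
          by (simp only: norm_mult norm_of_real) simp
      qed
      finally show ?thesis using r by (simp add: Kij field_simps)
    qed
    have "norm (K n) \<le> (\<Sum>i\<in>UNIV. \<Sum>j\<in>UNIV. norm (K n $ i $ j))" by (rule norm_matrix_le_sum)
    also have "\<dots> \<le> (\<Sum>i\<in>(UNIV :: 'm set). \<Sum>j\<in>(UNIV :: 'm set). (e n + pi / 2 * \<epsilon> n) * b / r)"
      by (intro sum_mono entry)
    also have "\<dots> = E n" by (simp add: E_def)
    finally show ?thesis .
  qed
  moreover have "summable (\<lambda>n. (E n)\<^sup>2)"
  proof -
    have "E n = (real CARD('m) * (real CARD('m) * (b / r))) * (e n + pi / 2 * \<epsilon> n)" for n by (simp add: E_def)
    then show ?thesis by (simp only:) (intro summable_square_mult summable_square_add e \<epsilon>(1))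
  qed
  ultimately have "l2_matrix K" by (intro l2_matrixI)
  then show ?thesis by (intro exI[of _ K]) (simp add: K_def)
qed

end

theorem lemma2:
  fixes Q :: "real \<Rightarrow> complex^'m^'m" and h H :: "complex^'m^'m"
    and w :: "'m \<Rightarrow> complex" and lam :: "nat \<Rightarrow> 'm \<Rightarrow> complex"
    and R :: "(nat \<times> 'm) set" and p :: nat and ms :: "nat \<Rightarrow> 'm"
  assumes "eigenvalue_indexing Q h H w lam"
    and "in_A12 Q h H (diag_mat w) lam"
    and "representatives lam R"
    and "distinct_value_indices w p ms"
  shows "(\<forall>s\<in>{1..p}. \<exists>K. l2_matrix K \<and>
            (\<forall>n. alpha_group Q h H w lam R ms s n = (2 / pi) *\<^sub>R I_group w ms s + K n)) \<and>
         (\<forall>s\<in>{1..p}. \<forall>q\<in>J w ms s. \<exists>K. l2_matrix K \<and>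
            (\<forall>n. (mat 1 - I_group w ms s) ** alpha Q h H lam n q = K n))"
proof -
  have A: "in_A Q h H (diag_mat w)" and simple: "all_poles_simple (Weyl Q h H)"
    using assms(2) by (auto simp: in_A12_def)
  have Q: "L2_potential Q" using A by (simp add: in_A_def)
  obtain Ca where Ca: "\<And>n q. mnorm (alpha Q h H lam n q) \<le> Ca"
    using assms(2) unfolding in_A12_def by blast
  obtain \<epsilon> where \<epsilon>: "summable (\<lambda>n. (\<epsilon> n)\<^sup>2)"
    "\<And>n q. n \<ge> 1 \<Longrightarrow> norm (lam n q - ((of_nat n)\<^sup>2 + 2 * w q / of_real pi)) \<le> \<epsilon> n"
    using eigenvalue_l2_asymptotics[OF assms(1)] by metis
  obtain \<delta> where \<delta>: "\<delta> > 0"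
    "\<And>q q'. w q \<noteq> w q' \<Longrightarrow> 3 * \<delta> \<le> norm (2 * w q / of_real pi - 2 * w q' / of_real pi)"
    using positive_separation[of w] by metis
  obtain N where N: "N \<ge> 1"
    "\<And>n q. n \<ge> N \<Longrightarrow> norm (lam n q - ((of_nat n)\<^sup>2 + 2 * w q / of_real pi)) < \<delta>"
    "\<And>n q n' q'. n \<ge> N \<Longrightarrow> norm (lam n' q' - ((of_nat n)\<^sup>2 + 2 * w q / of_real pi)) < 2 * \<delta> \<Longrightarrow> n' = n \<and> w q' = w q"
    using eigenvalue_localization[where w = w and lam = lam and \<epsilon> = \<epsilon> and \<delta> = \<delta>, OF summable_square_tendsto_0[OF \<epsilon>(1)] \<epsilon>(2) \<delta>] by metis
  (* The parameters mu = lam - n^2 that occur on the discs of radius delta have norm at most R0. *)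
  define R0 where "R0 = Max (range (\<lambda>q. norm (2 * w q / of_real pi))) + \<delta>"
  have R0: "norm (2 * w q / of_real pi) + \<delta> \<le> R0" for q
    unfolding R0_def by (intro add_right_mono Max_ge) auto
  have R0': "R0 \<ge> 0" using R0[of undefined] \<delta>(1) norm_ge_zero[of "2 * w undefined / of_real pi"] by linarith
  obtain e where e: "summable (\<lambda>n. (e n)\<^sup>2)"
    and e_all: "\<forall>n\<ge>1. \<forall>mu. norm mu \<le> R0 \<longrightarrow>
       norm ((- 1) ^ n *\<^sub>R boundary_value Q H (mat 1) h ((of_nat n)\<^sup>2 + mu) - (diag_mat w - mat (of_real (pi / 2) * mu))) \<le> e n \<and>
       norm ((- 1) ^ n *\<^sub>R boundary_value Q H 0 (mat 1) ((of_nat n)\<^sup>2 + mu) - mat 1) \<le> e n"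
    using boundary_value_l2_asymptotics[OF A R0'] by (elim exE conjE)
  have eW: "norm ((- 1) ^ n *\<^sub>R boundary_value Q H (mat 1) h lam' - diag_mat (\<lambda>j. w j - of_real (pi / 2) * (lam' - (of_nat n)\<^sup>2))) \<le> e n"
    and eT: "norm ((- 1) ^ n *\<^sub>R boundary_value Q H 0 (mat 1) lam' - mat 1) \<le> e n"
    if n: "n \<ge> N" and close: "norm (lam' - ((of_nat n)\<^sup>2 + 2 * w q / of_real pi)) \<le> \<delta>" for n lam' q
  proof -
    define mu where "mu = lam' - (of_nat n)\<^sup>2"
    have "norm mu \<le> norm (2 * w q / of_real pi) + norm (lam' - ((of_nat n)\<^sup>2 + 2 * w q / of_real pi))"
      using norm_triangle_ineq[of "2 * w q / of_real pi" "lam' - ((of_nat n)\<^sup>2 + 2 * w q / of_real pi)"] by (simp add: mu_def)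
    then have mu: "norm mu \<le> R0" using close R0[of q] by linarith
    have lam_eq: "lam' = (of_nat n)\<^sup>2 + mu" by (simp add: mu_def)
    have diag_eq: "(diag_mat w - mat (of_real (pi / 2) * mu) :: complex^'m^'m) = diag_mat (\<lambda>j. w j - of_real (pi / 2) * mu)"
      by (simp add: vec_eq_iff diag_mat_def mat_def)
    have n1: "1 \<le> n" using n N(1) by linarith
    note both = e_all[rule_format, OF n1 mu, unfolded diag_eq, folded lam_eq, unfolded mu_def]
    show "norm ((- 1) ^ n *\<^sub>R boundary_value Q H (mat 1) h lam' - diag_mat (\<lambda>j. w j - of_real (pi / 2) * (lam' - (of_nat n)\<^sup>2))) \<le> e n"
      by (rule conjunct1[OF both])
    show "norm ((- 1) ^ n *\<^sub>R boundary_value Q H 0 (mat 1) lam' - mat 1) \<le> e n"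
      by (rule conjunct2[OF both])
  qed
  interpret localized_spectrum Q h H w lam e \<epsilon> \<delta> N
    by (unfold_locales; fact Q assms(1) Delta_not_identically_zero[OF A] e \<epsilon> \<delta> N eW eT)
  show ?thesis
    using grouped_weight_asymptotics[OF assms(3)] off_group_weight_asymptotics[OF simple Ca] by blast
qed

end
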